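(* Let $\mathcal{T}$ be a triangulated category and $\mathcal{X}$ a rigid subcategory of $\mathcal{T}$. (i) If $\mathcal{X}$ is contravariantly finite, then the following are equivalent: (a) the homological functor $\mathsf{H}:\mathcal{T}\to\mathrm{mod}\text{-}\mathcal{X}$ is full; (b) $\mathcal{T}=(\mathcal{X}\star\mathcal{X}[1])\oplus\mathcal{X}^{\bot}$; (c) $\mathcal{T}/\mathcal{X}^{\bot}$ is abelian. (ii) If $\mathcal{X}$ is covariantly finite, then the following are equivalent: (a) the cohomological functor $\mathsf{H}^{\mathrm{op}}:\mathcal{T}^{\mathrm{op}}\to\mathcal{X}\text{-}\mathrm{mod}$ is full; (b) $\mathcal{T}=(\mathcal{X}[-1]\star\mathcal{X})\oplus{}^{\bot}\mathcal{X}$; (c) $\mathcal{T}/{}^{\bot}\mathcal{X}$ is abelian.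
   Context: $\mathcal{T}$ has split idempotents and shift $[1]$; subcategories are full, additive, closed under isomorphisms and direct summands. $\mathcal{X}$ is contravariantly finite if every $A\in\mathcal{T}$ admits a map $X_A\to A$, $X_A\in\mathcal{X}$, with $\mathcal{T}(\mathcal{X},X_A)\to\mathcal{T}(\mathcal{X},A)$ surjective; covariantly finite is dual. $\mathcal{X}$ is rigid if $\mathcal{T}(\mathcal{X},\mathcal{X}[1])=0$. $\mathcal{X}^{\bot}=\{A\mid\mathcal{T}(\mathcal{X},A)=0\}$, ${}^{\bot}\mathcal{X}=\{A\mid\mathcal{T}(A,\mathcal{X})=0\}$. For a subcategory $\mathcal{Z}$, $\mathcal{T}/\mathcal{Z}$ has the objects of $\mathcal{T}$ and morphisms those of $\mathcal{T}$ modulo maps factoring through an object of $\mathcal{Z}$. $\mathcal{U}\star\mathcal{V}$ is the full subcategory of all direct summands of objects $A$ for which there is a triangle $U\to A\to V\to U[1]$ with $U\in\mathcal{U}$, $V\in\mathcal{V}$. $\mathcal{A}\oplus\mathcal{B}$ is the full subcategory of all direct summands of direct sums $A\oplus B$ with $A\in\mathcal{A}$, $B\in\mathcal{B}$. $\mathrm{mod}\text{-}\mathcal{X}$ is the category of coherent functors $\mathcal{X}^{\mathrm{op}}\to\mathrm{Ab}$, i.e. cokernels of maps $\mathcal{X}(-,X^1)\to\mathcal{X}(-,X^0)$, and $\mathcal{X}\text{-}\mathrm{mod}=\mathrm{mod}\text{-}\mathcal{X}^{\mathrm{op}}$. $\mathsf{H}(A)=\mathcal{T}(-,A)|_{\mathcal{X}}$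 and $\mathsf{H}^{\mathrm{op}}(A)=\mathcal{T}(A,-)|_{\mathcal{X}}$. *)

theory Defs
  imports "HOL-Algebra.Coset" "HOL-Library.FuncSet"
begin

section \<open>Categories, functors, natural transformations\<close>

record ('o, 'm) cat =
  Obj  :: "'o set"
  Arr  :: "'m set"
  Dom  :: "'m \<Rightarrow> 'o"
  Cod  :: "'m \<Rightarrow> 'o"
  Ide  :: "'o \<Rightarrow> 'm"
  Comp :: "'m \<Rightarrow> 'm \<Rightarrow> 'm"  (infixr \<open>\<cdot>\<index>\<close> 70)

text \<open>Composition is written in the usual order: \<open>g \<cdot> f\<close> is ``first \<open>f\<close>, then \<open>g\<close>''.\<close>

definition Hom :: "('o, 'm, 'z) cat_scheme \<Rightarrow> 'o \<Rightarrow> 'o \<Rightarrow> 'm set" where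
  "Hom C A B = {f \<in> Arr C. Dom C f = A \<and> Cod C f = B}"

locale category =
  fixes C :: "('o, 'm, 'z) cat_scheme" (structure)
  assumes Dom_closed: "f \<in> Arr C \<Longrightarrow> Dom C f \<in> Obj C"
    and Cod_closed: "f \<in> Arr C \<Longrightarrow> Cod C f \<in> Obj C"
    and Ide_closed: "A \<in> Obj C \<Longrightarrow> Ide C A \<in> Hom C A A"
    and Comp_closed: "\<lbrakk>f \<in> Hom C A B; g \<in> Hom C B D\<rbrakk> \<Longrightarrow> g \<cdot> f \<in> Hom C A D"
    and Ide_left: "f \<in> Hom C A B \<Longrightarrow> Ide C B \<cdot> f = f"
    and Ide_right: "f \<in> Hom C A B \<Longrightarrow> f \<cdot> Ide C A = f"
    and Comp_assoc: "\<lbrakk>f \<in> Hom C A B; g \<in> Hom C B D; h \<in> Hom C D E\<rbrakk>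
           \<Longrightarrow> h \<cdot> (g \<cdot> f) = (h \<cdot> g) \<cdot> f"

definition is_iso :: "('o, 'm, 'z) cat_scheme \<Rightarrow> 'm \<Rightarrow> bool" where
  "is_iso C f \<longleftrightarrow> f \<in> Arr C \<and> (\<exists>g \<in> Hom C (Cod C f) (Dom C f).
      g \<cdot>\<^bsub>C\<^esub> f = Ide C (Dom C f) \<and> f \<cdot>\<^bsub>C\<^esub> g = Ide C (Cod C f))"

definition isomorphic :: "('o, 'm, 'z) cat_scheme \<Rightarrow> 'o \<Rightarrow> 'o \<Rightarrow> bool" where
  "isomorphic C A B \<longleftrightarrow> (\<exists>f \<in> Hom C A B. is_iso C f)"

definition full_subcat :: "('o, 'm, 'z) cat_scheme \<Rightarrow> 'o set \<Rightarrow> ('o, 'm) cat" where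
  "full_subcat C X = \<lparr>Obj = X \<inter> Obj C, Arr = {f \<in> Arr C. Dom C f \<in> X \<and> Cod C f \<in> X},
     Dom = Dom C, Cod = Cod C, Ide = Ide C, Comp = Comp C\<rparr>"

definition op_cat :: "('o, 'm, 'z) cat_scheme \<Rightarrow> ('o, 'm) cat" where
  "op_cat C = \<lparr>Obj = Obj C, Arr = Arr C, Dom = Cod C, Cod = Dom C, Ide = Ide C,
     Comp = (\<lambda>g f. f \<cdot>\<^bsub>C\<^esub> g)\<rparr>"

record ('o, 'm, 'p, 'n) ftr =
  FObj :: "'o \<Rightarrow> 'p"
  FArr :: "'m \<Rightarrow> 'n"

definition is_functor ::
  "('o, 'm, 'y) cat_scheme \<Rightarrow> ('p, 'n, 'z) cat_scheme \<Rightarrow> ('o, 'm, 'p, 'n) ftr \<Rightarrow> bool" where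
  "is_functor C D F \<longleftrightarrow>
     (\<forall>A \<in> Obj C. FObj F A \<in> Obj D \<and> FArr F (Ide C A) = Ide D (FObj F A)) \<and>
     (\<forall>f \<in> Arr C. FArr F f \<in> Hom D (FObj F (Dom C f)) (FObj F (Cod C f))) \<and>
     (\<forall>f \<in> Arr C. \<forall>g \<in> Arr C. Cod C f = Dom C g \<longrightarrow>
        FArr F (g \<cdot>\<^bsub>C\<^esub> f) = FArr F g \<cdot>\<^bsub>D\<^esub> FArr F f)"

definition full_functor ::
  "('o, 'm, 'y) cat_scheme \<Rightarrow> ('p, 'n, 'z) cat_scheme \<Rightarrow> ('o, 'm, 'p, 'n) ftr \<Rightarrow> bool" where
  "full_functor C D F \<longleftrightarrow> is_functor C D F \<and>
     (\<forall>A \<in> Obj C. \<forall>B \<in> Obj C. \<forall>h \<in> Hom D (FObj F A) (FObj F B). \<exists>f \<in> Hom C A B. FArr F f = h)"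

definition faithful_functor ::
  "('o, 'm, 'y) cat_scheme \<Rightarrow> ('p, 'n, 'z) cat_scheme \<Rightarrow> ('o, 'm, 'p, 'n) ftr \<Rightarrow> bool" where
  "faithful_functor C D F \<longleftrightarrow> is_functor C D F \<and>
     (\<forall>A \<in> Obj C. \<forall>B \<in> Obj C. inj_on (FArr F) (Hom C A B))"

definition ess_surjective ::
  "('o, 'm, 'y) cat_scheme \<Rightarrow> ('p, 'n, 'z) cat_scheme \<Rightarrow> ('o, 'm, 'p, 'n) ftr \<Rightarrow> bool" where
  "ess_surjective C D F \<longleftrightarrow> (\<forall>B \<in> Obj D. \<exists>A \<in> Obj C. isomorphic D (FObj F A) B)"

definition nat_trans ::
  "('o, 'm, 'y) cat_scheme \<Rightarrow> ('p, 'n, 'z) cat_scheme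
     \<Rightarrow> ('o, 'm, 'p, 'n) ftr \<Rightarrow> ('o \<Rightarrow> 'n) \<Rightarrow> ('o, 'm, 'p, 'n) ftr \<Rightarrow> bool" where
  "nat_trans C D F \<eta> G \<longleftrightarrow>
     (\<forall>A \<in> Obj C. \<eta> A \<in> Hom D (FObj F A) (FObj G A)) \<and>
     (\<forall>f \<in> Arr C. \<eta> (Cod C f) \<cdot>\<^bsub>D\<^esub> FArr F f = FArr G f \<cdot>\<^bsub>D\<^esub> \<eta> (Dom C f))"

text \<open>Functors and natural transformations are normalised to be \<open>undefined\<close> outside their
  domains (\<open>extensional\<close>), so that HOL equality is equality of functors, resp. transformations.\<close>

definition functor_cat ::
  "('o, 'm, 'y) cat_scheme \<Rightarrow> ('p, 'n, 'z) cat_scheme \<Rightarrow>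
     (('o, 'm, 'p, 'n) ftr, ('o, 'm, 'p, 'n) ftr \<times> ('o \<Rightarrow> 'n) \<times> ('o, 'm, 'p, 'n) ftr) cat" where
  "functor_cat C D =
     (let Fs = {F. is_functor C D F \<and> FObj F \<in> extensional (Obj C) \<and> FArr F \<in> extensional (Arr C)}
      in \<lparr>Obj = Fs,
          Arr = {(F, \<eta>, G). F \<in> Fs \<and> G \<in> Fs \<and> \<eta> \<in> extensional (Obj C) \<and> nat_trans C D F \<eta> G},
          Dom = (\<lambda>(F, \<eta>, G). F),
          Cod = (\<lambda>(F, \<eta>, G). G),
          Ide = (\<lambda>F. (F, (\<lambda>A \<in> Obj C. Ide D (FObj F A)), F)),
          Comp = (\<lambda>(G', \<theta>, K) (F, \<eta>, G). (F, (\<lambda>A \<in> Obj C. \<theta> A \<cdot>\<^bsub>D\<^esub> \<eta> A), K))\<rparr>)"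

text \<open>The category of (multiplicatively written) abelian groups with elements in type \<open>'g\<close>;
  an arrow is a homomorphism together with its source and target.\<close>

definition Ab_cat :: "('g monoid, 'g monoid \<times> ('g \<Rightarrow> 'g) \<times> 'g monoid) cat" where
  "Ab_cat = \<lparr>Obj = {G. comm_group G},
     Arr = {(G, f, H). comm_group G \<and> comm_group H \<and> f \<in> hom G H \<inter> extensional (carrier G)},
     Dom = (\<lambda>(G, f, H). G),
     Cod = (\<lambda>(G, f, H). H),
     Ide = (\<lambda>G. (G, (\<lambda>x \<in> carrier G. x), G)),
     Comp = (\<lambda>(H', g, K) (G, f, H). (G, compose (carrier G) g f, K))\<rparr>"

section \<open>Additive and abelian categories\<close>

record ('o, 'm) addcat = "('o, 'm) cat" +
  ZeroArr :: "'o \<Rightarrow> 'o \<Rightarrow> 'm"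
  PlusArr :: "'m \<Rightarrow> 'm \<Rightarrow> 'm"

definition hom_group :: "('o, 'm, 'z) addcat_scheme \<Rightarrow> 'o \<Rightarrow> 'o \<Rightarrow> 'm monoid" where
  "hom_group C A B = \<lparr>carrier = Hom C A B, mult = PlusArr C, one = ZeroArr C A B\<rparr>"

definition neg_arr :: "('o, 'm, 'z) addcat_scheme \<Rightarrow> 'm \<Rightarrow> 'm" where
  "neg_arr C f = inv\<^bsub>hom_group C (Dom C f) (Cod C f)\<^esub> f"

definition op_addcat :: "('o, 'm, 'z) addcat_scheme \<Rightarrow> ('o, 'm) addcat" where
  "op_addcat C = cat.extend (op_cat C) \<lparr>ZeroArr = (\<lambda>A B. ZeroArr C B A), PlusArr = PlusArr C\<rparr>"

locale preadditive_category = category C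
  for C :: "('o, 'm, 'z) addcat_scheme" (structure) +
  assumes hom_group: "\<lbrakk>A \<in> Obj C; B \<in> Obj C\<rbrakk> \<Longrightarrow> comm_group (hom_group C A B)"
    and Comp_add_right: "\<lbrakk>f \<in> Hom C A B; f' \<in> Hom C A B; g \<in> Hom C B D\<rbrakk>
           \<Longrightarrow> g \<cdot> PlusArr C f f' = PlusArr C (g \<cdot> f) (g \<cdot> f')"
    and Comp_add_left: "\<lbrakk>f \<in> Hom C A B; g \<in> Hom C B D; g' \<in> Hom C B D\<rbrakk>
           \<Longrightarrow> PlusArr C g g' \<cdot> f = PlusArr C (g \<cdot> f) (g' \<cdot> f)"

definition is_zero_object :: "('o, 'm, 'z) cat_scheme \<Rightarrow> 'o \<Rightarrow> bool" where
  "is_zero_object C Z \<longleftrightarrow> Z \<in> Obj C \<and>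
     (\<forall>A \<in> Obj C. (\<exists>!f. f \<in> Hom C Z A) \<and> (\<exists>!f. f \<in> Hom C A Z))"

definition is_biproduct :: "('o, 'm, 'z) addcat_scheme \<Rightarrow> 'o \<Rightarrow> 'o \<Rightarrow> 'o \<Rightarrow> bool" where
  "is_biproduct C A B P \<longleftrightarrow> A \<in> Obj C \<and> B \<in> Obj C \<and> P \<in> Obj C \<and>
     (\<exists>i \<in> Hom C A P. \<exists>j \<in> Hom C B P. \<exists>p \<in> Hom C P A. \<exists>q \<in> Hom C P B.
        p \<cdot>\<^bsub>C\<^esub> i = Ide C A \<and> q \<cdot>\<^bsub>C\<^esub> j = Ide C B \<and>
        p \<cdot>\<^bsub>C\<^esub> j = ZeroArr C B A \<and> q \<cdot>\<^bsub>C\<^esub> i = ZeroArr C A B \<and>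
        PlusArr C (i \<cdot>\<^bsub>C\<^esub> p) (j \<cdot>\<^bsub>C\<^esub> q) = Ide C P)"

definition direct_summand :: "('o, 'm, 'z) addcat_scheme \<Rightarrow> 'o \<Rightarrow> 'o \<Rightarrow> bool" where
  "direct_summand C B A \<longleftrightarrow> (\<exists>B'. is_biproduct C B B' A)"

locale additive_category = preadditive_category +
  assumes zero_object: "\<exists>Z. is_zero_object C Z"
    and biproducts: "\<lbrakk>A \<in> Obj C; B \<in> Obj C\<rbrakk> \<Longrightarrow> \<exists>P. is_biproduct C A B P"

definition is_mono :: "('o, 'm, 'z) cat_scheme \<Rightarrow> 'm \<Rightarrow> bool" where
  "is_mono C f \<longleftrightarrow> f \<in> Arr C \<and>
     (\<forall>D \<in> Obj C. \<forall>g \<in> Hom C D (Dom C f). \<forall>h \<in> Hom C D (Dom C f).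
        f \<cdot>\<^bsub>C\<^esub> g = f \<cdot>\<^bsub>C\<^esub> h \<longrightarrow> g = h)"

definition is_epi :: "('o, 'm, 'z) cat_scheme \<Rightarrow> 'm \<Rightarrow> bool" where
  "is_epi C f \<longleftrightarrow> f \<in> Arr C \<and>
     (\<forall>D \<in> Obj C. \<forall>g \<in> Hom C (Cod C f) D. \<forall>h \<in> Hom C (Cod C f) D.
        g \<cdot>\<^bsub>C\<^esub> f = h \<cdot>\<^bsub>C\<^esub> f \<longrightarrow> g = h)"

definition is_kernel :: "('o, 'm, 'z) addcat_scheme \<Rightarrow> 'm \<Rightarrow> 'm \<Rightarrow> bool" where
  "is_kernel C k f \<longleftrightarrow> f \<in> Arr C \<and> k \<in> Arr C \<and> Cod C k = Dom C f \<and>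
     f \<cdot>\<^bsub>C\<^esub> k = ZeroArr C (Dom C k) (Cod C f) \<and>
     (\<forall>D \<in> Obj C. \<forall>h \<in> Hom C D (Dom C f). f \<cdot>\<^bsub>C\<^esub> h = ZeroArr C D (Cod C f) \<longrightarrow>
        (\<exists>!h'. h' \<in> Hom C D (Dom C k) \<and> k \<cdot>\<^bsub>C\<^esub> h' = h))"

definition is_cokernel :: "('o, 'm, 'z) addcat_scheme \<Rightarrow> 'm \<Rightarrow> 'm \<Rightarrow> bool" where
  "is_cokernel C c f \<longleftrightarrow> f \<in> Arr C \<and> c \<in> Arr C \<and> Dom C c = Cod C f \<and>
     c \<cdot>\<^bsub>C\<^esub> f = ZeroArr C (Dom C f) (Cod C c) \<and>
     (\<forall>D \<in> Obj C. \<forall>h \<in> Hom C (Cod C f) D. h \<cdot>\<^bsub>C\<^esub> f = ZeroArr C (Dom C f) D \<longrightarrow>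
        (\<exists>!h'. h' \<in> Hom C (Cod C c) D \<and> h' \<cdot>\<^bsub>C\<^esub> c = h))"

locale abelian_category = additive_category +
  assumes kernels: "f \<in> Arr C \<Longrightarrow> \<exists>k. is_kernel C k f"
    and cokernels: "f \<in> Arr C \<Longrightarrow> \<exists>c. is_cokernel C c f"
    and mono_is_kernel: "is_mono C f \<Longrightarrow> \<exists>g. is_kernel C f g"
    and epi_is_cokernel: "is_epi C f \<Longrightarrow> \<exists>g. is_cokernel C f g"

definition split_idempotents :: "('o, 'm, 'z) cat_scheme \<Rightarrow> bool" where
  "split_idempotents C \<longleftrightarrow> (\<forall>A \<in> Obj C. \<forall>e \<in> Hom C A A. e \<cdot>\<^bsub>C\<^esub> e = e \<longrightarrow>
     (\<exists>B \<in> Obj C. \<exists>p \<in> Hom C A B. \<exists>i \<in> Hom C B A. i \<cdot>\<^bsub>C\<^esub> p = e \<and> p \<cdot>\<^bsub>C\<^esub> i = Ide C B))"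

section \<open>Subcategories and additive quotients\<close>

text \<open>A full subcategory is given by its set of objects. The following is the notion used
  throughout: full, additive, closed under isomorphisms and direct summands.\<close>

definition subcategory :: "('o, 'm, 'z) addcat_scheme \<Rightarrow> 'o set \<Rightarrow> bool" where
  "subcategory C X \<longleftrightarrow> X \<subseteq> Obj C \<and>
     (\<exists>Z \<in> X. is_zero_object C Z) \<and>
     (\<forall>A \<in> X. \<forall>B \<in> X. \<forall>P. is_biproduct C A B P \<longrightarrow> P \<in> X) \<and>
     (\<forall>A \<in> X. \<forall>B \<in> Obj C. isomorphic C A B \<longrightarrow> B \<in> X) \<and>
     (\<forall>A \<in> X. \<forall>B. direct_summand C B A \<longrightarrow> B \<in> X)"

definition contravariantly_finite :: "('o, 'm, 'z) cat_scheme \<Rightarrow> 'o set \<Rightarrow> bool" where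
  "contravariantly_finite C X \<longleftrightarrow> (\<forall>A \<in> Obj C. \<exists>X0 \<in> X. \<exists>f \<in> Hom C X0 A.
     \<forall>X' \<in> X. \<forall>g \<in> Hom C X' A. \<exists>h \<in> Hom C X' X0. f \<cdot>\<^bsub>C\<^esub> h = g)"

definition covariantly_finite :: "('o, 'm, 'z) cat_scheme \<Rightarrow> 'o set \<Rightarrow> bool" where
  "covariantly_finite C X \<longleftrightarrow> (\<forall>A \<in> Obj C. \<exists>X0 \<in> X. \<exists>f \<in> Hom C A X0.
     \<forall>X' \<in> X. \<forall>g \<in> Hom C A X'. \<exists>h \<in> Hom C X0 X'. h \<cdot>\<^bsub>C\<^esub> f = g)"

definition right_perp :: "('o, 'm, 'z) addcat_scheme \<Rightarrow> 'o set \<Rightarrow> 'o set" where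
  "right_perp C X = {A \<in> Obj C. \<forall>X' \<in> X. Hom C X' A = {ZeroArr C X' A}}"

definition left_perp :: "('o, 'm, 'z) addcat_scheme \<Rightarrow> 'o set \<Rightarrow> 'o set" where
  "left_perp C X = {A \<in> Obj C. \<forall>X' \<in> X. Hom C A X' = {ZeroArr C A X'}}"

definition sum_subcat :: "('o, 'm, 'z) addcat_scheme \<Rightarrow> 'o set \<Rightarrow> 'o set \<Rightarrow> 'o set" where
  "sum_subcat C \<A> \<B> = {D. \<exists>A \<in> \<A>. \<exists>B \<in> \<B>. \<exists>P. is_biproduct C A B P \<and> direct_summand C D P}"

definition factors_through :: "('o, 'm, 'z) cat_scheme \<Rightarrow> 'o set \<Rightarrow> 'm \<Rightarrow> bool" where
  "factors_through C Z f \<longleftrightarrow>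
     (\<exists>D \<in> Z. \<exists>g \<in> Hom C (Dom C f) D. \<exists>h \<in> Hom C D (Cod C f). f = h \<cdot>\<^bsub>C\<^esub> g)"

definition quot_class :: "('o, 'm, 'z) addcat_scheme \<Rightarrow> 'o set \<Rightarrow> 'm \<Rightarrow> 'm set" where
  "quot_class C Z f =
     {g \<in> Hom C (Dom C f) (Cod C f). factors_through C Z (PlusArr C g (neg_arr C f))}"

text \<open>The quotient by the ideal of arrows factoring through \<open>Z\<close>: arrows are residue classes,
  and the structure is computed on representatives (\<open>SOME\<close>), the choice of which is immaterial.\<close>

definition quot_cat :: "('o, 'm, 'z) addcat_scheme \<Rightarrow> 'o set \<Rightarrow> ('o, 'm set) addcat" where
  "quot_cat C Z =
     (let rep = (\<lambda>F. SOME f. f \<in> F) in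
      \<lparr>Obj = Obj C,
       Arr = quot_class C Z ` Arr C,
       Dom = (\<lambda>F. Dom C (rep F)),
       Cod = (\<lambda>F. Cod C (rep F)),
       Ide = (\<lambda>A. quot_class C Z (Ide C A)),
       Comp = (\<lambda>G F. quot_class C Z (rep G \<cdot>\<^bsub>C\<^esub> rep F)),
       ZeroArr = (\<lambda>A B. quot_class C Z (ZeroArr C A B)),
       PlusArr = (\<lambda>F G. quot_class C Z (PlusArr C (rep F) (rep G)))\<rparr>)"

section \<open>Coherent functors\<close>

text \<open>\<open>yoneda_restr C X\<close> is the functor \<open>H\<close> sending \<open>A\<close> to \<open>C(-, A)\<close> restricted to \<open>X\<close>, a functor
  from the opposite of the full subcategory \<open>X\<close> to abelian groups.\<close>

type_synonym ('o, 'm) presheaf =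
  "('o, 'm, 'm monoid, 'm monoid \<times> ('m \<Rightarrow> 'm) \<times> 'm monoid) ftr"

type_synonym ('o, 'm) presheaf_arr =
  "('o, 'm) presheaf \<times> ('o \<Rightarrow> 'm monoid \<times> ('m \<Rightarrow> 'm) \<times> 'm monoid) \<times> ('o, 'm) presheaf"

definition yoneda_obj :: "('o, 'm, 'z) addcat_scheme \<Rightarrow> 'o set \<Rightarrow> 'o \<Rightarrow> ('o, 'm) presheaf" where
  "yoneda_obj C X A =
     \<lparr>FObj = (\<lambda>U \<in> Obj (full_subcat C X). hom_group C U A),
      FArr = (\<lambda>f \<in> Arr (full_subcat C X).
        (hom_group C (Cod C f) A, (\<lambda>g \<in> Hom C (Cod C f) A. g \<cdot>\<^bsub>C\<^esub> f), hom_group C (Dom C f) A))\<rparr>"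

definition yoneda_arr :: "('o, 'm, 'z) addcat_scheme \<Rightarrow> 'o set \<Rightarrow> 'm \<Rightarrow> ('o, 'm) presheaf_arr" where
  "yoneda_arr C X a =
     (yoneda_obj C X (Dom C a),
      (\<lambda>U \<in> Obj (full_subcat C X). (hom_group C U (Dom C a),
         (\<lambda>g \<in> Hom C U (Dom C a). a \<cdot>\<^bsub>C\<^esub> g), hom_group C U (Cod C a))),
      yoneda_obj C X (Cod C a))"

definition yoneda_restr ::
  "('o, 'm, 'z) addcat_scheme \<Rightarrow> 'o set \<Rightarrow> ('o, 'm, ('o, 'm) presheaf, ('o, 'm) presheaf_arr) ftr" where
  "yoneda_restr C X = \<lparr>FObj = yoneda_obj C X, FArr = yoneda_arr C X\<rparr>"

definition presheaf_cat ::
  "('o, 'm, 'z) addcat_scheme \<Rightarrow> 'o set \<Rightarrow> (('o, 'm) presheaf, ('o, 'm) presheaf_arr) cat" where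
  "presheaf_cat C X = functor_cat (op_cat (full_subcat C X)) Ab_cat"

text \<open>\<open>F\<close> is coherent if it is the cokernel of a map \<open>\<alpha>\<close> between representables. Cokernels of
  functors with values in abelian groups are formed objectwise, so this says that the components
  of \<open>\<pi>\<close> are surjective with kernel the image of those of \<open>\<alpha>\<close>. The values of \<open>F\<close> are groups on the
  type of arrows; up to isomorphism this is no restriction, since a quotient group of a group on
  that type can be transported to a set of coset representatives.\<close>

definition coherent :: "('o, 'm, 'z) addcat_scheme \<Rightarrow> 'o set \<Rightarrow> ('o, 'm) presheaf \<Rightarrow> bool" where
  "coherent C X F \<longleftrightarrow> F \<in> Obj (presheaf_cat C X) \<and>
     (\<exists>X1 \<in> X. \<exists>X0 \<in> X. \<exists>\<alpha> \<pi>.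
        (yoneda_obj C X X1, \<alpha>, yoneda_obj C X X0) \<in> Arr (presheaf_cat C X) \<and>
        (yoneda_obj C X X0, \<pi>, F) \<in> Arr (presheaf_cat C X) \<and>
        (\<forall>U \<in> X. case (\<alpha> U, \<pi> U) of ((G1, a, G0), (G0', p, K)) \<Rightarrow>
           p ` carrier G0 = carrier K \<and> kernel G0 K p = a ` carrier G1))"

definition mod_cat ::
  "('o, 'm, 'z) addcat_scheme \<Rightarrow> 'o set \<Rightarrow> (('o, 'm) presheaf, ('o, 'm) presheaf_arr) cat" where
  "mod_cat C X = full_subcat (presheaf_cat C X) {F. coherent C X F}"

text \<open>Left modules \<open>X-mod\<close> are by definition \<open>mod_cat (op_addcat C) X\<close>, and the functor
  sending \<open>A\<close> to \<open>C(A, -)\<close> restricted to \<open>X\<close> is \<open>yoneda_restr (op_addcat C) X\<close>.\<close>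

section \<open>Triangulated categories\<close>

record ('o, 'm) tricat = "('o, 'm) addcat" +
  Shift :: "('o, 'm, 'o, 'm) ftr"
  Tri   :: "('m \<times> 'm \<times> 'm) set"

abbreviation ShO :: "('o, 'm, 'z) tricat_scheme \<Rightarrow> 'o \<Rightarrow> 'o" where
  "ShO T \<equiv> FObj (Shift T)"

abbreviation ShA :: "('o, 'm, 'z) tricat_scheme \<Rightarrow> 'm \<Rightarrow> 'm" where
  "ShA T \<equiv> FArr (Shift T)"

definition is_candidate_triangle ::
  "('o, 'm, 'z) tricat_scheme \<Rightarrow> 'o \<Rightarrow> 'o \<Rightarrow> 'o \<Rightarrow> 'm \<Rightarrow> 'm \<Rightarrow> 'm \<Rightarrow> bool" where
  "is_candidate_triangle T A B C u v w \<longleftrightarrow>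
     u \<in> Hom T A B \<and> v \<in> Hom T B C \<and> w \<in> Hom T C (ShO T A)"

definition is_triangle ::
  "('o, 'm, 'z) tricat_scheme \<Rightarrow> 'o \<Rightarrow> 'o \<Rightarrow> 'o \<Rightarrow> 'm \<Rightarrow> 'm \<Rightarrow> 'm \<Rightarrow> bool" where
  "is_triangle T A B C u v w \<longleftrightarrow> is_candidate_triangle T A B C u v w \<and> (u, v, w) \<in> Tri T"

text \<open>Verdier's axioms. The shift is only required to be an additive auto-equivalence, which
  includes the case of an automorphism.\<close>

locale triangulated_category = additive_category T
  for T :: "('o, 'm, 'z) tricat_scheme" (structure) +
  assumes shift_full: "full_functor T T (Shift T)"
    and shift_faithful: "faithful_functor T T (Shift T)"
    and shift_ess_surjective: "ess_surjective T T (Shift T)"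
    and shift_additive: "\<lbrakk>f \<in> Hom T A B; g \<in> Hom T A B\<rbrakk>
          \<Longrightarrow> ShA T (PlusArr T f g) = PlusArr T (ShA T f) (ShA T g)"
    and TR1_iso: "\<lbrakk>is_triangle T A B C u v w; is_candidate_triangle T A' B' C' u' v' w';
          f \<in> Hom T A A'; g \<in> Hom T B B'; h \<in> Hom T C C'; is_iso T f; is_iso T g; is_iso T h;
          g \<cdot> u = u' \<cdot> f; h \<cdot> v = v' \<cdot> g; ShA T f \<cdot> w = w' \<cdot> h\<rbrakk>
          \<Longrightarrow> is_triangle T A' B' C' u' v' w'"
    and TR1_id: "\<lbrakk>A \<in> Obj T; is_zero_object T Z\<rbrakk>
          \<Longrightarrow> is_triangle T A A Z (Ide T A) (ZeroArr T A Z) (ZeroArr T Z (ShO T A))"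
    and TR1_cone: "u \<in> Hom T A B \<Longrightarrow> \<exists>C v w. is_triangle T A B C u v w"
    and TR2: "is_candidate_triangle T A B C u v w
          \<Longrightarrow> is_triangle T A B C u v w \<longleftrightarrow> is_triangle T B C (ShO T A) v w (neg_arr T (ShA T u))"
    and TR3: "\<lbrakk>is_triangle T A B C u v w; is_triangle T A' B' C' u' v' w';
          f \<in> Hom T A A'; g \<in> Hom T B B'; g \<cdot> u = u' \<cdot> f\<rbrakk>
          \<Longrightarrow> \<exists>h \<in> Hom T C C'. h \<cdot> v = v' \<cdot> g \<and> ShA T f \<cdot> w = w' \<cdot> h"
    and TR4: "\<lbrakk>is_triangle T A B C' u j k; is_triangle T B C A' v p q;
          is_triangle T A C B' (v \<cdot> u) l m\<rbrakk>
          \<Longrightarrow> \<exists>f \<in> Hom T C' B'. \<exists>g \<in> Hom T B' A'. is_triangle T C' B' A' f g (ShA T j \<cdot> q) \<and>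
                f \<cdot> j = l \<cdot> v \<and> m \<cdot> f = k \<and> g \<cdot> l = p \<and> q \<cdot> g = ShA T u \<cdot> m"

text \<open>The subcategories \<open>X[1]\<close> and \<open>X[-1]\<close>, both closed under isomorphisms (for \<open>X\<close> closed under
  isomorphisms); since the shift is an equivalence, \<open>A \<in> X[-1]\<close> means \<open>A[1] \<in> X\<close>.\<close>

definition shift_subcat :: "('o, 'm, 'z) tricat_scheme \<Rightarrow> 'o set \<Rightarrow> 'o set" where
  "shift_subcat T X = {A \<in> Obj T. \<exists>B \<in> X. isomorphic T A (ShO T B)}"

definition unshift_subcat :: "('o, 'm, 'z) tricat_scheme \<Rightarrow> 'o set \<Rightarrow> 'o set" where
  "unshift_subcat T X = {A \<in> Obj T. ShO T A \<in> X}"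

definition rigid :: "('o, 'm, 'z) tricat_scheme \<Rightarrow> 'o set \<Rightarrow> bool" where
  "rigid T X \<longleftrightarrow> (\<forall>A \<in> X. \<forall>B \<in> shift_subcat T X. Hom T A B = {ZeroArr T A B})"

definition star_subcat :: "('o, 'm, 'z) tricat_scheme \<Rightarrow> 'o set \<Rightarrow> 'o set \<Rightarrow> 'o set" where
  "star_subcat T \<U> \<V> = {D. \<exists>A. direct_summand T D A \<and>
     (\<exists>U \<in> \<U>. \<exists>V \<in> \<V>. \<exists>u v w. is_triangle T U A V u v w)}"

end

theory Submission
  imports Defs
begin

text \<open>For \<open>A \<in> T\<close> take a right approximation \<open>X0 \<rightarrow> A\<close>, an approximation \<open>X1\<close> of its weak kernel,
  and let \<open>R\<close> be the cone of \<open>X1 \<rightarrow> X0\<close>. Rigidity makes \<open>H(X1) \<rightarrow> H(X0) \<rightarrow> H(R) \<rightarrow> 0\<close> exact, so the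
  induced map \<open>k : R \<rightarrow> A\<close> becomes an isomorphism under \<open>H\<close>, with \<open>R \<in> X \<star> X[1]\<close>. Moreover \<open>H(f) = 0\<close>
  iff \<open>f\<close> factors through the right perp of \<open>X\<close>: if \<open>f\<close> kills \<open>X0 \<rightarrow> A\<close> it factors through its cone.
  Hence if \<open>k\<close> has a right inverse \<open>g\<close> modulo this ideal, then \<open>1 - k g\<close> factors through some \<open>Y\<close> in the
  perp and \<open>A\<close> is a retract of \<open>R \<oplus> Y\<close>. Such a \<open>g\<close> exists if \<open>H\<close> is full, and also if the quotient
  is abelian, \<open>k\<close> being a monomorphism and an epimorphism there.
  Conversely, natural families out of an object of \<open>X \<star> X[1]\<close> are determined on \<open>X0\<close> and extend over
  the weak cokernel, so the decomposition makes \<open>H\<close> full. Under fullness kernels in the quotient are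
  the images of approximated weak kernels, while the cokernel of \<open>f\<close> is always the cone of \<open>f\<close> composed
  with an approximation of its source.\<close>

section \<open>Preadditive categories\<close>

text \<open>Everything is computed with elements of \<open>Hom C U A\<close> for \<open>U\<close> in
  \<open>X\<close>: the quotient is never compared with \<open>mod-X\<close>, and no exact structure
  on presheaves is used. The obstacle is that triangles give only weak kernels and cokernels, and
  that \<open>H\<close> turns a cone into an honest cokernel only under control of its first vertex:
  rigidity kills arrows from \<open>X\<close> to \<open>X[1]\<close>, not to an arbitrary
  \<open>A[1]\<close>. Hence every cone is taken of an arrow out of \<open>X\<close>, after
  composing with an approximation. Factoring through such a cone is strict, whereas a lift into a
  kernel, or a factorization through an epimorphism, exists at first only as a family of maps on
  \<open>X\<close>; turning such a family into an arrow is what fullness supplies. Fullness of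
  \<open>H\<close> concerns additive families, so the passage from (a) to (b) has to verify
  additivity of the one family that it uses; the decomposition then represents every natural family,
  which spares this check in the proof that the quotient is abelian.\<close>

context category
begin

lemma Hom_iff: "f \<in> Hom C A B \<longleftrightarrow> f \<in> Arr C \<and> Dom C f = A \<and> Cod C f = B"
  by (simp add: Hom_def)

lemma HomD:
  assumes "f \<in> Hom C A B"
  shows "f \<in> Arr C" "Dom C f = A" "Cod C f = B" "A \<in> Obj C" "B \<in> Obj C"
  using assms Dom_closed Cod_closed by (auto simp: Hom_def)

lemma Arr_Hom: "f \<in> Arr C \<Longrightarrow> f \<in> Hom C (Dom C f) (Cod C f)"
  by (simp add: Hom_def)

lemma isomorphic_obtain:
  assumes "isomorphic C A B"
  obtains f g where "f \<in> Hom C A B" "g \<in> Hom C B A" "g \<cdot> f = Ide C A" "f \<cdot> g = Ide C B"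
    "is_iso C f" "is_iso C g"
proof -
  from assms obtain f where f: "f \<in> Hom C A B" "is_iso C f" unfolding isomorphic_def by blast
  then obtain g where g: "g \<in> Hom C B A" "g \<cdot> f = Ide C A" "f \<cdot> g = Ide C B"
    unfolding is_iso_def by (auto simp: Hom_def)
  have "is_iso C g" unfolding is_iso_def using f(1) g by (auto simp: Hom_def)
  with that f g show thesis by blast
qed

lemma is_iso_Ide: "A \<in> Obj C \<Longrightarrow> is_iso C (Ide C A)"
  unfolding is_iso_def using Ide_closed Ide_left by (fastforce simp: Hom_def)

lemma isomorphic_refl: "A \<in> Obj C \<Longrightarrow> isomorphic C A A"
  unfolding isomorphic_def using Ide_closed is_iso_Ide by blast

lemma isomorphic_sym: "isomorphic C A B \<Longrightarrow> isomorphic C B A"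
  by (metis isomorphic_obtain isomorphic_def)

lemma zero_object_unique:
  assumes "is_zero_object C Z" "f \<in> Hom C Z A" "g \<in> Hom C Z A" shows "f = g"
  using assms HomD(5)[OF assms(2)] unfolding is_zero_object_def by blast

end

context preadditive_category
begin

abbreviation add_arr (infixl \<open>\<boxplus>\<close> 65) where "f \<boxplus> g \<equiv> PlusArr C f g"
abbreviation opp_arr (\<open>\<boxminus>_\<close> [80] 80) where "\<boxminus>f \<equiv> neg_arr C f"

section \<open>Arithmetic in the groups of arrows\<close>

lemma zero_in_Hom:
  assumes "A \<in> Obj C" "B \<in> Obj C" shows "ZeroArr C A B \<in> Hom C A B"
proof -
  interpret comm_group "hom_group C A B" using hom_group assms .
  show ?thesis using one_closed by (auto simp: hom_group_def)
qed

lemma plus_in_Hom: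
  assumes "f \<in> Hom C A B" "g \<in> Hom C A B" shows "f \<boxplus> g \<in> Hom C A B"
proof -
  interpret comm_group "hom_group C A B" using hom_group HomD[OF assms(1)] by blast
  show ?thesis using m_closed assms by (auto simp: hom_group_def)
qed

lemma plus_commute:
  assumes "f \<in> Hom C A B" "g \<in> Hom C A B" shows "f \<boxplus> g = g \<boxplus> f"
proof -
  interpret comm_group "hom_group C A B" using hom_group HomD[OF assms(1)] by blast
  show ?thesis using m_comm assms by (auto simp: hom_group_def)
qed

lemma plus_assoc:
  assumes "f \<in> Hom C A B" "g \<in> Hom C A B" "h \<in> Hom C A B"
  shows "(f \<boxplus> g) \<boxplus> h = f \<boxplus> (g \<boxplus> h)"
proof -
  interpret comm_group "hom_group C A B" using hom_group HomD[OF assms(1)] by blast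
  show ?thesis using m_assoc assms by (auto simp: hom_group_def)
qed

lemma plus_zero:
  assumes "f \<in> Hom C A B" shows "f \<boxplus> ZeroArr C A B = f" "ZeroArr C A B \<boxplus> f = f"
proof -
  interpret comm_group "hom_group C A B" using hom_group HomD[OF assms(1)] by blast
  show "f \<boxplus> ZeroArr C A B = f" "ZeroArr C A B \<boxplus> f = f"
    using r_one l_one assms by (auto simp: hom_group_def)
qed

lemma neg_in_Hom:
  assumes "f \<in> Hom C A B" shows "\<boxminus>f \<in> Hom C A B"
proof -
  interpret comm_group "hom_group C A B" using hom_group HomD[OF assms(1)] by blast
  show ?thesis using inv_closed[of f] assms HomD[OF assms] by (auto simp: hom_group_def neg_arr_def)
qed

lemma plus_neg:
  assumes "f \<in> Hom C A B" shows "f \<boxplus> \<boxminus>f = ZeroArr C A B" "\<boxminus>f \<boxplus> f = ZeroArr C A B"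
proof -
  interpret comm_group "hom_group C A B" using hom_group HomD[OF assms(1)] by blast
  show "f \<boxplus> \<boxminus>f = ZeroArr C A B" "\<boxminus>f \<boxplus> f = ZeroArr C A B"
    using r_inv[of f] l_inv[of f] assms HomD[OF assms] by (auto simp: hom_group_def neg_arr_def)
qed

lemma plus_left_cancel:
  assumes "f \<in> Hom C A B" "g \<in> Hom C A B" "h \<in> Hom C A B" "f \<boxplus> g = f \<boxplus> h" shows "g = h"
proof -
  interpret comm_group "hom_group C A B" using hom_group HomD[OF assms(1)] by blast
  show ?thesis using Units_l_cancel[of f g h] Units_eq assms by (simp add: hom_group_def)
qed

lemma neg_unique:
  assumes "f \<in> Hom C A B" "g \<in> Hom C A B" "f \<boxplus> g = ZeroArr C A B" shows "g = \<boxminus>f"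
  by (rule plus_left_cancel[OF assms(1,2) neg_in_Hom[OF assms(1)]]) (simp add: assms(3) plus_neg[OF assms(1)])

lemma neg_neg: "f \<in> Hom C A B \<Longrightarrow> \<boxminus>\<boxminus>f = f"
  by (metis neg_unique neg_in_Hom plus_neg(2))

lemma minus_eq_zero_iff:
  assumes "f \<in> Hom C A B" "g \<in> Hom C A B" shows "g \<boxplus> \<boxminus>f = ZeroArr C A B \<longleftrightarrow> g = f"
  by (metis assms neg_in_Hom neg_neg neg_unique plus_commute plus_neg(1))

lemma comp_zero:
  assumes "g \<in> Hom C B D" "A \<in> Obj C" shows "g \<cdot> ZeroArr C A B = ZeroArr C A D"
proof -
  have z: "ZeroArr C A B \<in> Hom C A B" using zero_in_Hom[OF assms(2) HomD(4)[OF assms(1)]] .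
  note gz = Comp_closed[OF z assms(1)]
  have z': "ZeroArr C A D \<in> Hom C A D" using zero_in_Hom[OF assms(2) HomD(5)[OF assms(1)]] .
  show ?thesis
    using plus_left_cancel[OF gz gz z'] Comp_add_right[OF z z assms(1)]
    by (simp add: plus_zero(1)[OF gz] plus_zero(1)[OF z])
qed

lemma zero_comp:
  assumes "f \<in> Hom C A B" "D \<in> Obj C" shows "ZeroArr C B D \<cdot> f = ZeroArr C A D"
proof -
  have z: "ZeroArr C B D \<in> Hom C B D" using zero_in_Hom[OF HomD(5)[OF assms(1)] assms(2)] .
  note gz = Comp_closed[OF assms(1) z]
  have z': "ZeroArr C A D \<in> Hom C A D" using zero_in_Hom[OF HomD(4)[OF assms(1)] assms(2)] .
  show ?thesis
    using plus_left_cancel[OF gz gz z'] Comp_add_left[OF assms(1) z z]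
    by (simp add: plus_zero(1)[OF gz] plus_zero(1)[OF z])
qed

lemma comp_neg:
  assumes "f \<in> Hom C A B" "g \<in> Hom C B D" shows "g \<cdot> \<boxminus>f = \<boxminus>(g \<cdot> f)"
  by (rule neg_unique[OF Comp_closed[OF assms] Comp_closed[OF neg_in_Hom[OF assms(1)] assms(2)]])
    (simp add: Comp_add_right[OF assms(1) neg_in_Hom[OF assms(1)] assms(2), symmetric]
      plus_neg(1)[OF assms(1)] comp_zero[OF assms(2) HomD(4)[OF assms(1)]])

lemma neg_comp:
  assumes "f \<in> Hom C A B" "g \<in> Hom C B D" shows "\<boxminus>g \<cdot> f = \<boxminus>(g \<cdot> f)"
  by (rule neg_unique[OF Comp_closed[OF assms] Comp_closed[OF assms(1) neg_in_Hom[OF assms(2)]]])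
    (simp add: Comp_add_left[OF assms neg_in_Hom[OF assms(2)], symmetric]
      plus_neg(1)[OF assms(2)] zero_comp[OF assms(1) HomD(5)[OF assms(2)]])

lemma neg_zero: "A \<in> Obj C \<Longrightarrow> B \<in> Obj C \<Longrightarrow> \<boxminus>(ZeroArr C A B) = ZeroArr C A B"
  by (metis neg_unique plus_zero(1) zero_in_Hom)

text \<open>An arrow into or out of an object whose identity is zero is itself zero. Being an
  equation, the criterion passes directly to the shift and to the quotient.\<close>

lemma zero_object_iff:
  "is_zero_object C Z \<longleftrightarrow> Z \<in> Obj C \<and> Ide C Z = ZeroArr C Z Z" (is "_ \<longleftrightarrow> ?R")
proof
  assume "is_zero_object C Z"
  then show ?R by (meson is_zero_object_def Ide_closed zero_in_Hom zero_object_unique)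
next
  assume R: ?R
  have "f = ZeroArr C Z A" if "f \<in> Hom C Z A" for f A
    using that R comp_zero[OF that] Ide_right by metis
  moreover have "f = ZeroArr C A Z" if "f \<in> Hom C A Z" for f A
    using that R zero_comp[OF that] Ide_left by metis
  ultimately show "is_zero_object C Z"
    unfolding is_zero_object_def using R zero_in_Hom by metis
qed

text \<open>The complement is the object that splits the complementary idempotent \<open>e\<close>,
  that is, 1 - \<open>i p\<close>; this is where split idempotents enter.\<close>

lemma retract_direct_summand:
  assumes split: "split_idempotents C" and i: "i \<in> Hom C A P" and p: "p \<in> Hom C P A"
    and pi: "p \<cdot> i = Ide C A"
  shows "direct_summand C A P"
proof -
  note P = HomD(5)[OF i] and A = HomD(4)[OF i]
  note I = Ide_closed[OF P]
  note ip = Comp_closed[OF p i]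
  define e where "e = Ide C P \<boxplus> \<boxminus>(i \<cdot> p)"
  have e: "e \<in> Hom C P P" unfolding e_def by (intro plus_in_Hom I neg_in_Hom ip)
  have pe: "p \<cdot> e = ZeroArr C P A"
  proof -
    have "p \<cdot> e = p \<boxplus> \<boxminus>(p \<cdot> (i \<cdot> p))"
      unfolding e_def by (simp add: Comp_add_right[OF I neg_in_Hom[OF ip] p] comp_neg[OF ip p] Ide_right[OF p])
    also have "p \<cdot> (i \<cdot> p) = p" by (simp add: Comp_assoc[OF p i p] pi Ide_left[OF p])
    finally show ?thesis by (simp add: plus_neg[OF p])
  qed
  have ei: "e \<cdot> i = ZeroArr C A P"
  proof -
    have "e \<cdot> i = i \<boxplus> \<boxminus>((i \<cdot> p) \<cdot> i)"
      unfolding e_def by (simp add: Comp_add_left[OF i I neg_in_Hom[OF ip]] neg_comp[OF i ip] Ide_left[OF i])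
    also have "(i \<cdot> p) \<cdot> i = i" by (simp add: Comp_assoc[OF i p i, symmetric] pi Ide_right[OF i])
    finally show ?thesis by (simp add: plus_neg[OF i])
  qed
  have "e \<cdot> e = e \<boxplus> \<boxminus>(i \<cdot> (p \<cdot> e))"
    using e by (subst (1) e_def)
      (simp add: Comp_add_left[OF e I neg_in_Hom[OF ip]] neg_comp[OF e ip] Ide_left[OF e] Comp_assoc[OF e p i])
  then have ee: "e \<cdot> e = e" by (simp add: pe comp_zero[OF i P] neg_zero[OF P P] plus_zero[OF e])
  obtain B s j where s: "s \<in> Hom C P B" and j: "j \<in> Hom C B P" and js: "j \<cdot> s = e"
    and sj: "s \<cdot> j = Ide C B"
    using split[unfolded split_idempotents_def, rule_format, OF P e ee] by blast
  note B = HomD(5)[OF s]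
  have "e \<cdot> j = j" using Comp_assoc[OF j s j] by (simp add: js sj Ide_right[OF j])
  then have pj: "p \<cdot> j = ZeroArr C B A"
    using Comp_assoc[OF j e p] by (simp add: pe zero_comp[OF j A])
  have "s \<cdot> e = s" using Comp_assoc[OF s j s] by (simp add: js sj Ide_left[OF s])
  then have si: "s \<cdot> i = ZeroArr C A B"
    using Comp_assoc[OF i e s] by (simp add: ei comp_zero[OF s A])
  have "(i \<cdot> p) \<boxplus> (j \<cdot> s) = Ide C P"
    unfolding js e_def plus_commute[OF I neg_in_Hom[OF ip]] plus_assoc[OF ip neg_in_Hom[OF ip] I, symmetric]
    by (simp add: plus_neg(1)[OF ip] plus_zero(2)[OF I])
  then have "is_biproduct C A B P"
    unfolding is_biproduct_def
    by (intro conjI bexI[OF _ i] bexI[OF _ j] bexI[OF _ p] bexI[OF _ s] A B P pi sj pj si)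
  then show ?thesis unfolding direct_summand_def by blast
qed

lemma direct_summand_retract:
  assumes "direct_summand C A P"
  obtains i p where "i \<in> Hom C A P" "p \<in> Hom C P A" "p \<cdot> i = Ide C A"
  using assms unfolding direct_summand_def is_biproduct_def by blast

end

text \<open>\<open>star_subcat\<close> is defined by summands of middle terms of triangles; this
  puts the middle terms themselves into it. The complement is a zero object.\<close>

lemma (in additive_category) direct_summand_refl:
  assumes "A \<in> Obj C" shows "direct_summand C A A"
proof -
  obtain Z where Z: "is_zero_object C Z" using zero_object by blast
  then have Z': "Z \<in> Obj C" "Ide C Z = ZeroArr C Z Z" by (simp_all add: zero_object_iff)
  note I = Ide_closed[OF assms] and a = zero_in_Hom[OF assms Z'(1)] and b = zero_in_Hom[OF Z'(1) assms]
  have "is_biproduct C A Z A"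
    unfolding is_biproduct_def
    by (intro conjI bexI[OF _ I] bexI[OF _ a] bexI[OF _ b])
      (simp_all add: assms Z' Ide_left[OF I] Ide_left[OF b] Ide_right[OF a] comp_zero[OF a] comp_zero[OF b] plus_zero[OF I])
  then show ?thesis unfolding direct_summand_def by blast
qed

section \<open>Objects presented by a subcategory\<close>

definition is_weak_cokernel :: "('o, 'm, 'z) addcat_scheme \<Rightarrow> 'm \<Rightarrow> 'm \<Rightarrow> bool" where
  "is_weak_cokernel C c f \<longleftrightarrow> f \<in> Arr C \<and> c \<in> Arr C \<and> Dom C c = Cod C f \<and>
     c \<cdot>\<^bsub>C\<^esub> f = ZeroArr C (Dom C f) (Cod C c) \<and>
     (\<forall>E. \<forall>h \<in> Hom C (Cod C f) E. h \<cdot>\<^bsub>C\<^esub> f = ZeroArr C (Dom C f) E \<longrightarrow>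
        (\<exists>h' \<in> Hom C (Cod C c) E. h' \<cdot>\<^bsub>C\<^esub> c = h))"

definition is_weak_kernel :: "('o, 'm, 'z) addcat_scheme \<Rightarrow> 'm \<Rightarrow> 'm \<Rightarrow> bool" where
  "is_weak_kernel C k f \<longleftrightarrow> f \<in> Arr C \<and> k \<in> Arr C \<and> Cod C k = Dom C f \<and>
     f \<cdot>\<^bsub>C\<^esub> k = ZeroArr C (Dom C k) (Cod C f) \<and>
     (\<forall>E. \<forall>h \<in> Hom C E (Dom C f). f \<cdot>\<^bsub>C\<^esub> h = ZeroArr C E (Cod C f) \<longrightarrow>
        (\<exists>h' \<in> Hom C E (Dom C k). k \<cdot>\<^bsub>C\<^esub> h' = h))"

text \<open>This and \<open>hom_inj_on\<close> say that \<open>H(f)\<close> is objectwise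
  surjective, resp. injective, without mentioning presheaves. An arrow from an object of
  \<open>X\<close> with \<open>hom_surj_on\<close> is a right approximation.\<close>

definition hom_surj_on :: "('o, 'm, 'z) addcat_scheme \<Rightarrow> 'o set \<Rightarrow> 'm \<Rightarrow> bool" where
  "hom_surj_on C X f \<longleftrightarrow>
     (\<forall>U \<in> X. \<forall>g \<in> Hom C U (Cod C f). \<exists>g' \<in> Hom C U (Dom C f). f \<cdot>\<^bsub>C\<^esub> g' = g)"

definition hom_inj_on :: "('o, 'm, 'z) addcat_scheme \<Rightarrow> 'o set \<Rightarrow> 'm \<Rightarrow> bool" where
  "hom_inj_on C X f \<longleftrightarrow> (\<forall>U \<in> X. inj_on (\<lambda>g. f \<cdot>\<^bsub>C\<^esub> g) (Hom C U (Dom C f)))"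

text \<open>A natural transformation from \<open>H(A)\<close> to \<open>H(B)\<close>, encoded as one
  function on arrows: an arrow knows its domain, so the components need no index. Additivity is kept
  as a separate predicate because the two directions of the proof treat it differently.\<close>

definition nat_family :: "('o, 'm, 'z) addcat_scheme \<Rightarrow> 'o set \<Rightarrow> 'o \<Rightarrow> 'o \<Rightarrow> ('m \<Rightarrow> 'm) \<Rightarrow> bool" where
  "nat_family C X A B \<eta> \<longleftrightarrow>
     (\<forall>U \<in> X. \<forall>u \<in> Hom C U A. \<eta> u \<in> Hom C U B) \<and>
     (\<forall>U \<in> X. \<forall>V \<in> X. \<forall>v \<in> Hom C U V. \<forall>u \<in> Hom C V A. \<eta> (u \<cdot>\<^bsub>C\<^esub> v) = \<eta> u \<cdot>\<^bsub>C\<^esub> v)"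

definition additive_family :: "('o, 'm, 'z) addcat_scheme \<Rightarrow> 'o set \<Rightarrow> 'o \<Rightarrow> ('m \<Rightarrow> 'm) \<Rightarrow> bool" where
  "additive_family C X A \<eta> \<longleftrightarrow>
     (\<forall>U \<in> X. \<forall>u \<in> Hom C U A. \<forall>v \<in> Hom C U A. \<eta> (PlusArr C u v) = PlusArr C (\<eta> u) (\<eta> v))"

definition represents :: "('o, 'm, 'z) addcat_scheme \<Rightarrow> 'o set \<Rightarrow> 'o \<Rightarrow> 'm \<Rightarrow> ('m \<Rightarrow> 'm) \<Rightarrow> bool" where
  "represents C X A f \<eta> \<longleftrightarrow> (\<forall>U \<in> X. \<forall>u \<in> Hom C U A. f \<cdot>\<^bsub>C\<^esub> u = \<eta> u)"

context preadditive_category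
begin

section \<open>Working with weak kernels, weak cokernels and natural families\<close>

lemma weak_cokernelE:
  assumes "is_weak_cokernel C c f" "f \<in> Hom C A B" "c \<in> Hom C B D" "h \<in> Hom C B E"
    "h \<cdot> f = ZeroArr C A E"
  obtains h' where "h' \<in> Hom C D E" "h' \<cdot> c = h"
  using assms HomD(2,3)[OF assms(2)] HomD(2,3)[OF assms(3)] unfolding is_weak_cokernel_def by auto

lemma weak_kernelE:
  assumes "is_weak_kernel C k f" "f \<in> Hom C A B" "k \<in> Hom C K A" "h \<in> Hom C E A"
    "f \<cdot> h = ZeroArr C E B"
  obtains h' where "h' \<in> Hom C E K" "k \<cdot> h' = h"
  using assms HomD(2,3)[OF assms(2)] HomD(2,3)[OF assms(3)] unfolding is_weak_kernel_def by auto

lemma hom_surj_onE: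
  assumes "hom_surj_on C X f" "f \<in> Hom C A B" "U \<in> X" "g \<in> Hom C U B"
  obtains g' where "g' \<in> Hom C U A" "f \<cdot> g' = g"
  using assms HomD(2,3)[OF assms(2)] unfolding hom_surj_on_def by auto

lemma hom_inj_onD:
  assumes "hom_inj_on C X f" "f \<in> Hom C A B" "U \<in> X" "g \<in> Hom C U A" "h \<in> Hom C U A" "f \<cdot> g = f \<cdot> h"
  shows "g = h"
  using assms by (auto simp: hom_inj_on_def Hom_iff inj_on_def)

lemma nat_familyD:
  assumes "nat_family C X A B \<eta>" "V \<in> X" "u \<in> Hom C V A"
  shows "\<eta> u \<in> Hom C V B" "U \<in> X \<Longrightarrow> v \<in> Hom C U V \<Longrightarrow> \<eta> (u \<cdot> v) = \<eta> u \<cdot> v"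
  using assms by (auto simp: nat_family_def)

lemma nat_family_comp:
  assumes "h \<in> Hom C A B" shows "nat_family C X A B (\<lambda>u. h \<cdot> u)"
  using assms by (simp add: nat_family_def Comp_closed Comp_assoc)

lemma nat_family_comp':
  assumes "nat_family C X P B \<eta>" "h \<in> Hom C A P" shows "nat_family C X A B (\<lambda>u. \<eta> (h \<cdot> u))"
  unfolding nat_family_def
proof (intro conjI ballI)
  fix U V u v assume U: "U \<in> X" "V \<in> X" "v \<in> Hom C U V" "u \<in> Hom C V A"
  show "\<eta> (h \<cdot> u \<cdot> v) = \<eta> (h \<cdot> u) \<cdot> v"
    using nat_familyD(2)[OF assms(1) U(2) Comp_closed[OF U(4) assms(2)] U(1,3)] Comp_assoc[OF U(3,4) assms(2)]
    by simp
qed (use assms nat_familyD(1) Comp_closed in metis)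

text \<open>Preimages under an injective \<open>H(k)\<close> are unique, so choosing one for each
  element is automatically natural: the two sides of the naturality equation have the same image
  under \<open>k\<close>.\<close>

lemma nat_family_lift:
  assumes k: "k \<in> Hom C R A" "hom_inj_on C X k" and \<psi>: "nat_family C X E A \<psi>"
    and lift: "\<And>U u. U \<in> X \<Longrightarrow> u \<in> Hom C U E \<Longrightarrow> \<exists>r \<in> Hom C U R. k \<cdot> r = \<psi> u"
  obtains \<eta> where "nat_family C X E R \<eta>" "\<And>U u. U \<in> X \<Longrightarrow> u \<in> Hom C U E \<Longrightarrow> k \<cdot> \<eta> u = \<psi> u"
proof -
  define \<eta> where "\<eta> u = (SOME r. r \<in> Hom C (Dom C u) R \<and> k \<cdot> r = \<psi> u)" for u
  have \<eta>: "\<eta> u \<in> Hom C U R \<and> k \<cdot> \<eta> u = \<psi> u" if "U \<in> X" "u \<in> Hom C U E" for U u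
  proof -
    have "Dom C u = U" using that by (simp add: Hom_iff)
    moreover have "\<exists>r. r \<in> Hom C U R \<and> k \<cdot> r = \<psi> u" using lift[OF that] by blast
    ultimately show ?thesis unfolding \<eta>_def by (metis (mono_tags, lifting) someI_ex)
  qed
  have "\<eta> (u \<cdot> v) = \<eta> u \<cdot> v" if "U \<in> X" "V \<in> X" "v \<in> Hom C U V" "u \<in> Hom C V E" for U V u v
  proof (rule hom_inj_onD[OF k(2,1) that(1)])
    note uv = Comp_closed[OF that(3,4)]
    show "\<eta> (u \<cdot> v) \<in> Hom C U R" using \<eta>[OF that(1) uv] by simp
    show "\<eta> u \<cdot> v \<in> Hom C U R" using \<eta>[OF that(2,4)] Comp_closed[OF that(3)] by simp
    have "k \<cdot> \<eta> u \<cdot> v = \<psi> u \<cdot> v" using \<eta>[OF that(2,4)] Comp_assoc[OF that(3) _ k(1)] by simp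
    then show "k \<cdot> \<eta> (u \<cdot> v) = k \<cdot> \<eta> u \<cdot> v"
      using \<eta>[OF that(1) uv] nat_familyD(2)[OF \<psi> that(2,4,1,3)] by simp
  qed
  then have "nat_family C X E R \<eta>" using \<eta> by (simp add: nat_family_def)
  with that \<eta> show thesis by blast
qed

end

text \<open>The part of a triangulated category that the proof uses. Rotating triangles shows that it
  holds for \<open>T\<close> with \<open>S = X \<star> X[1]\<close>, and for the opposite of \<open>T\<close> with \<open>S = X[-1] \<star> X\<close>, so that
  part (ii) needs no triangulated structure on the opposite category, whose shift would have to be
  a quasi-inverse of the given one.\<close>

locale presented_category = additive_category C
  for C :: "('o, 'm, 'z) addcat_scheme" (structure) +
  fixes X S :: "'o set"
  assumes split_idempotents: "split_idempotents C"
    and subcategory: "subcategory C X"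
    and contravariantly_finite: "contravariantly_finite C X"
    and weak_kernel_exists: "f \<in> Arr C \<Longrightarrow> \<exists>k. is_weak_kernel C k f"
    and cone: "\<lbrakk>p \<in> Arr C; Dom C p \<in> X\<rbrakk> \<Longrightarrow> \<exists>c. is_weak_cokernel C c p \<and>
          is_weak_kernel C p c \<and> hom_surj_on C X c \<and> (Cod C p \<in> X \<longrightarrow> Cod C c \<in> S)"
    and S_presented: "D \<in> S \<Longrightarrow> \<exists>x q. Dom C x \<in> X \<and> Cod C x \<in> X \<and> is_weak_cokernel C q x \<and>
          hom_surj_on C X q \<and> direct_summand C D (Cod C q)"
begin

section \<open>Cones, approximations and images\<close>

lemma X_Obj: "U \<in> X \<Longrightarrow> U \<in> Obj C"
  using subcategory unfolding subcategory_def by blast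

lemma S_Obj: "D \<in> S \<Longrightarrow> D \<in> Obj C"
  using S_presented unfolding direct_summand_def is_biproduct_def by blast

lemma coneE:
  assumes "p \<in> Hom C P A" "P \<in> X"
  obtains D c where "c \<in> Hom C A D" "c \<cdot> p = ZeroArr C P D" "is_weak_cokernel C c p"
    "is_weak_kernel C p c" "hom_surj_on C X c" "A \<in> X \<Longrightarrow> D \<in> S"
proof -
  have p: "p \<in> Arr C" "Dom C p = P" "Cod C p = A" using assms by (simp_all add: Hom_iff)
  with cone[of p] assms(2) obtain c where c: "is_weak_cokernel C c p" "is_weak_kernel C p c"
    "hom_surj_on C X c" "A \<in> X \<longrightarrow> Cod C c \<in> S" by auto
  have "c \<in> Hom C A (Cod C c)" "c \<cdot> p = ZeroArr C P (Cod C c)"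
    using c(1) p by (auto simp: is_weak_cokernel_def Hom_iff)
  with that c show thesis by blast
qed

lemma weak_kernel_obtain:
  assumes "f \<in> Hom C A B"
  obtains K k where "k \<in> Hom C K A" "f \<cdot> k = ZeroArr C K B" "is_weak_kernel C k f"
proof -
  have f: "f \<in> Arr C" "Dom C f = A" "Cod C f = B" using assms by (simp_all add: Hom_iff)
  with weak_kernel_exists[of f] obtain k where k: "is_weak_kernel C k f" by auto
  have "k \<in> Hom C (Dom C k) A" "f \<cdot> k = ZeroArr C (Dom C k) B"
    using k f by (auto simp: is_weak_kernel_def Hom_iff)
  with that k show thesis by blast
qed

lemma approxE:
  assumes "A \<in> Obj C"
  obtains U a where "U \<in> X" "a \<in> Hom C U A" "hom_surj_on C X a"
proof -
  obtain U a where "U \<in> X" "a \<in> Hom C U A" "\<forall>X' \<in> X. \<forall>g \<in> Hom C X' A. \<exists>h \<in> Hom C X' U. a \<cdot> h = g"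
    using contravariantly_finite[unfolded contravariantly_finite_def, rule_format, OF assms] by blast
  moreover from this have "hom_surj_on C X a" by (auto simp: hom_surj_on_def Hom_iff)
  ultimately show thesis using that by blast
qed

lemma hom_inj_onI:
  assumes "f \<in> Hom C A B"
    "\<And>U g. U \<in> X \<Longrightarrow> g \<in> Hom C U A \<Longrightarrow> f \<cdot> g = ZeroArr C U B \<Longrightarrow> g = ZeroArr C U A"
  shows "hom_inj_on C X f"
  unfolding hom_inj_on_def
proof (intro ballI inj_onI)
  fix U g h assume U: "U \<in> X" and "g \<in> Hom C U (Dom C f)" "h \<in> Hom C U (Dom C f)" and eq: "f \<cdot> g = f \<cdot> h"
  then have g: "g \<in> Hom C U A" and h: "h \<in> Hom C U A" using assms(1) by (simp_all add: Hom_iff)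
  have "f \<cdot> (g \<boxplus> \<boxminus>h) = ZeroArr C U B"
    using Comp_add_right[OF g neg_in_Hom[OF h] assms(1)] comp_neg[OF h assms(1)]
      plus_neg(1)[OF Comp_closed[OF h assms(1)]] eq by simp
  from assms(2)[OF U plus_in_Hom[OF g neg_in_Hom[OF h]] this] show "g = h"
    using minus_eq_zero_iff[OF h g] by simp
qed

text \<open>The image factorization of \<open>H(p)\<close>, realized by objects: \<open>x\<close>
  covers the kernel of \<open>H(p)\<close> by a representable, and \<open>R\<close> is the cone of
  \<open>x\<close>, so \<open>H(R)\<close> is the cokernel of \<open>H(x)\<close>, which is the
  image of \<open>H(p)\<close>. The last conclusion records that \<open>H(x)\<close> reaches the
  whole kernel.\<close>

lemma image_factorization:
  assumes p: "p \<in> Hom C P A" and P: "P \<in> X"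
  obtains N R x q k where "N \<in> X" "x \<in> Hom C N P" "q \<in> Hom C P R" "k \<in> Hom C R A" "R \<in> S"
    "k \<cdot> q = p" "p \<cdot> x = ZeroArr C N A" "hom_surj_on C X q" "hom_inj_on C X k"
    "\<And>U s. U \<in> X \<Longrightarrow> s \<in> Hom C U P \<Longrightarrow> p \<cdot> s = ZeroArr C U A \<Longrightarrow> \<exists>s' \<in> Hom C U N. x \<cdot> s' = s"
proof -
  obtain L l where l: "l \<in> Hom C L P" "p \<cdot> l = ZeroArr C L A" "is_weak_kernel C l p"
    using weak_kernel_obtain[OF p] .
  obtain N a where a: "N \<in> X" "a \<in> Hom C N L" "hom_surj_on C X a" using approxE[OF HomD(4)[OF l(1)]] .
  define x where "x = l \<cdot> a"
  have x: "x \<in> Hom C N P" unfolding x_def using Comp_closed[OF a(2) l(1)] .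
  have px: "p \<cdot> x = ZeroArr C N A"
    unfolding x_def using Comp_assoc[OF a(2) l(1) p] l(2) zero_comp[OF a(2) HomD(5)[OF p]] by simp
  \<comment> \<open>Two lifts: \<open>s\<close> passes through the weak kernel \<open>L\<close>
    because \<open>p\<close> kills it, and then through the approximation \<open>a\<close> of
    \<open>L\<close> because its domain is in \<open>X\<close>.\<close>
  have ex: "\<exists>s' \<in> Hom C U N. x \<cdot> s' = s" if U: "U \<in> X" and s: "s \<in> Hom C U P" and ps: "p \<cdot> s = ZeroArr C U A" for U s
  proof -
    obtain t where t: "t \<in> Hom C U L" "l \<cdot> t = s" using weak_kernelE[OF l(3) p l(1) s ps] .
    obtain s' where s': "s' \<in> Hom C U N" "a \<cdot> s' = t" using hom_surj_onE[OF a(3,2) U t(1)] .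
    show ?thesis using s' t Comp_assoc[OF s'(1) a(2) l(1)] unfolding x_def by auto
  qed
  obtain R q where q: "q \<in> Hom C P R" "q \<cdot> x = ZeroArr C N R" "is_weak_cokernel C q x"
    "hom_surj_on C X q" "R \<in> S" using coneE[OF x a(1)] P by blast
  obtain k where k: "k \<in> Hom C R A" "k \<cdot> q = p" using weak_cokernelE[OF q(3) x q(1) p px] .
  \<comment> \<open>An element killed by \<open>k\<close> lifts along \<open>q\<close> to some
    \<open>s\<close> killed by \<open>p\<close>; this \<open>s\<close> comes from \<open>N\<close>,
    and the composite of \<open>x\<close> and \<open>q\<close> is zero.\<close>
  have "hom_inj_on C X k"
  proof (rule hom_inj_onI[OF k(1)])
    fix U r assume U: "U \<in> X" and r: "r \<in> Hom C U R" and kr: "k \<cdot> r = ZeroArr C U A"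
    obtain s where s: "s \<in> Hom C U P" "q \<cdot> s = r" using hom_surj_onE[OF q(4,1) U r] .
    have "p \<cdot> s = ZeroArr C U A" using Comp_assoc[OF s(1) q(1) k(1)] s(2) k(2) kr by simp
    then obtain s' where s': "s' \<in> Hom C U N" "x \<cdot> s' = s" using ex[OF U s(1)] by blast
    show "r = ZeroArr C U R"
      using Comp_assoc[OF s'(1) x q(1)] s'(2) s(2) q(2) zero_comp[OF s'(1) HomD(5)[OF q(1)]] by simp
  qed
  then show thesis using that[OF a(1) x q(1) k(1) q(5) k(2) px q(4)] ex by blast
qed

lemma factors_through_perp_iff:
  assumes f: "f \<in> Hom C A B"
  shows "factors_through C (right_perp C X) f \<longleftrightarrow> (\<forall>U \<in> X. \<forall>u \<in> Hom C U A. f \<cdot> u = ZeroArr C U B)"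
proof
  assume "factors_through C (right_perp C X) f"
  then obtain Y g h where Y: "Y \<in> right_perp C X" and g: "g \<in> Hom C A Y" and h: "h \<in> Hom C Y B" and fe: "f = h \<cdot> g"
    using f unfolding factors_through_def by (auto simp: Hom_iff)
  show "\<forall>U \<in> X. \<forall>u \<in> Hom C U A. f \<cdot> u = ZeroArr C U B"
  proof (intro ballI)
    fix U u assume U: "U \<in> X" and u: "u \<in> Hom C U A"
    have "g \<cdot> u = ZeroArr C U Y" using Y U Comp_closed[OF u g] unfolding right_perp_def by auto
    then show "f \<cdot> u = ZeroArr C U B"
      using Comp_assoc[OF u g h] comp_zero[OF h X_Obj[OF U]] by (simp add: fe)
  qed
next
  assume null: "\<forall>U \<in> X. \<forall>u \<in> Hom C U A. f \<cdot> u = ZeroArr C U B"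
  obtain P a where a: "P \<in> X" "a \<in> Hom C P A" "hom_surj_on C X a" using approxE[OF HomD(4)[OF f]] .
  obtain D c where c: "c \<in> Hom C A D" "c \<cdot> a = ZeroArr C P D" "is_weak_cokernel C c a" "hom_surj_on C X c"
    using coneE[OF a(2,1)] .
  obtain h where h: "h \<in> Hom C D B" "h \<cdot> c = f" using weak_cokernelE[OF c(3) a(2) c(1) f] null a by blast
  \<comment> \<open>An arrow from \<open>U\<close> to the cone lifts along \<open>c\<close> to
    \<open>A\<close>, then along the approximation \<open>a\<close> to \<open>P\<close>; but
    \<open>c\<close> after \<open>a\<close> is zero.\<close>
  have "D \<in> right_perp C X"
    unfolding right_perp_def
  proof (intro CollectI conjI ballI HomD(5)[OF c(1)] equalityI subsetI)
    fix U g assume U: "U \<in> X" and g: "g \<in> Hom C U D"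
    obtain u where u: "u \<in> Hom C U A" "c \<cdot> u = g" using hom_surj_onE[OF c(4,1) U g] .
    obtain v where v: "v \<in> Hom C U P" "a \<cdot> v = u" using hom_surj_onE[OF a(3,2) U u(1)] .
    show "g \<in> {ZeroArr C U D}"
      using Comp_assoc[OF v(1) a(2) c(1)] u v c(2) zero_comp[OF v(1) HomD(5)[OF c(1)]] by simp
  next
    fix U g assume "U \<in> X" "g \<in> {ZeroArr C U D}"
    then show "g \<in> Hom C U D" using zero_in_Hom[OF X_Obj HomD(5)[OF c(1)]] by simp
  qed
  then show "factors_through C (right_perp C X) f"
    unfolding factors_through_def using c(1) h HomD(2,3)[OF f] by auto
qed

text \<open>Fullness of \<open>H\<close> at the source \<open>A\<close>, in a strong form: the
  family need not consist of homomorphisms. This form lets the lifting lemmas below be applied to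
  families made of chosen preimages.\<close>

definition representable :: "'o \<Rightarrow> bool" where
  "representable A \<longleftrightarrow> (\<forall>B \<eta>. nat_family C X A B \<eta> \<longrightarrow> (\<exists>f \<in> Hom C A B. represents C X A f \<eta>))"

section \<open>Condition (b) and representability of natural families\<close>

definition decomposable :: bool where
  "decomposable \<longleftrightarrow> Obj C = sum_subcat C S (right_perp C X)"

lemma right_inverse_sum_subcat:
  assumes R: "R \<in> S" and k: "k \<in> Hom C R A" and g: "g \<in> Hom C A R"
    and kg: "\<And>U u. U \<in> X \<Longrightarrow> u \<in> Hom C U A \<Longrightarrow> (k \<cdot> g) \<cdot> u = u"
  shows "A \<in> sum_subcat C S (right_perp C X)"
proof -
  note A = HomD(5)[OF k] and kgA = Comp_closed[OF g k]
  note I = Ide_closed[OF A] and nkg = neg_in_Hom[OF kgA]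
  have "(Ide C A \<boxplus> \<boxminus>(k \<cdot> g)) \<cdot> u = ZeroArr C U A" if "U \<in> X" "u \<in> Hom C U A" for U u
    using Comp_add_left[OF that(2) I nkg] neg_comp[OF that(2) kgA] kg[OF that] Ide_left[OF that(2)]
      plus_neg[OF that(2)] by simp
  then have "factors_through C (right_perp C X) (Ide C A \<boxplus> \<boxminus>(k \<cdot> g))"
    by (simp add: factors_through_perp_iff[OF plus_in_Hom[OF I nkg]])
  then obtain Y j h where Y: "Y \<in> right_perp C X" and j: "j \<in> Hom C A Y" and h: "h \<in> Hom C Y A"
    and hj: "Ide C A \<boxplus> \<boxminus>(k \<cdot> g) = h \<cdot> j"
    unfolding factors_through_def using plus_in_Hom[OF I nkg] by (auto simp: Hom_iff)
  obtain P where P: "is_biproduct C R Y P" using biproducts[OF S_Obj[OF R] HomD(4)[OF h]] by blast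
  then obtain i1 i2 p1 p2 where i1: "i1 \<in> Hom C R P" and i2: "i2 \<in> Hom C Y P"
    and p1: "p1 \<in> Hom C P R" and p2: "p2 \<in> Hom C P Y" and e: "p1 \<cdot> i1 = Ide C R" "p2 \<cdot> i2 = Ide C Y"
    "p1 \<cdot> i2 = ZeroArr C Y R" "p2 \<cdot> i1 = ZeroArr C R Y"
    unfolding is_biproduct_def by blast
  \<comment> \<open>As matrices, \<open>i\<close> is the column (\<open>g\<close>, \<open>j\<close>)
    and \<open>p\<close> the row (\<open>k\<close>, \<open>h\<close>), so \<open>p\<close> after
    \<open>i\<close> is \<open>k g\<close> + \<open>h j\<close>, which is the identity by
    \<open>hj\<close>.\<close>
  define i where "i = (i1 \<cdot> g) \<boxplus> (i2 \<cdot> j)"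
  define p where "p = (k \<cdot> p1) \<boxplus> (h \<cdot> p2)"
  note c = Comp_closed[OF p1 k] Comp_closed[OF p2 h] Comp_closed[OF g i1] Comp_closed[OF j i2]
  have i: "i \<in> Hom C A P" and p: "p \<in> Hom C P A" unfolding i_def p_def using plus_in_Hom c by simp_all
  have pi1: "p \<cdot> i1 = k"
    using Comp_add_left[OF i1 c(1,2)] Comp_assoc[OF i1 p1 k] Comp_assoc[OF i1 p2 h] e
      comp_zero[OF h S_Obj[OF R]] Ide_right[OF k] plus_zero(1)[OF k] by (simp add: p_def)
  have pi2: "p \<cdot> i2 = h"
    using Comp_add_left[OF i2 c(1,2)] Comp_assoc[OF i2 p1 k] Comp_assoc[OF i2 p2 h] e
      comp_zero[OF k HomD(4)[OF h]] Ide_right[OF h] plus_zero(2)[OF h] by (simp add: p_def)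
  have "p \<cdot> i = (k \<cdot> g) \<boxplus> (Ide C A \<boxplus> \<boxminus>(k \<cdot> g))"
    using Comp_add_right[OF c(3,4) p] Comp_assoc[OF g i1 p] Comp_assoc[OF j i2 p] pi1 pi2
    by (simp add: i_def hj)
  also have "\<dots> = Ide C A"
    using plus_commute[OF I nkg] plus_assoc[OF kgA nkg I, symmetric] plus_neg(1)[OF kgA] plus_zero(2)[OF I]
    by simp
  finally have "direct_summand C A P" by (rule retract_direct_summand[OF split_idempotents i p])
  then show ?thesis unfolding sum_subcat_def using R Y P by blast
qed

text \<open>Image factorization of an approximation \<open>a\<close>: since \<open>H(a)\<close> is
  surjective, so is the second factor \<open>H(k)\<close>, which is injective already.\<close>

lemma S_approximation:
  assumes "A \<in> Obj C"
  obtains R k where "R \<in> S" "k \<in> Hom C R A" "hom_surj_on C X k" "hom_inj_on C X k"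
proof -
  obtain P a where a: "P \<in> X" "a \<in> Hom C P A" "hom_surj_on C X a" using approxE[OF assms] .
  obtain R q k where q: "q \<in> Hom C P R" and k: "k \<in> Hom C R A" "R \<in> S" "k \<cdot> q = a" "hom_inj_on C X k"
    using image_factorization[OF a(2,1)] by metis
  have "hom_surj_on C X k"
    unfolding hom_surj_on_def
  proof (intro ballI)
    fix U g assume U: "U \<in> X" and "g \<in> Hom C U (Cod C k)"
    then have g: "g \<in> Hom C U A" using k(1) by (simp add: Hom_iff)
    obtain g' where g': "g' \<in> Hom C U P" "a \<cdot> g' = g" using hom_surj_onE[OF a(3,2) U g] .
    show "\<exists>g' \<in> Hom C U (Dom C k). k \<cdot> g' = g"
    proof
      show "q \<cdot> g' \<in> Hom C U (Dom C k)" using Comp_closed[OF g'(1) q] k(1) by (simp add: Hom_iff)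
      show "k \<cdot> q \<cdot> g' = g" using Comp_assoc[OF g'(1) q k(1)] k(3) g'(2) by simp
    qed
  qed
  with that k show thesis by blast
qed

text \<open>The premise is restricted to additive families because that is all that fullness of
  \<open>H\<close> yields. It is applied to the inverse of \<open>H(k)\<close>, which is natural and
  gives a right inverse of \<open>k\<close> modulo the ideal.\<close>

lemma additive_representable_imp_decomposable:
  assumes full: "\<And>A B \<eta>. A \<in> Obj C \<Longrightarrow> B \<in> Obj C \<Longrightarrow> nat_family C X A B \<eta> \<Longrightarrow> additive_family C X A \<eta> \<Longrightarrow>
    \<exists>f \<in> Hom C A B. represents C X A f \<eta>"
  shows decomposable
  unfolding decomposable_def
proof (intro equalityI subsetI)
  fix A assume A: "A \<in> Obj C"
  obtain R k where R: "R \<in> S" and k: "k \<in> Hom C R A" "hom_surj_on C X k" "hom_inj_on C X k"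
    using S_approximation[OF A] .
  have id: "nat_family C X A A (\<lambda>u. u)" by (simp add: nat_family_def)
  obtain \<eta> where \<eta>: "nat_family C X A R \<eta>" and k\<eta>: "\<And>U u. U \<in> X \<Longrightarrow> u \<in> Hom C U A \<Longrightarrow> k \<cdot> \<eta> u = u"
    using nat_family_lift[OF k(1,3) id] hom_surj_onE[OF k(2,1)] by metis
  \<comment> \<open>Additivity is inherited from the injectivity of \<open>H(k)\<close>: after
    composing with \<open>k\<close>, both sides become the sum of \<open>u\<close> and
    \<open>v\<close>.\<close>
  have "additive_family C X A \<eta>"
    unfolding additive_family_def
  proof (intro ballI)
    fix U u v assume U: "U \<in> X" and u: "u \<in> Hom C U A" and v: "v \<in> Hom C U A"
    note \<eta>u = nat_familyD(1)[OF \<eta> U u] and \<eta>v = nat_familyD(1)[OF \<eta> U v]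
    show "\<eta> (u \<boxplus> v) = \<eta> u \<boxplus> \<eta> v"
      by (rule hom_inj_onD[OF k(3,1) U nat_familyD(1)[OF \<eta> U plus_in_Hom[OF u v]] plus_in_Hom[OF \<eta>u \<eta>v]])
        (simp add: Comp_add_right[OF \<eta>u \<eta>v k(1)] k\<eta>[OF U] u v plus_in_Hom[OF u v])
  qed
  from full[OF A HomD(4)[OF k(1)] \<eta> this] obtain g where g: "g \<in> Hom C A R" "represents C X A g \<eta>" by blast
  show "A \<in> sum_subcat C S (right_perp C X)"
  proof (rule right_inverse_sum_subcat[OF R k(1) g(1)])
    fix U u assume U: "U \<in> X" and u: "u \<in> Hom C U A"
    show "(k \<cdot> g) \<cdot> u = u"
      using Comp_assoc[OF u g(1) k(1)] g(2) k\<eta>[OF U u] U u by (simp add: represents_def)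
  qed
qed (auto simp: sum_subcat_def direct_summand_def is_biproduct_def)

text \<open>The family is extended to \<open>P\<close> along \<open>p\<close>, represented there,
  and restricted back along \<open>i\<close>.\<close>

lemma representable_retract:
  assumes P: "representable P" and A: "direct_summand C A P"
  shows "representable A"
  unfolding representable_def
proof (intro allI impI)
  fix B \<eta> assume \<eta>: "nat_family C X A B \<eta>"
  obtain i p where i: "i \<in> Hom C A P" and p: "p \<in> Hom C P A" and pi: "p \<cdot> i = Ide C A"
    using direct_summand_retract[OF A] .
  obtain f where f: "f \<in> Hom C P B" "represents C X P f (\<lambda>u. \<eta> (p \<cdot> u))"
    using P nat_family_comp'[OF \<eta> p] unfolding representable_def by blast
  show "\<exists>f \<in> Hom C A B. represents C X A f \<eta>"
  proof
    show "f \<cdot> i \<in> Hom C A B" using Comp_closed[OF i f(1)] .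
    show "represents C X A (f \<cdot> i) \<eta>"
      unfolding represents_def
    proof (intro ballI)
      fix U u assume U: "U \<in> X" and u: "u \<in> Hom C U A"
      have "\<eta> (p \<cdot> i \<cdot> u) = \<eta> u" using Comp_assoc[OF u i p] pi Ide_left[OF u] by simp
      then show "(f \<cdot> i) \<cdot> u = \<eta> u"
        using Comp_assoc[OF u i f(1)] f(2) U Comp_closed[OF u i] by (simp add: represents_def)
    qed
  qed
qed

text \<open>A Yoneda argument: \<open>q\<close> is an element of \<open>H(A)\<close> at
  \<open>P\<close> that generates all others, so the family is determined by
  \<open>\<eta> q\<close>. This arrow kills \<open>x\<close>, hence descends to the weak cokernel
  \<open>A\<close>.\<close>

lemma representable_S:
  assumes "D \<in> S" shows "representable D"
proof -
  obtain x q where x: "Dom C x \<in> X" "Cod C x \<in> X" "is_weak_cokernel C q x" "hom_surj_on C X q"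
    "direct_summand C D (Cod C q)" using S_presented[OF assms] by blast
  define N P A where "N = Dom C x" and "P = Cod C x" and "A = Cod C q"
  have NP: "N \<in> X" "P \<in> X" and xH: "x \<in> Hom C N P" and q: "q \<in> Hom C P A" and qx: "q \<cdot> x = ZeroArr C N A"
    using x by (auto simp: is_weak_cokernel_def Hom_iff N_def P_def A_def)
  have "representable A"
    unfolding representable_def
  proof (intro allI impI)
    fix B \<eta> assume \<eta>: "nat_family C X A B \<eta>"
    note \<eta>q = nat_familyD(1)[OF \<eta> NP(2) q]
    have z: "ZeroArr C N P \<in> Hom C N P" using zero_in_Hom X_Obj NP by blast
    \<comment> \<open>That \<open>\<eta>\<close> sends zero to zero follows from naturality alone,
      by writing the zero element as \<open>q\<close> composed with a zero arrow.\<close>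
    have "\<eta> q \<cdot> x = \<eta> (q \<cdot> ZeroArr C N P)"
      using nat_familyD(2)[OF \<eta> NP(2) q NP(1) xH] qx comp_zero[OF q X_Obj[OF NP(1)]] by simp
    also have "\<dots> = ZeroArr C N B"
      using nat_familyD(2)[OF \<eta> NP(2) q NP(1) z] comp_zero[OF \<eta>q X_Obj[OF NP(1)]] by simp
    finally obtain h where h: "h \<in> Hom C A B" "h \<cdot> q = \<eta> q" using weak_cokernelE[OF x(3) xH q \<eta>q] by blast
    have "represents C X A h \<eta>"
      unfolding represents_def
    proof (intro ballI)
      fix U u assume U: "U \<in> X" and u: "u \<in> Hom C U A"
      obtain v where v: "v \<in> Hom C U P" "q \<cdot> v = u" using hom_surj_onE[OF x(4) q U u] .
      show "h \<cdot> u = \<eta> u"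
        using nat_familyD(2)[OF \<eta> NP(2) q U v(1)] Comp_assoc[OF v(1) q h(1)] v(2) h(2) by simp
    qed
    with h show "\<exists>f \<in> Hom C A B. represents C X A f \<eta>" by blast
  qed
  then show ?thesis using representable_retract x(5) A_def by blast
qed

text \<open>\<open>H\<close> vanishes on \<open>Y\<close>, so every element of \<open>H(P)\<close>
  is fixed by the projection to \<open>R\<close> followed by the inclusion; a representing arrow on
  \<open>R\<close>, composed with \<open>p1\<close>, therefore works on \<open>P\<close>.\<close>

lemma decomposable_imp_representable:
  assumes decomposable and "A \<in> Obj C"
  shows "representable A"
proof -
  obtain R Y P where R: "R \<in> S" and Y: "Y \<in> right_perp C X" and P: "is_biproduct C R Y P" and A: "direct_summand C A P"
    using assms unfolding decomposable_def sum_subcat_def by blast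
  obtain i1 i2 p1 p2 where i1: "i1 \<in> Hom C R P" and i2: "i2 \<in> Hom C Y P"
    and p1: "p1 \<in> Hom C P R" and p2: "p2 \<in> Hom C P Y" and e: "(i1 \<cdot> p1) \<boxplus> (i2 \<cdot> p2) = Ide C P"
    using P unfolding is_biproduct_def by blast
  have "representable P"
    unfolding representable_def
  proof (intro allI impI)
    fix B \<eta> assume \<eta>: "nat_family C X P B \<eta>"
    obtain h where h: "h \<in> Hom C R B" "represents C X R h (\<lambda>u. \<eta> (i1 \<cdot> u))"
      using representable_S[OF R] nat_family_comp'[OF \<eta> i1] unfolding representable_def by blast
    have "represents C X P (h \<cdot> p1) \<eta>"
      unfolding represents_def
    proof (intro ballI)
      fix U u assume U: "U \<in> X" and u: "u \<in> Hom C U P"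
      have "p2 \<cdot> u = ZeroArr C U Y" using Y U Comp_closed[OF u p2] unfolding right_perp_def by auto
      then have "i1 \<cdot> p1 \<cdot> u = u"
        using Comp_add_left[OF u Comp_closed[OF p1 i1] Comp_closed[OF p2 i2]] e Ide_left[OF u]
          Comp_assoc[OF u p1 i1] Comp_assoc[OF u p2 i2] comp_zero[OF i2 X_Obj[OF U]]
          plus_zero(1)[OF Comp_closed[OF Comp_closed[OF u p1] i1]] by simp
      then show "(h \<cdot> p1) \<cdot> u = \<eta> u"
        using Comp_assoc[OF u p1 h(1)] h(2) U Comp_closed[OF u p1] by (simp add: represents_def)
    qed
    then show "\<exists>f \<in> Hom C P B. represents C X P f \<eta>" using Comp_closed[OF p1 h(1)] by blast
  qed
  then show ?thesis using representable_retract A by blast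
qed

text \<open>Cones are available only for arrows out of \<open>X\<close>, so \<open>f\<close> is
  replaced by its composite with an approximation \<open>a\<close> of \<open>A\<close>. This does
  not change the image of \<open>H(f)\<close>. The final factorization is a strict equality:
  \<open>a\<close> is itself an element of \<open>H(A)\<close>, so a suitable \<open>h\<close> kills
  \<open>f a\<close> exactly.\<close>

lemma cokernel_on_X:
  assumes f: "f \<in> Hom C A B"
  obtains D c where "c \<in> Hom C B D" "hom_surj_on C X c"
    "\<And>U u. U \<in> X \<Longrightarrow> u \<in> Hom C U A \<Longrightarrow> c \<cdot> f \<cdot> u = ZeroArr C U D"
    "\<And>U u. U \<in> X \<Longrightarrow> u \<in> Hom C U B \<Longrightarrow> c \<cdot> u = ZeroArr C U D \<Longrightarrow> \<exists>v \<in> Hom C U A. f \<cdot> v = u"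
    "\<And>E h. h \<in> Hom C B E \<Longrightarrow> (\<And>U u. U \<in> X \<Longrightarrow> u \<in> Hom C U A \<Longrightarrow> h \<cdot> f \<cdot> u = ZeroArr C U E) \<Longrightarrow>
       \<exists>h' \<in> Hom C D E. h' \<cdot> c = h"
proof -
  obtain P a where a: "P \<in> X" "a \<in> Hom C P A" "hom_surj_on C X a" using approxE[OF HomD(4)[OF f]] .
  note fa = Comp_closed[OF a(2) f]
  obtain D c where c: "c \<in> Hom C B D" "c \<cdot> f \<cdot> a = ZeroArr C P D" "is_weak_cokernel C c (f \<cdot> a)"
    "is_weak_kernel C (f \<cdot> a) c" "hom_surj_on C X c" using coneE[OF fa a(1)] .
  show thesis
  proof (rule that[OF c(1,5)])
    fix U u assume U: "U \<in> X" and u: "u \<in> Hom C U A"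
    obtain v where v: "v \<in> Hom C U P" "a \<cdot> v = u" using hom_surj_onE[OF a(3,2) U u] .
    show "c \<cdot> f \<cdot> u = ZeroArr C U D"
      using Comp_assoc[OF v(1) fa c(1)] Comp_assoc[OF v(1) a(2) f] c(2) v(2) zero_comp[OF v(1) HomD(5)[OF c(1)]]
      by simp
  next
    fix U u assume U: "U \<in> X" and u: "u \<in> Hom C U B" and cu: "c \<cdot> u = ZeroArr C U D"
    obtain v where v: "v \<in> Hom C U P" "(f \<cdot> a) \<cdot> v = u" using weak_kernelE[OF c(4,1) fa u cu] .
    then show "\<exists>v \<in> Hom C U A. f \<cdot> v = u"
      using Comp_assoc[OF v(1) a(2) f] Comp_closed[OF v(1) a(2)] by auto
  next
    fix E h assume h: "h \<in> Hom C B E" and "\<And>U u. U \<in> X \<Longrightarrow> u \<in> Hom C U A \<Longrightarrow> h \<cdot> f \<cdot> u = ZeroArr C U E"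
    then have "h \<cdot> f \<cdot> a = ZeroArr C P E" using a by simp
    then show "\<exists>h' \<in> Hom C D E. h' \<cdot> c = h" using weak_cokernelE[OF c(3) fa c(1) h] by blast
  qed
qed

text \<open>The weak kernel \<open>L\<close> maps onto the kernel of \<open>H(f)\<close> but not
  injectively; the image of the composite of \<open>l\<close> with an approximation of
  \<open>L\<close> repairs this. In contrast to \<open>cokernel_on_X\<close>, the lifting property
  is obtained only for sources in \<open>X\<close>; \<open>kernel_lift\<close> extends it.\<close>

lemma kernel_on_X:
  assumes f: "f \<in> Hom C A B"
  obtains R k where "k \<in> Hom C R A" "hom_inj_on C X k"
    "\<And>U u. U \<in> X \<Longrightarrow> u \<in> Hom C U R \<Longrightarrow> f \<cdot> k \<cdot> u = ZeroArr C U B"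
    "\<And>U u. U \<in> X \<Longrightarrow> u \<in> Hom C U A \<Longrightarrow> f \<cdot> u = ZeroArr C U B \<Longrightarrow> \<exists>v \<in> Hom C U R. k \<cdot> v = u"
proof -
  obtain L l where l: "l \<in> Hom C L A" "f \<cdot> l = ZeroArr C L B" "is_weak_kernel C l f"
    using weak_kernel_obtain[OF f] .
  obtain P a where a: "P \<in> X" "a \<in> Hom C P L" "hom_surj_on C X a" using approxE[OF HomD(4)[OF l(1)]] .
  note la = Comp_closed[OF a(2) l(1)]
  obtain R q k where q: "q \<in> Hom C P R" "hom_surj_on C X q" and k: "k \<in> Hom C R A" "k \<cdot> q = l \<cdot> a" "hom_inj_on C X k"
    using image_factorization[OF la a(1)] by metis
  show thesis
  proof (rule that[OF k(1,3)])
    fix U r assume U: "U \<in> X" and r: "r \<in> Hom C U R"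
    obtain s where s: "s \<in> Hom C U P" "q \<cdot> s = r" using hom_surj_onE[OF q(2,1) U r] .
    have "k \<cdot> r = l \<cdot> a \<cdot> s" using Comp_assoc[OF s(1) q(1) k(1)] Comp_assoc[OF s(1) a(2) l(1)] s(2) k(2) by simp
    then show "f \<cdot> k \<cdot> r = ZeroArr C U B"
      using Comp_assoc[OF Comp_closed[OF s(1) a(2)] l(1) f] l(2)
        zero_comp[OF Comp_closed[OF s(1) a(2)] HomD(5)[OF f]] by simp
  next
    fix U u assume U: "U \<in> X" and u: "u \<in> Hom C U A" and fu: "f \<cdot> u = ZeroArr C U B"
    obtain v where v: "v \<in> Hom C U L" "l \<cdot> v = u" using weak_kernelE[OF l(3) f l(1) u fu] .
    obtain w where w: "w \<in> Hom C U P" "a \<cdot> w = v" using hom_surj_onE[OF a(3,2) U v(1)] .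
    show "\<exists>v \<in> Hom C U R. k \<cdot> v = u"
    proof
      show "q \<cdot> w \<in> Hom C U R" using Comp_closed[OF w(1) q(1)] .
      show "k \<cdot> q \<cdot> w = u"
        using Comp_assoc[OF w(1) q(1) k(1)] Comp_assoc[OF w(1) a(2) l(1)] k(2) v(2) w(2) by simp
    qed
  qed
qed

end

section \<open>The quotient by the perpendicular ideal\<close>

context abelian_category
begin

text \<open>The monomorphism \<open>f\<close> is the kernel of some \<open>g\<close>. As
  \<open>f\<close> is an epimorphism, \<open>g\<close> is zero, so the identity of \<open>B\<close>
  factors through \<open>f\<close>.\<close>

lemma mono_epi_right_inverse:
  assumes f: "f \<in> Hom C A B" and "is_mono C f" and epi: "is_epi C f"
  obtains g where "g \<in> Hom C B A" "f \<cdot> g = Ide C B"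
proof -
  obtain g where g: "is_kernel C f g" using mono_is_kernel[OF assms(2)] by blast
  define D where "D = Cod C g"
  have gH: "g \<in> Hom C B D" using g f unfolding is_kernel_def D_def by (simp add: Hom_iff)
  have gf: "g \<cdot> f = ZeroArr C A D" using g HomD(2)[OF f] unfolding is_kernel_def D_def by simp
  note B = HomD(5)[OF f] and D = HomD(5)[OF gH]
  have "g = ZeroArr C B D"
    using epi[unfolded is_epi_def] gH zero_in_Hom[OF B D] gf zero_comp[OF f D] D HomD(3)[OF f] by simp
  then have "g \<cdot> Ide C B = ZeroArr C B D" using Ide_right[OF gH] by simp
  then have "\<exists>h'. h' \<in> Hom C B A \<and> f \<cdot> h' = Ide C B"
    using g[unfolded is_kernel_def] Ide_closed[OF B] B HomD(2,3)[OF gH] HomD(2)[OF f] by (metis (no_types, lifting))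
  with that show thesis by blast
qed

end

text \<open>This is the equation \<open>H(f)\<close> = \<open>H(g)\<close>; for parallel arrows it
  turns out to be congruence modulo the perpendicular ideal.\<close>

definition hom_eq_on :: "('o, 'm, 'z) addcat_scheme \<Rightarrow> 'o set \<Rightarrow> 'm \<Rightarrow> 'm \<Rightarrow> bool" where
  "hom_eq_on C X f g \<longleftrightarrow> (\<forall>U \<in> X. \<forall>u \<in> Hom C U (Dom C f). f \<cdot>\<^bsub>C\<^esub> u = g \<cdot>\<^bsub>C\<^esub> u)"

context presented_category
begin

abbreviation sim (infix \<open>\<approx>\<close> 50) where "f \<approx> g \<equiv> hom_eq_on C X f g"

section \<open>Equality of arrows after applying \<open>H\<close>\<close>

lemma simI:
  assumes "f \<in> Hom C A B" "\<And>U u. U \<in> X \<Longrightarrow> u \<in> Hom C U A \<Longrightarrow> f \<cdot> u = g \<cdot> u" shows "f \<approx> g"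
  using assms by (simp add: hom_eq_on_def Hom_iff)

lemma simD:
  assumes "f \<approx> g" "f \<in> Hom C A B" "U \<in> X" "u \<in> Hom C U A" shows "f \<cdot> u = g \<cdot> u"
  using assms by (simp add: hom_eq_on_def Hom_iff)

lemma sim_refl: "f \<approx> f" by (simp add: hom_eq_on_def)

lemma sim_sym: "f \<approx> g \<Longrightarrow> f \<in> Hom C A B \<Longrightarrow> g \<in> Hom C A B \<Longrightarrow> g \<approx> f"
  by (simp add: hom_eq_on_def Hom_iff)

lemma sim_trans: "f \<approx> g \<Longrightarrow> g \<approx> h \<Longrightarrow> f \<in> Hom C A B \<Longrightarrow> g \<in> Hom C A B \<Longrightarrow> f \<approx> h"
  by (simp add: hom_eq_on_def Hom_iff)

lemma sim_comp:
  assumes "f \<approx> f'" "g \<approx> g'" "f \<in> Hom C A B" "f' \<in> Hom C A B" "g \<in> Hom C B D" "g' \<in> Hom C B D"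
  shows "g \<cdot> f \<approx> g' \<cdot> f'"
proof (rule simI[OF Comp_closed[OF assms(3,5)]])
  fix U u assume U: "U \<in> X" "u \<in> Hom C U A"
  show "(g \<cdot> f) \<cdot> u = (g' \<cdot> f') \<cdot> u"
    using Comp_assoc[OF U(2) assms(3,5)] Comp_assoc[OF U(2) assms(4,6)] simD[OF assms(1,3) U]
      simD[OF assms(2,5) U(1) Comp_closed[OF U(2) assms(4)]] by simp
qed

lemma sim_plus:
  assumes "f \<approx> f'" "g \<approx> g'" "f \<in> Hom C A B" "f' \<in> Hom C A B" "g \<in> Hom C A B" "g' \<in> Hom C A B"
  shows "f \<boxplus> g \<approx> f' \<boxplus> g'"
proof (rule simI[OF plus_in_Hom[OF assms(3,5)]])
  fix U u assume U: "U \<in> X" "u \<in> Hom C U A"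
  show "(f \<boxplus> g) \<cdot> u = (f' \<boxplus> g') \<cdot> u"
    using Comp_add_left[OF U(2) assms(3,5)] Comp_add_left[OF U(2) assms(4,6)] simD[OF assms(1,3) U]
      simD[OF assms(2,5) U] by simp
qed

lemma sim_zero_iff:
  assumes "f \<in> Hom C A B"
  shows "f \<approx> ZeroArr C A B \<longleftrightarrow> (\<forall>U \<in> X. \<forall>u \<in> Hom C U A. f \<cdot> u = ZeroArr C U B)"
  unfolding hom_eq_on_def HomD(2)[OF assms]
  by (intro ball_cong refl) (simp add: zero_comp[OF _ HomD(5)[OF assms]])

definition cls :: "'m \<Rightarrow> 'm set" where "cls f = quot_class C (right_perp C X) f"

abbreviation (input) Q where "Q \<equiv> quot_cat C (right_perp C X)"

text \<open>By \<open>factors_through_perp_iff\<close> the difference of two arrows lies in the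
  ideal exactly when \<open>H\<close> identifies them. From here on residue classes are handled by
  evaluating on \<open>X\<close>, and no factorizations have to be exhibited.\<close>

lemma cls_eq:
  assumes f: "f \<in> Hom C A B" shows "cls f = {g \<in> Hom C A B. f \<approx> g}"
proof -
  have "factors_through C (right_perp C X) (g \<boxplus> \<boxminus>f) \<longleftrightarrow> f \<approx> g" if g: "g \<in> Hom C A B" for g
  proof -
    have "(g \<boxplus> \<boxminus>f) \<cdot> u = ZeroArr C U B \<longleftrightarrow> f \<cdot> u = g \<cdot> u" if u: "u \<in> Hom C U A" for U u
      using minus_eq_zero_iff[OF Comp_closed[OF u f] Comp_closed[OF u g]]
        Comp_add_left[OF u g neg_in_Hom[OF f]] neg_comp[OF u f] by auto
    then show ?thesis
      unfolding factors_through_perp_iff[OF plus_in_Hom[OF g neg_in_Hom[OF f]]] hom_eq_on_def HomD(2)[OF f]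
      by (intro ball_cong refl) simp
  qed
  then show ?thesis using HomD(2,3)[OF f] unfolding cls_def quot_class_def by auto
qed

lemma cls_eq_iff:
  assumes "f \<in> Hom C A B" "g \<in> Hom C A B" shows "cls f = cls g \<longleftrightarrow> f \<approx> g"
proof
  assume "cls f = cls g"
  then have "g \<in> cls f" using sim_refl assms(2) by (simp add: cls_eq)
  then show "f \<approx> g" using assms by (simp add: cls_eq)
next
  assume fg: "f \<approx> g"
  then show "cls f = cls g"
    using assms sim_trans[OF fg _ assms] sim_trans[OF sim_sym[OF fg assms] _ assms(2,1)]
    by (auto simp: cls_eq)
qed

text \<open>The operations of the quotient are computed on \<open>SOME\<close> representatives;
  this, together with congruence, removes the choice in \<open>cls_Comp\<close> and
  \<open>cls_plus\<close>.\<close>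

lemma rep_cls:
  assumes "f \<in> Hom C A B"
  shows "(SOME g. g \<in> cls f) \<in> Hom C A B" "f \<approx> (SOME g. g \<in> cls f)"
proof -
  have "f \<in> cls f" using assms sim_refl by (simp add: cls_eq)
  then have "(SOME g. g \<in> cls f) \<in> cls f" by (rule someI)
  then show "(SOME g. g \<in> cls f) \<in> Hom C A B" "f \<approx> (SOME g. g \<in> cls f)" using assms by (auto simp: cls_eq)
qed

section \<open>The quotient as an additive category\<close>

lemma Q_Obj [simp]: "Obj Q = Obj C" by (simp add: quot_cat_def)

lemma Q_Ide [simp]: "Ide Q A = cls (Ide C A)" by (simp add: quot_cat_def cls_def)

lemma Q_Zero [simp]: "ZeroArr Q A B = cls (ZeroArr C A B)" by (simp add: quot_cat_def cls_def)

lemma cls_in_Hom: assumes "f \<in> Hom C A B" shows "cls f \<in> Hom Q A B"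
  using rep_cls(1)[OF assms] assms by (auto simp: quot_cat_def cls_def[symmetric] Hom_def)

lemma Q_HomE:
  assumes "F \<in> Hom Q A B" obtains f where "f \<in> Hom C A B" "F = cls f"
proof -
  obtain f where f: "f \<in> Arr C" "F = cls f"
    using assms by (auto simp: quot_cat_def cls_def[symmetric] Hom_def)
  from cls_in_Hom[OF Arr_Hom[OF f(1)]] assms f(2) have "Dom C f = A" "Cod C f = B" by (auto simp: Hom_def)
  with that f show thesis by (simp add: Hom_def)
qed

lemma cls_Comp:
  assumes f: "f \<in> Hom C A B" and g: "g \<in> Hom C B D" shows "cls g \<cdot>\<^bsub>Q\<^esub> cls f = cls (g \<cdot> f)"
proof -
  note r = rep_cls[OF f] rep_cls[OF g]
  have "cls g \<cdot>\<^bsub>Q\<^esub> cls f = cls ((SOME h. h \<in> cls g) \<cdot> (SOME h. h \<in> cls f))"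
    by (simp add: quot_cat_def cls_def)
  also have "\<dots> = cls (g \<cdot> f)"
    using cls_eq_iff[OF Comp_closed[OF f g] Comp_closed[OF r(1,3)]] sim_comp[OF r(2,4) f r(1) g r(3)] by simp
  finally show ?thesis .
qed

lemma cls_plus:
  assumes f: "f \<in> Hom C A B" and g: "g \<in> Hom C A B" shows "PlusArr Q (cls f) (cls g) = cls (f \<boxplus> g)"
proof -
  note r = rep_cls[OF f] rep_cls[OF g]
  have "PlusArr Q (cls f) (cls g) = cls ((SOME h. h \<in> cls f) \<boxplus> (SOME h. h \<in> cls g))"
    by (simp add: quot_cat_def cls_def)
  also have "\<dots> = cls (f \<boxplus> g)"
    using cls_eq_iff[OF plus_in_Hom[OF f g] plus_in_Hom[OF r(1,3)]] sim_plus[OF r(2,4) f r(1) g r(3)] by simp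
  finally show ?thesis .
qed

lemma Q_preadditive: "preadditive_category Q"
proof (intro preadditive_category.intro category.intro preadditive_category_axioms.intro)
  fix F assume "F \<in> Arr Q"
  then have "F \<in> Hom Q (Dom Q F) (Cod Q F)" by (simp add: Hom_def)
  then obtain f where "f \<in> Hom C (Dom Q F) (Cod Q F)" by (rule Q_HomE)
  then show "Dom Q F \<in> Obj Q" "Cod Q F \<in> Obj Q" using HomD(4,5) by auto
next
  fix A assume "A \<in> Obj Q"
  then show "Ide Q A \<in> Hom Q A A" using cls_in_Hom[OF Ide_closed] by simp
next
  fix F G A B D assume "F \<in> Hom Q A B" "G \<in> Hom Q B D"
  then show "G \<cdot>\<^bsub>Q\<^esub> F \<in> Hom Q A D" by (auto elim!: Q_HomE simp: cls_Comp intro!: cls_in_Hom Comp_closed)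
next
  fix F A B assume F: "F \<in> Hom Q A B"
  then obtain f where f: "f \<in> Hom C A B" "F = cls f" by (rule Q_HomE)
  show "Ide Q B \<cdot>\<^bsub>Q\<^esub> F = F" using cls_Comp[OF f(1) Ide_closed[OF HomD(5)[OF f(1)]]] Ide_left[OF f(1)] f(2) by simp
  show "F \<cdot>\<^bsub>Q\<^esub> Ide Q A = F" using cls_Comp[OF Ide_closed[OF HomD(4)[OF f(1)]] f(1)] Ide_right[OF f(1)] f(2) by simp
next
  fix F G H A B D E assume "F \<in> Hom Q A B" "G \<in> Hom Q B D" "H \<in> Hom Q D E"
  then obtain f g h where f: "f \<in> Hom C A B" "F = cls f" and g: "g \<in> Hom C B D" "G = cls g"
    and h: "h \<in> Hom C D E" "H = cls h" by (meson Q_HomE)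
  show "H \<cdot>\<^bsub>Q\<^esub> G \<cdot>\<^bsub>Q\<^esub> F = (H \<cdot>\<^bsub>Q\<^esub> G) \<cdot>\<^bsub>Q\<^esub> F"
    using Comp_assoc[OF f(1) g(1) h(1)] cls_Comp[OF f(1) g(1)] cls_Comp[OF g(1) h(1)]
      cls_Comp[OF Comp_closed[OF f(1) g(1)] h(1)] cls_Comp[OF f(1) Comp_closed[OF g(1) h(1)]] f(2) g(2) h(2)
    by simp
next
  fix A B assume "A \<in> Obj Q" "B \<in> Obj Q"
  then have AB: "A \<in> Obj C" "B \<in> Obj C" by simp_all
  show "comm_group (hom_group Q A B)"
  proof (rule comm_groupI)
    fix F G assume "F \<in> carrier (hom_group Q A B)" "G \<in> carrier (hom_group Q A B)"
    then obtain f g where fg: "f \<in> Hom C A B" "F = cls f" "g \<in> Hom C A B" "G = cls g"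
      by (auto simp: hom_group_def elim!: Q_HomE)
    show "F \<otimes>\<^bsub>hom_group Q A B\<^esub> G \<in> carrier (hom_group Q A B)"
      using cls_in_Hom[OF plus_in_Hom[OF fg(1,3)]] fg by (simp add: hom_group_def cls_plus)
    show "F \<otimes>\<^bsub>hom_group Q A B\<^esub> G = G \<otimes>\<^bsub>hom_group Q A B\<^esub> F"
      using plus_commute[OF fg(1,3)] fg by (simp add: hom_group_def cls_plus)
  next
    show "\<one>\<^bsub>hom_group Q A B\<^esub> \<in> carrier (hom_group Q A B)"
      using cls_in_Hom[OF zero_in_Hom[OF AB]] by (simp add: hom_group_def)
  next
    fix F G H assume "F \<in> carrier (hom_group Q A B)" "G \<in> carrier (hom_group Q A B)" "H \<in> carrier (hom_group Q A B)"
    then obtain f g h where fg: "f \<in> Hom C A B" "F = cls f" "g \<in> Hom C A B" "G = cls g" "h \<in> Hom C A B" "H = cls h"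
      by (auto simp: hom_group_def elim!: Q_HomE)
    show "(F \<otimes>\<^bsub>hom_group Q A B\<^esub> G) \<otimes>\<^bsub>hom_group Q A B\<^esub> H = F \<otimes>\<^bsub>hom_group Q A B\<^esub> (G \<otimes>\<^bsub>hom_group Q A B\<^esub> H)"
      using plus_assoc[OF fg(1,3,5)] cls_plus[OF fg(1,3)] cls_plus[OF fg(3,5)]
        cls_plus[OF fg(1) plus_in_Hom[OF fg(3,5)]] cls_plus[OF plus_in_Hom[OF fg(1,3)] fg(5)] fg(2,4,6)
      by (simp add: hom_group_def)
  next
    fix F assume "F \<in> carrier (hom_group Q A B)"
    then obtain f where f: "f \<in> Hom C A B" "F = cls f" by (auto simp: hom_group_def elim!: Q_HomE)
    show "\<one>\<^bsub>hom_group Q A B\<^esub> \<otimes>\<^bsub>hom_group Q A B\<^esub> F = F"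
      using cls_plus[OF zero_in_Hom[OF AB] f(1)] plus_zero(2)[OF f(1)] f(2) by (simp add: hom_group_def)
    show "\<exists>G \<in> carrier (hom_group Q A B). G \<otimes>\<^bsub>hom_group Q A B\<^esub> F = \<one>\<^bsub>hom_group Q A B\<^esub>"
      using cls_plus[OF neg_in_Hom[OF f(1)] f(1)] plus_neg(2)[OF f(1)] f(2) cls_in_Hom[OF neg_in_Hom[OF f(1)]]
      by (auto simp: hom_group_def)
  qed
next
  fix F F' G A B D assume "F \<in> Hom Q A B" "F' \<in> Hom Q A B" "G \<in> Hom Q B D"
  then obtain f f' g where f: "f \<in> Hom C A B" "F = cls f" "f' \<in> Hom C A B" "F' = cls f'"
    and g: "g \<in> Hom C B D" "G = cls g" by (meson Q_HomE)
  show "G \<cdot>\<^bsub>Q\<^esub> PlusArr Q F F' = PlusArr Q (G \<cdot>\<^bsub>Q\<^esub> F) (G \<cdot>\<^bsub>Q\<^esub> F')"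
    using Comp_add_right[OF f(1,3) g(1)] cls_plus[OF f(1,3)] cls_Comp[OF f(1) g(1)] cls_Comp[OF f(3) g(1)]
      cls_Comp[OF plus_in_Hom[OF f(1,3)] g(1)] cls_plus[OF Comp_closed[OF f(1) g(1)] Comp_closed[OF f(3) g(1)]] f g
    by simp
next
  fix F G G' A B D assume "F \<in> Hom Q A B" "G \<in> Hom Q B D" "G' \<in> Hom Q B D"
  then obtain f g g' where f: "f \<in> Hom C A B" "F = cls f"
    and g: "g \<in> Hom C B D" "G = cls g" "g' \<in> Hom C B D" "G' = cls g'" by (meson Q_HomE)
  show "PlusArr Q G G' \<cdot>\<^bsub>Q\<^esub> F = PlusArr Q (G \<cdot>\<^bsub>Q\<^esub> F) (G' \<cdot>\<^bsub>Q\<^esub> F)"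
    using Comp_add_left[OF f(1) g(1,3)] cls_plus[OF g(1,3)] cls_Comp[OF f(1) g(1)] cls_Comp[OF f(1) g(3)]
      cls_Comp[OF f(1) plus_in_Hom[OF g(1,3)]] cls_plus[OF Comp_closed[OF f(1) g(1)] Comp_closed[OF f(1) g(3)]] f g
    by simp
qed

lemma Q_biproduct: assumes "is_biproduct C A B P" shows "is_biproduct Q A B P"
proof -
  obtain i j p q where h: "i \<in> Hom C A P" "j \<in> Hom C B P" "p \<in> Hom C P A" "q \<in> Hom C P B"
    and e: "p \<cdot> i = Ide C A" "q \<cdot> j = Ide C B" "p \<cdot> j = ZeroArr C B A" "q \<cdot> i = ZeroArr C A B"
     "(i \<cdot> p) \<boxplus> (j \<cdot> q) = Ide C P" using assms unfolding is_biproduct_def by blast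
  note c = h[THEN cls_in_Hom]
  show ?thesis unfolding is_biproduct_def
    by (intro conjI bexI[OF _ c(1)] bexI[OF _ c(2)] bexI[OF _ c(3)] bexI[OF _ c(4)])
      (use HomD(4,5)[OF h(1)] HomD(4)[OF h(2)] in \<open>simp_all add: e
        cls_Comp[OF h(1,3)] cls_Comp[OF h(1,4)] cls_Comp[OF h(2,3)] cls_Comp[OF h(2,4)]
        cls_Comp[OF h(3,1)] cls_Comp[OF h(4,2)] cls_plus[OF Comp_closed[OF h(3,1)] Comp_closed[OF h(4,2)]]\<close>)
qed

lemma Q_additive: "additive_category Q"
proof -
  interpret Q: preadditive_category Q by (rule Q_preadditive)
  show ?thesis
  proof
    obtain Z where "is_zero_object C Z" using zero_object by blast
    then have "is_zero_object Q Z" unfolding Q.zero_object_iff zero_object_iff by simp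
    then show "\<exists>Z. is_zero_object Q Z" by blast
  next
    fix A B assume "A \<in> Obj Q" "B \<in> Obj Q"
    then show "\<exists>P. is_biproduct Q A B P" using biproducts[of A B] Q_biproduct by auto
  qed
qed

section \<open>Monomorphisms, epimorphisms, kernels and cokernels in the quotient\<close>

lemma hom_inj_on_sim:
  assumes "hom_inj_on C X k" "k \<in> Hom C R A" "f \<in> Hom C E R" "g \<in> Hom C E R" "k \<cdot> f \<approx> k \<cdot> g"
  shows "f \<approx> g"
proof (rule simI[OF assms(3)])
  fix U u assume U: "U \<in> X" and u: "u \<in> Hom C U E"
  show "f \<cdot> u = g \<cdot> u"
    by (rule hom_inj_onD[OF assms(1,2) U Comp_closed[OF u assms(3)] Comp_closed[OF u assms(4)]])
      (simp add: Comp_assoc[OF u assms(3,2)] Comp_assoc[OF u assms(4,2)]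
        simD[OF assms(5) Comp_closed[OF assms(3,2)] U u])
qed

lemma hom_surj_on_sim:
  assumes "hom_surj_on C X c" "c \<in> Hom C A B" "f \<in> Hom C B E" "g \<in> Hom C B E" "f \<cdot> c \<approx> g \<cdot> c"
  shows "f \<approx> g"
proof (rule simI[OF assms(3)])
  fix U u assume U: "U \<in> X" and u: "u \<in> Hom C U B"
  obtain v where v: "v \<in> Hom C U A" "c \<cdot> v = u" using hom_surj_onE[OF assms(1,2) U u] .
  show "f \<cdot> u = g \<cdot> u"
    using simD[OF assms(5) Comp_closed[OF assms(2,3)] U v(1)] Comp_assoc[OF v(1) assms(2,3)]
      Comp_assoc[OF v(1) assms(2,4)] v(2) by simp
qed

text \<open>Objects of \<open>X\<close> are test objects of the quotient: arrows out of them are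
  identified only if they are equal. So cancelling against such arrows is injectivity of
  \<open>H(f)\<close>, and conversely agreement on \<open>X\<close> decides equality of
  classes.\<close>

lemma Q_mono_iff:
  assumes f: "f \<in> Hom C A B" shows "is_mono Q (cls f) \<longleftrightarrow> hom_inj_on C X f"
proof
  assume m: "is_mono Q (cls f)"
  show "hom_inj_on C X f"
    unfolding hom_inj_on_def
  proof (intro ballI inj_onI)
    fix U g h assume U: "U \<in> X" and "g \<in> Hom C U (Dom C f)" "h \<in> Hom C U (Dom C f)" and eq: "f \<cdot> g = f \<cdot> h"
    then have g: "g \<in> Hom C U A" and h: "h \<in> Hom C U A" using f by (simp_all add: Hom_iff)
    have "cls f \<cdot>\<^bsub>Q\<^esub> cls g = cls f \<cdot>\<^bsub>Q\<^esub> cls h" using cls_Comp[OF g f] cls_Comp[OF h f] eq by simp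
    then have "cls g = cls h"
      using m cls_in_Hom[OF g] cls_in_Hom[OF h] cls_in_Hom[OF f] X_Obj[OF U] unfolding is_mono_def
      by (auto simp: Hom_def[of Q])
    then have "g \<approx> h" using cls_eq_iff[OF g h] by simp
    \<comment> \<open>Evaluating the congruence at the identity of \<open>U\<close>, which is an
      arrow from an object of \<open>X\<close>.\<close>
    then show "g = h" using simD[OF _ g U Ide_closed[OF X_Obj[OF U]]] Ide_right[OF g] Ide_right[OF h] by simp
  qed
next
  assume inj: "hom_inj_on C X f"
  have D: "cls f \<in> Arr Q" "Dom Q (cls f) = A" using cls_in_Hom[OF f] by (simp_all add: Hom_def)
  show "is_mono Q (cls f)"
    unfolding is_mono_def D
  proof (intro conjI ballI impI D)
    fix E G H assume "G \<in> Hom Q E A" "H \<in> Hom Q E A" and eq: "cls f \<cdot>\<^bsub>Q\<^esub> G = cls f \<cdot>\<^bsub>Q\<^esub> H"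
    then obtain g h where g: "g \<in> Hom C E A" "G = cls g" and h: "h \<in> Hom C E A" "H = cls h" by (meson Q_HomE)
    have "f \<cdot> g \<approx> f \<cdot> h"
      using eq cls_Comp[OF g(1) f] cls_Comp[OF h(1) f] cls_eq_iff[OF Comp_closed[OF g(1) f] Comp_closed[OF h(1) f]]
        g(2) h(2) by simp
    from hom_inj_on_sim[OF inj f g(1) h(1) this] show "G = H" using cls_eq_iff[OF g(1) h(1)] g(2) h(2) by simp
  qed
qed

text \<open>For an epimorphism, the cokernel arrow \<open>c\<close> becomes zero in the quotient, so
  \<open>H(c)\<close> is zero and every element of \<open>H(B)\<close> is hit by
  \<open>H(f)\<close>. The converse cancels a surjection elementwise.\<close>

lemma Q_epi_iff:
  assumes f: "f \<in> Hom C A B" shows "is_epi Q (cls f) \<longleftrightarrow> hom_surj_on C X f"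
proof
  assume e: "is_epi Q (cls f)"
  obtain D c where c: "c \<in> Hom C B D" "\<And>U u. U \<in> X \<Longrightarrow> u \<in> Hom C U A \<Longrightarrow> c \<cdot> f \<cdot> u = ZeroArr C U D"
    "\<And>U u. U \<in> X \<Longrightarrow> u \<in> Hom C U B \<Longrightarrow> c \<cdot> u = ZeroArr C U D \<Longrightarrow> \<exists>v \<in> Hom C U A. f \<cdot> v = u"
    using cokernel_on_X[OF f] by metis
  note D = HomD(5)[OF c(1)] and z = zero_in_Hom[OF HomD(4,5)[OF c(1)]]
  have "c \<cdot> f \<approx> ZeroArr C A D"
    using sim_zero_iff[OF Comp_closed[OF f c(1)]] c(2) Comp_assoc[OF _ f c(1)] by simp
  then have "cls c \<cdot>\<^bsub>Q\<^esub> cls f = cls (ZeroArr C B D) \<cdot>\<^bsub>Q\<^esub> cls f"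
    using cls_Comp[OF f c(1)] cls_Comp[OF f z] zero_comp[OF f D]
      cls_eq_iff[OF Comp_closed[OF f c(1)] zero_in_Hom[OF HomD(4)[OF f] D]] by simp
  then have "cls c = cls (ZeroArr C B D)"
    using e cls_in_Hom[OF f] cls_in_Hom[OF c(1)] cls_in_Hom[OF z] D unfolding is_epi_def
    by (auto simp: Hom_def[of Q])
  then have cz: "c \<approx> ZeroArr C B D" using cls_eq_iff[OF c(1) z] by simp
  show "hom_surj_on C X f"
    unfolding hom_surj_on_def using c(3) cz sim_zero_iff[OF c(1)] HomD(2,3)[OF f] by simp
next
  assume surj: "hom_surj_on C X f"
  have D: "cls f \<in> Arr Q" "Cod Q (cls f) = B" using cls_in_Hom[OF f] by (simp_all add: Hom_def)
  show "is_epi Q (cls f)"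
    unfolding is_epi_def D
  proof (intro conjI ballI impI D)
    fix E G H assume "G \<in> Hom Q B E" "H \<in> Hom Q B E" and eq: "G \<cdot>\<^bsub>Q\<^esub> cls f = H \<cdot>\<^bsub>Q\<^esub> cls f"
    then obtain g h where g: "g \<in> Hom C B E" "G = cls g" and h: "h \<in> Hom C B E" "H = cls h" by (meson Q_HomE)
    have "g \<cdot> f \<approx> h \<cdot> f"
      using eq cls_Comp[OF f g(1)] cls_Comp[OF f h(1)] cls_eq_iff[OF Comp_closed[OF f g(1)] Comp_closed[OF f h(1)]]
        g(2) h(2) by simp
    from hom_surj_on_sim[OF surj f g(1) h(1) this] show "G = H" using cls_eq_iff[OF g(1) h(1)] g(2) h(2) by simp
  qed
qed

text \<open>Injectivity of \<open>H(k)\<close> makes \<open>cls k\<close> a monomorphism, which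
  settles uniqueness; what remains to be supplied is a factorization up to
  \<open>\<approx>\<close>.\<close>

lemma Q_is_kernelI:
  assumes f: "f \<in> Hom C A B" and k: "k \<in> Hom C R A" and inj: "hom_inj_on C X k"
    and fk: "f \<cdot> k \<approx> ZeroArr C R B"
    and univ: "\<And>E h. h \<in> Hom C E A \<Longrightarrow> f \<cdot> h \<approx> ZeroArr C E B \<Longrightarrow> \<exists>h' \<in> Hom C E R. k \<cdot> h' \<approx> h"
  shows "is_kernel Q (cls k) (cls f)"
proof -
  have D: "cls f \<in> Arr Q" "Dom Q (cls f) = A" "Cod Q (cls f) = B" "cls k \<in> Arr Q" "Dom Q (cls k) = R" "Cod Q (cls k) = A"
    using cls_in_Hom[OF f] cls_in_Hom[OF k] by (simp_all add: Hom_def)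
  note z = zero_in_Hom[OF _ HomD(5)[OF f]]
  show ?thesis
    unfolding is_kernel_def D
  proof (intro conjI ballI impI D refl)
    show "cls f \<cdot>\<^bsub>Q\<^esub> cls k = ZeroArr Q R B"
      using cls_Comp[OF k f] fk cls_eq_iff[OF Comp_closed[OF k f] z[OF HomD(4)[OF k]]] by simp
  next
    fix E H assume E: "E \<in> Obj Q" and "H \<in> Hom Q E A" and fH: "cls f \<cdot>\<^bsub>Q\<^esub> H = ZeroArr Q E B"
    then obtain h where h: "h \<in> Hom C E A" "H = cls h" by (meson Q_HomE)
    have "f \<cdot> h \<approx> ZeroArr C E B"
      using fH h(2) cls_Comp[OF h(1) f] cls_eq_iff[OF Comp_closed[OF h(1) f] z[OF HomD(4)[OF h(1)]]] by simp
    then obtain h' where h': "h' \<in> Hom C E R" "k \<cdot> h' \<approx> h" using univ[OF h(1)] by blast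
    show "\<exists>!h'. h' \<in> Hom Q E R \<and> cls k \<cdot>\<^bsub>Q\<^esub> h' = H"
    proof (rule ex1I[of _ "cls h'"])
      show "cls h' \<in> Hom Q E R \<and> cls k \<cdot>\<^bsub>Q\<^esub> cls h' = H"
        using cls_in_Hom[OF h'(1)] cls_Comp[OF h'(1) k] cls_eq_iff[OF Comp_closed[OF h'(1) k] h(1)] h'(2) h(2) by simp
      then have kh': "cls k \<cdot>\<^bsub>Q\<^esub> cls h' = H" ..
      fix G assume G: "G \<in> Hom Q E R \<and> cls k \<cdot>\<^bsub>Q\<^esub> G = H"
      have "is_mono Q (cls k)" using Q_mono_iff[OF k] inj by simp
      then show "G = cls h'" using G kh' cls_in_Hom[OF h'(1)] E unfolding is_mono_def D by metis
    qed
  qed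
qed

lemma Q_is_cokernelI:
  assumes f: "f \<in> Hom C A B" and c: "c \<in> Hom C B D" and surj: "hom_surj_on C X c"
    and cf: "c \<cdot> f \<approx> ZeroArr C A D"
    and univ: "\<And>E h. h \<in> Hom C B E \<Longrightarrow> h \<cdot> f \<approx> ZeroArr C A E \<Longrightarrow> \<exists>h' \<in> Hom C D E. h' \<cdot> c \<approx> h"
  shows "is_cokernel Q (cls c) (cls f)"
proof -
  have D: "cls f \<in> Arr Q" "Dom Q (cls f) = A" "Cod Q (cls f) = B" "cls c \<in> Arr Q" "Dom Q (cls c) = B" "Cod Q (cls c) = D"
    using cls_in_Hom[OF f] cls_in_Hom[OF c] by (simp_all add: Hom_def)
  note z = zero_in_Hom[OF HomD(4)[OF f]]
  show ?thesis
    unfolding is_cokernel_def D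
  proof (intro conjI ballI impI D refl)
    show "cls c \<cdot>\<^bsub>Q\<^esub> cls f = ZeroArr Q A D"
      using cls_Comp[OF f c] cf cls_eq_iff[OF Comp_closed[OF f c] z[OF HomD(5)[OF c]]] by simp
  next
    fix E H assume E: "E \<in> Obj Q" and "H \<in> Hom Q B E" and fH: "H \<cdot>\<^bsub>Q\<^esub> cls f = ZeroArr Q A E"
    then obtain h where h: "h \<in> Hom C B E" "H = cls h" by (meson Q_HomE)
    have "h \<cdot> f \<approx> ZeroArr C A E"
      using fH h(2) cls_Comp[OF f h(1)] cls_eq_iff[OF Comp_closed[OF f h(1)] z[OF HomD(5)[OF h(1)]]] by simp
    then obtain h' where h': "h' \<in> Hom C D E" "h' \<cdot> c \<approx> h" using univ[OF h(1)] by blast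
    show "\<exists>!h'. h' \<in> Hom Q D E \<and> h' \<cdot>\<^bsub>Q\<^esub> cls c = H"
    proof (rule ex1I[of _ "cls h'"])
      show "cls h' \<in> Hom Q D E \<and> cls h' \<cdot>\<^bsub>Q\<^esub> cls c = H"
        using cls_in_Hom[OF h'(1)] cls_Comp[OF c h'(1)] cls_eq_iff[OF Comp_closed[OF c h'(1)] h(1)] h'(2) h(2) by simp
      then have kh': "cls h' \<cdot>\<^bsub>Q\<^esub> cls c = H" ..
      fix G assume G: "G \<in> Hom Q D E \<and> G \<cdot>\<^bsub>Q\<^esub> cls c = H"
      have "is_epi Q (cls c)" using Q_epi_iff[OF c] surj by simp
      then show "G = cls h'" using G kh' cls_in_Hom[OF h'(1)] E unfolding is_epi_def D by metis
    qed
  qed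
qed

lemma abelian_imp_decomposable:
  assumes "abelian_category Q" shows decomposable
  unfolding decomposable_def
proof (intro equalityI subsetI)
  interpret Q: abelian_category Q by fact
  fix A assume A: "A \<in> Obj C"
  obtain R k where R: "R \<in> S" and k: "k \<in> Hom C R A" "hom_surj_on C X k" "hom_inj_on C X k"
    using S_approximation[OF A] .
  obtain G where G: "G \<in> Hom Q A R" "cls k \<cdot>\<^bsub>Q\<^esub> G = Ide Q A"
    using Q.mono_epi_right_inverse[OF cls_in_Hom[OF k(1)]] Q_mono_iff[OF k(1)] Q_epi_iff[OF k(1)] k by blast
  obtain g where g: "g \<in> Hom C A R" "G = cls g" using Q_HomE[OF G(1)] .
  have sim: "k \<cdot> g \<approx> Ide C A"
    using G(2) g cls_Comp[OF g(1) k(1)] cls_eq_iff[OF Comp_closed[OF g(1) k(1)] Ide_closed[OF A]] by simp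
  show "A \<in> sum_subcat C S (right_perp C X)"
  proof (rule right_inverse_sum_subcat[OF R k(1) g(1)])
    fix U u assume "U \<in> X" and u: "u \<in> Hom C U A"
    then show "(k \<cdot> g) \<cdot> u = u"
      using simD[OF sim Comp_closed[OF g(1) k(1)]] Ide_left[OF u] by simp
  qed
qed (auto simp: sum_subcat_def direct_summand_def is_biproduct_def)

text \<open>The elementwise lifts are unique by injectivity of \<open>H(k)\<close>, hence form a
  natural family out of \<open>E\<close>; representability of \<open>E\<close> makes an arrow of it.
  This arrow lifts \<open>h\<close> only modulo the ideal.\<close>

lemma kernel_lift:
  assumes rep: "representable E" and k: "k \<in> Hom C R A" "hom_inj_on C X k" and h: "h \<in> Hom C E A"
    and lift: "\<And>U u. U \<in> X \<Longrightarrow> u \<in> Hom C U E \<Longrightarrow> \<exists>r \<in> Hom C U R. k \<cdot> r = h \<cdot> u"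
  shows "\<exists>h' \<in> Hom C E R. k \<cdot> h' \<approx> h"
proof -
  obtain \<eta> where \<eta>: "nat_family C X E R \<eta>" "\<And>U u. U \<in> X \<Longrightarrow> u \<in> Hom C U E \<Longrightarrow> k \<cdot> \<eta> u = h \<cdot> u"
    using nat_family_lift[OF k nat_family_comp[OF h]] lift by metis
  obtain h' where h': "h' \<in> Hom C E R" "represents C X E h' \<eta>" using rep \<eta>(1) unfolding representable_def by blast
  have "k \<cdot> h' \<approx> h"
  proof (rule simI[OF Comp_closed[OF h'(1) k(1)]])
    fix U u assume U: "U \<in> X" and u: "u \<in> Hom C U E"
    show "(k \<cdot> h') \<cdot> u = h \<cdot> u"
      using Comp_assoc[OF u h'(1) k(1)] h'(2) \<eta>(2)[OF U u] U u by (simp add: represents_def)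
  qed
  with h' show ?thesis by blast
qed

text \<open>The family sends an element of \<open>H(B)\<close> to the image under \<open>h\<close>
  of any preimage along \<open>f\<close>. It starts at \<open>B\<close>, so it is the target of
  \<open>f\<close> that has to be representable.\<close>

lemma cokernel_lift:
  assumes rep: "representable B" and f: "f \<in> Hom C A B" "hom_surj_on C X f" and h: "h \<in> Hom C A E"
    and ker: "\<And>U u. U \<in> X \<Longrightarrow> u \<in> Hom C U A \<Longrightarrow> f \<cdot> u = ZeroArr C U B \<Longrightarrow> h \<cdot> u = ZeroArr C U E"
  shows "\<exists>h' \<in> Hom C B E. h' \<cdot> f \<approx> h"
proof -
  define \<eta> where "\<eta> b = h \<cdot> (SOME a. a \<in> Hom C (Dom C b) A \<and> f \<cdot> a = b)" for b
  have \<eta>f: "\<eta> (f \<cdot> a) = h \<cdot> a" if U: "U \<in> X" and a: "a \<in> Hom C U A" for U a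
  proof -
    define a' where "a' = (SOME a'. a' \<in> Hom C U A \<and> f \<cdot> a' = f \<cdot> a)"
    have "a' \<in> Hom C U A \<and> f \<cdot> a' = f \<cdot> a" unfolding a'_def by (rule someI[of _ a]) (simp add: a)
    then have a': "a' \<in> Hom C U A" "f \<cdot> a' = f \<cdot> a" by auto
    note d = plus_in_Hom[OF a'(1) neg_in_Hom[OF a]]
    \<comment> \<open>The chosen preimage and \<open>a\<close> differ by an element of the kernel of
      \<open>H(f)\<close>, which \<open>h\<close> kills; so \<open>\<eta>\<close> does not depend on
      the choice.\<close>
    have "f \<cdot> (a' \<boxplus> \<boxminus>a) = ZeroArr C U B"
      using Comp_add_right[OF a'(1) neg_in_Hom[OF a] f(1)] comp_neg[OF a f(1)] a'(2)
        plus_neg(1)[OF Comp_closed[OF a f(1)]] by simp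
    from ker[OF U d this] have "h \<cdot> a' = h \<cdot> a"
      using Comp_add_right[OF a'(1) neg_in_Hom[OF a] h] comp_neg[OF a h]
        minus_eq_zero_iff[OF Comp_closed[OF a h] Comp_closed[OF a'(1) h]] by simp
    moreover have "Dom C (f \<cdot> a) = U" using Comp_closed[OF a f(1)] by (simp add: Hom_iff)
    ultimately show ?thesis unfolding \<eta>_def a'_def by simp
  qed
  have "nat_family C X B E \<eta>"
    unfolding nat_family_def
  proof (intro conjI ballI)
    fix U u assume U: "U \<in> X" and u: "u \<in> Hom C U B"
    obtain a where a: "a \<in> Hom C U A" "f \<cdot> a = u" using hom_surj_onE[OF f(2,1) U u] .
    show "\<eta> u \<in> Hom C U E" using \<eta>f[OF U a(1)] a(2) Comp_closed[OF a(1) h] by simp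
  next
    fix U V v u assume U: "U \<in> X" "V \<in> X" and v: "v \<in> Hom C U V" and u: "u \<in> Hom C V B"
    obtain a where a: "a \<in> Hom C V A" "f \<cdot> a = u" using hom_surj_onE[OF f(2,1) U(2) u] .
    show "\<eta> (u \<cdot> v) = \<eta> u \<cdot> v"
      using \<eta>f[OF U(2) a(1)] \<eta>f[OF U(1) Comp_closed[OF v a(1)]] Comp_assoc[OF v a(1) f(1)] Comp_assoc[OF v a(1) h] a(2)
      by simp
  qed
  then obtain h' where h': "h' \<in> Hom C B E" "represents C X B h' \<eta>" using rep unfolding representable_def by blast
  have "h' \<cdot> f \<approx> h"
  proof (rule simI[OF Comp_closed[OF f(1) h'(1)]])
    fix U u assume U: "U \<in> X" and u: "u \<in> Hom C U A"
    show "(h' \<cdot> f) \<cdot> u = h \<cdot> u"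
      using Comp_assoc[OF u f(1) h'(1)] h'(2) \<eta>f[OF U u] U Comp_closed[OF u f(1)] by (simp add: represents_def)
  qed
  with h' show ?thesis by blast
qed

lemma Q_kernel_exists:
  assumes rep: "\<And>A. A \<in> Obj C \<Longrightarrow> representable A" and f: "f \<in> Hom C A B"
  shows "\<exists>k. is_kernel Q k (cls f)"
proof -
  obtain R k where k: "k \<in> Hom C R A" "hom_inj_on C X k"
    "\<And>U u. U \<in> X \<Longrightarrow> u \<in> Hom C U R \<Longrightarrow> f \<cdot> k \<cdot> u = ZeroArr C U B"
    "\<And>U u. U \<in> X \<Longrightarrow> u \<in> Hom C U A \<Longrightarrow> f \<cdot> u = ZeroArr C U B \<Longrightarrow> \<exists>v \<in> Hom C U R. k \<cdot> v = u"
    using kernel_on_X[OF f] by metis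
  have "is_kernel Q (cls k) (cls f)"
  proof (rule Q_is_kernelI[OF f k(1,2)])
    show "f \<cdot> k \<approx> ZeroArr C R B"
      using sim_zero_iff[OF Comp_closed[OF k(1) f]] k(3) Comp_assoc[OF _ k(1) f] by simp
  next
    fix E h assume h: "h \<in> Hom C E A" and fh: "f \<cdot> h \<approx> ZeroArr C E B"
    show "\<exists>h' \<in> Hom C E R. k \<cdot> h' \<approx> h"
    proof (rule kernel_lift[OF rep[OF HomD(4)[OF h]] k(1,2) h])
      fix U u assume U: "U \<in> X" and u: "u \<in> Hom C U E"
      show "\<exists>r \<in> Hom C U R. k \<cdot> r = h \<cdot> u"
        using k(4)[OF U Comp_closed[OF u h]] fh U u Comp_assoc[OF u h f] sim_zero_iff[OF Comp_closed[OF h f]] by simp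
    qed
  qed
  then show ?thesis by blast
qed

text \<open>A monomorphism is shown to be the kernel of its cokernel, and an epimorphism the
  cokernel of its kernel. Exactness is read off on \<open>X\<close>; \<open>kernel_lift\<close> and
  \<open>cokernel_lift\<close> then provide the factorizations.\<close>

lemma representable_imp_abelian:
  assumes rep: "\<And>A. A \<in> Obj C \<Longrightarrow> representable A" shows "abelian_category Q"
proof -
  interpret Q: additive_category Q by (rule Q_additive)
  show ?thesis
  proof
    fix F assume "F \<in> Arr Q"
    then obtain f where f: "f \<in> Hom C (Dom Q F) (Cod Q F)" "F = cls f" by (meson Q_HomE Q.Arr_Hom)
    show "\<exists>k. is_kernel Q k F" using Q_kernel_exists[OF rep f(1)] f(2) by simp
    show "\<exists>c. is_cokernel Q c F"
    proof (rule cokernel_on_X[OF f(1)])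
      fix D c
      assume c: "c \<in> Hom C (Cod Q F) D" "hom_surj_on C X c"
        "\<And>U u. U \<in> X \<Longrightarrow> u \<in> Hom C U (Dom Q F) \<Longrightarrow> c \<cdot> f \<cdot> u = ZeroArr C U D"
        "\<And>E h. h \<in> Hom C (Cod Q F) E \<Longrightarrow>
           (\<And>U u. U \<in> X \<Longrightarrow> u \<in> Hom C U (Dom Q F) \<Longrightarrow> h \<cdot> f \<cdot> u = ZeroArr C U E) \<Longrightarrow> \<exists>h' \<in> Hom C D E. h' \<cdot> c = h"
      have "is_cokernel Q (cls c) (cls f)"
      proof (rule Q_is_cokernelI[OF f(1) c(1,2)])
        show "c \<cdot> f \<approx> ZeroArr C (Dom Q F) D"
          using sim_zero_iff[OF Comp_closed[OF f(1) c(1)]] c(3) Comp_assoc[OF _ f(1) c(1)] by simp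
      next
        fix E h assume h: "h \<in> Hom C (Cod Q F) E" "h \<cdot> f \<approx> ZeroArr C (Dom Q F) E"
        have "\<exists>h' \<in> Hom C D E. h' \<cdot> c = h"
          by (rule c(4)[OF h(1)]) (use sim_zero_iff[OF Comp_closed[OF f(1) h(1)]] h(2) Comp_assoc[OF _ f(1) h(1)] in simp)
        then show "\<exists>h' \<in> Hom C D E. h' \<cdot> c \<approx> h" using sim_refl by blast
      qed
      then show ?thesis using f(2) by blast
    qed
  next
    fix F assume F: "is_mono Q F"
    then have "F \<in> Hom Q (Dom Q F) (Cod Q F)" by (simp add: is_mono_def Hom_def)
    then obtain A B f where f: "f \<in> Hom C A B" "F = cls f" by (meson Q_HomE)
    have inj: "hom_inj_on C X f" using F f Q_mono_iff by simp
    obtain D c where c: "c \<in> Hom C B D" "\<And>U u. U \<in> X \<Longrightarrow> u \<in> Hom C U A \<Longrightarrow> c \<cdot> f \<cdot> u = ZeroArr C U D"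
      "\<And>U u. U \<in> X \<Longrightarrow> u \<in> Hom C U B \<Longrightarrow> c \<cdot> u = ZeroArr C U D \<Longrightarrow> \<exists>v \<in> Hom C U A. f \<cdot> v = u"
      using cokernel_on_X[OF f(1)] by metis
    have "is_kernel Q (cls f) (cls c)"
    proof (rule Q_is_kernelI[OF c(1) f(1) inj])
      show "c \<cdot> f \<approx> ZeroArr C A D"
        using sim_zero_iff[OF Comp_closed[OF f(1) c(1)]] c(2) Comp_assoc[OF _ f(1) c(1)] by simp
    next
      fix E h assume h: "h \<in> Hom C E B" and ch: "c \<cdot> h \<approx> ZeroArr C E D"
      show "\<exists>h' \<in> Hom C E A. f \<cdot> h' \<approx> h"
      proof (rule kernel_lift[OF rep[OF HomD(4)[OF h]] f(1) inj h])
        fix U u assume U: "U \<in> X" and u: "u \<in> Hom C U E"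
        show "\<exists>r \<in> Hom C U A. f \<cdot> r = h \<cdot> u"
          using c(3)[OF U Comp_closed[OF u h]] ch U u Comp_assoc[OF u h c(1)] sim_zero_iff[OF Comp_closed[OF h c(1)]]
          by simp
      qed
    qed
    then show "\<exists>g. is_kernel Q F g" using f(2) by blast
  next
    fix F assume F: "is_epi Q F"
    then have "F \<in> Hom Q (Dom Q F) (Cod Q F)" by (simp add: is_epi_def Hom_def)
    then obtain A B f where f: "f \<in> Hom C A B" "F = cls f" by (meson Q_HomE)
    have surj: "hom_surj_on C X f" using F f Q_epi_iff by simp
    obtain R k where k: "k \<in> Hom C R A"
      "\<And>U u. U \<in> X \<Longrightarrow> u \<in> Hom C U R \<Longrightarrow> f \<cdot> k \<cdot> u = ZeroArr C U B"
      "\<And>U u. U \<in> X \<Longrightarrow> u \<in> Hom C U A \<Longrightarrow> f \<cdot> u = ZeroArr C U B \<Longrightarrow> \<exists>v \<in> Hom C U R. k \<cdot> v = u"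
      using kernel_on_X[OF f(1)] by metis
    have "is_cokernel Q (cls f) (cls k)"
    proof (rule Q_is_cokernelI[OF k(1) f(1) surj])
      show "f \<cdot> k \<approx> ZeroArr C R B"
        using sim_zero_iff[OF Comp_closed[OF k(1) f(1)]] k(2) Comp_assoc[OF _ k(1) f(1)] by simp
    next
      fix E h assume h: "h \<in> Hom C A E" and hk: "h \<cdot> k \<approx> ZeroArr C R E"
      show "\<exists>h' \<in> Hom C B E. h' \<cdot> f \<approx> h"
      proof (rule cokernel_lift[OF rep[OF HomD(5)[OF f(1)]] f(1) surj h])
        fix U u assume U: "U \<in> X" and u: "u \<in> Hom C U A" and fu: "f \<cdot> u = ZeroArr C U B"
        obtain v where v: "v \<in> Hom C U R" "k \<cdot> v = u" using k(3)[OF U u fu] by blast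
        show "h \<cdot> u = ZeroArr C U E"
          using hk sim_zero_iff[OF Comp_closed[OF k(1) h]] U v Comp_assoc[OF v(1) k(1) h] by auto
      qed
    qed
    then show "\<exists>g. is_cokernel Q F g" using f(2) by blast
  qed
qed

lemma decomposable_iff_abelian: "decomposable \<longleftrightarrow> abelian_category Q"
  using abelian_imp_decomposable representable_imp_abelian decomposable_imp_representable by blast

end

section \<open>Fullness of the restricted Yoneda functor\<close>

lemma Ab_cat_Hom_iff:
  "h \<in> Hom Ab_cat G H \<longleftrightarrow>
     (\<exists>f. h = (G, f, H) \<and> comm_group G \<and> comm_group H \<and> f \<in> hom G H \<and> f \<in> extensional (carrier G))"
  by (cases h) (auto simp: Hom_def Ab_cat_def)

context presented_category
begin

section \<open>Presheaves \<open>H(A)\<close> and the arrows between them\<close>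

lemma Obj_X [simp]: "Obj (full_subcat C X) = X"
  using X_Obj by (auto simp: full_subcat_def)

lemma Arr_X [simp]: "f \<in> Arr (full_subcat C X) \<longleftrightarrow> f \<in> Hom C (Dom C f) (Cod C f) \<and> Dom C f \<in> X \<and> Cod C f \<in> X"
  by (auto simp: full_subcat_def Hom_def)

lemma restrict_comp_in_hom:
  assumes f: "f \<in> Hom C U V" and A: "A \<in> Obj C"
  shows "(\<lambda>g \<in> Hom C V A. g \<cdot> f) \<in> hom (hom_group C V A) (hom_group C U A)"
  using f plus_in_Hom by (auto simp: hom_def hom_group_def Comp_closed Comp_add_left)

lemma yoneda_obj_presheaf:
  assumes A: "A \<in> Obj C" shows "yoneda_obj C X A \<in> Obj (presheaf_cat C X)"
proof -
  let ?K = "op_cat (full_subcat C X)"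
  have K: "Obj ?K = X" "Arr ?K = {f \<in> Arr C. Dom C f \<in> X \<and> Cod C f \<in> X}" "Dom ?K = Cod C" "Cod ?K = Dom C"
    "Ide ?K = Ide C" "\<And>g f. g \<cdot>\<^bsub>?K\<^esub> f = f \<cdot> g"
    using X_Obj by (auto simp: op_cat_def full_subcat_def)
  have F: "FObj (yoneda_obj C X A) U = hom_group C U A" if "U \<in> X" for U
    using that by (simp add: yoneda_obj_def)
  have FA: "FArr (yoneda_obj C X A) f = (hom_group C V A, (\<lambda>g \<in> Hom C V A. g \<cdot> f), hom_group C U A)"
    if "f \<in> Hom C U V" "U \<in> X" "V \<in> X" for f U V
    using that by (simp add: yoneda_obj_def Hom_iff)
  have "is_functor ?K Ab_cat (yoneda_obj C X A)"
    unfolding is_functor_def K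
  proof (intro conjI ballI impI)
    fix U assume U: "U \<in> X"
    show "FObj (yoneda_obj C X A) U \<in> Obj Ab_cat" using F[OF U] hom_group[OF X_Obj[OF U] A] by (simp add: Ab_cat_def)
    have "(\<lambda>g \<in> Hom C U A. g \<cdot> Ide C U) = (\<lambda>g \<in> Hom C U A. g)"
      by (rule restrict_ext) (simp add: Ide_right)
    then show "FArr (yoneda_obj C X A) (Ide C U) = Ide Ab_cat (FObj (yoneda_obj C X A) U)"
      using F[OF U] FA[OF Ide_closed[OF X_Obj[OF U]] U U] by (simp add: Ab_cat_def hom_group_def)
  next
    fix f assume "f \<in> {f \<in> Arr C. Dom C f \<in> X \<and> Cod C f \<in> X}"
    then have f: "f \<in> Hom C (Dom C f) (Cod C f)" and U: "Dom C f \<in> X" and V: "Cod C f \<in> X" by (auto simp: Hom_def)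
    show "FArr (yoneda_obj C X A) f \<in> Hom Ab_cat (FObj (yoneda_obj C X A) (Cod C f)) (FObj (yoneda_obj C X A) (Dom C f))"
      using FA[OF f U V] F[OF U] F[OF V] restrict_comp_in_hom[OF f A] hom_group[OF X_Obj[OF U] A] hom_group[OF X_Obj[OF V] A]
      by (simp add: Hom_def[of Ab_cat]) (simp add: Ab_cat_def hom_group_def)
  next
    fix f g assume "f \<in> {f \<in> Arr C. Dom C f \<in> X \<and> Cod C f \<in> X}" "g \<in> {f \<in> Arr C. Dom C f \<in> X \<and> Cod C f \<in> X}"
      "Dom C f = Cod C g"
    then obtain U V W where f: "f \<in> Hom C V W" and g: "g \<in> Hom C U V" and U: "U \<in> X" "V \<in> X" "W \<in> X" by (auto simp: Hom_def)
    have "(\<lambda>u \<in> Hom C W A. u \<cdot> f \<cdot> g) = compose (Hom C W A) (\<lambda>u \<in> Hom C V A. u \<cdot> g) (\<lambda>u \<in> Hom C W A. u \<cdot> f)"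
      unfolding compose_def by (rule restrict_ext) (simp add: Comp_closed[OF f] Comp_assoc[OF g f])
    then show "FArr (yoneda_obj C X A) (f \<cdot> g) = FArr (yoneda_obj C X A) g \<cdot>\<^bsub>Ab_cat\<^esub> FArr (yoneda_obj C X A) f"
      unfolding FA[OF f U(2,3)] FA[OF g U(1,2)] FA[OF Comp_closed[OF g f] U(1,3)]
      by (simp add: Ab_cat_def hom_group_def)
  qed
  moreover have "FObj (yoneda_obj C X A) \<in> extensional (Obj ?K)" "FArr (yoneda_obj C X A) \<in> extensional (Arr ?K)"
    by (simp_all add: yoneda_obj_def op_cat_def full_subcat_def)
  ultimately show ?thesis by (simp add: presheaf_cat_def functor_cat_def Let_def)
qed

text \<open>The restrictions produce the normal form demanded by \<open>functor_cat\<close> and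
  \<open>Ab_cat\<close>, so that two families agreeing on \<open>X\<close> give the same presheaf
  arrow.\<close>

definition family_comp :: "'o \<Rightarrow> 'o \<Rightarrow> ('m \<Rightarrow> 'm) \<Rightarrow> 'o \<Rightarrow> 'm monoid \<times> ('m \<Rightarrow> 'm) \<times> 'm monoid" where
  "family_comp A B \<eta> = (\<lambda>U \<in> X. (hom_group C U A, (\<lambda>u \<in> Hom C U A. \<eta> u), hom_group C U B))"

definition family_arr :: "'o \<Rightarrow> 'o \<Rightarrow> ('m \<Rightarrow> 'm) \<Rightarrow> ('o, 'm) presheaf_arr" where
  "family_arr A B \<eta> = (yoneda_obj C X A, family_comp A B \<eta>, yoneda_obj C X B)"

lemma yoneda_arr_eq: "f \<in> Hom C A B \<Longrightarrow> yoneda_arr C X f = family_arr A B (\<lambda>u. f \<cdot> u)"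
  by (simp add: yoneda_arr_def family_arr_def family_comp_def Hom_iff)

lemma family_arr_eq_iff:
  "family_arr A B \<eta> = family_arr A B \<theta> \<longleftrightarrow> (\<forall>U \<in> X. \<forall>u \<in> Hom C U A. \<eta> u = \<theta> u)"
proof
  assume "family_arr A B \<eta> = family_arr A B \<theta>"
  then have "family_comp A B \<eta> U = family_comp A B \<theta> U" for U by (simp add: family_arr_def)
  then have "(\<lambda>u \<in> Hom C U A. \<eta> u) = (\<lambda>u \<in> Hom C U A. \<theta> u)" if "U \<in> X" for U
    using that unfolding family_comp_def by (metis (no_types, lifting) prod.inject restrict_apply')
  then show "\<forall>U \<in> X. \<forall>u \<in> Hom C U A. \<eta> u = \<theta> u" by (metis restrict_apply')
next
  assume "\<forall>U \<in> X. \<forall>u \<in> Hom C U A. \<eta> u = \<theta> u"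
  then have "family_comp A B \<eta> = family_comp A B \<theta>"
    unfolding family_comp_def by (intro restrict_ext) (auto cong: restrict_cong)
  then show "family_arr A B \<eta> = family_arr A B \<theta>" by (simp add: family_arr_def)
qed

text \<open>The dictionary between transformations of presheaves and single functions on arrows; it
  confines the bookkeeping with extensional homomorphisms to one place.\<close>

lemma presheaf_arr_yoneda_iff:
  assumes A: "A \<in> Obj C" and B: "B \<in> Obj C"
  shows "(yoneda_obj C X A, \<alpha>, yoneda_obj C X B) \<in> Arr (presheaf_cat C X) \<longleftrightarrow>
    (\<exists>\<eta>. nat_family C X A B \<eta> \<and> additive_family C X A \<eta> \<and> \<alpha> = family_comp A B \<eta>)"
    (is "?L \<longleftrightarrow> ?R")
proof -
  let ?K = "op_cat (full_subcat C X)"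
  have K: "Obj ?K = X" "Arr ?K = {f \<in> Arr C. Dom C f \<in> X \<and> Cod C f \<in> X}" "Dom ?K = Cod C" "Cod ?K = Dom C"
    using X_Obj by (auto simp: op_cat_def full_subcat_def)
  have F: "FObj (yoneda_obj C X A) U = hom_group C U A" if "U \<in> X" for U A
    using that by (simp add: yoneda_obj_def)
  have FA: "FArr (yoneda_obj C X A) f = (hom_group C V A, (\<lambda>g \<in> Hom C V A. g \<cdot> f), hom_group C U A)"
    if "f \<in> Hom C U V" "U \<in> X" "V \<in> X" for f U V A
    using that by (simp add: yoneda_obj_def Hom_iff)
  have Arr: "?L \<longleftrightarrow> \<alpha> \<in> extensional X \<and> nat_trans ?K Ab_cat (yoneda_obj C X A) \<alpha> (yoneda_obj C X B)"
    using yoneda_obj_presheaf[OF A] yoneda_obj_presheaf[OF B] K(1)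
    by (simp add: presheaf_cat_def functor_cat_def Let_def)
  have nat: "compose (Hom C V A) (\<lambda>u \<in> Hom C U A. \<eta> u) (\<lambda>u \<in> Hom C V A. u \<cdot> f)
      = compose (Hom C V A) (\<lambda>u \<in> Hom C V B. u \<cdot> f) (\<lambda>u \<in> Hom C V A. \<eta> u) \<longleftrightarrow>
      (\<forall>u \<in> Hom C V A. \<eta> (u \<cdot> f) = \<eta> u \<cdot> f)"
    if f: "f \<in> Hom C U V" and \<eta>: "\<And>u. u \<in> Hom C V A \<Longrightarrow> \<eta> u \<in> Hom C V B" for U V f \<eta>
  proof -
    have "compose (Hom C V A) (\<lambda>u \<in> Hom C U A. \<eta> u) (\<lambda>u \<in> Hom C V A. u \<cdot> f) = (\<lambda>u \<in> Hom C V A. \<eta> (u \<cdot> f))"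
      "compose (Hom C V A) (\<lambda>u \<in> Hom C V B. u \<cdot> f) (\<lambda>u \<in> Hom C V A. \<eta> u) = (\<lambda>u \<in> Hom C V A. \<eta> u \<cdot> f)"
      unfolding compose_def by (auto intro!: restrict_ext simp: Comp_closed[OF f] \<eta>)
    moreover have "(\<lambda>u \<in> Hom C V A. \<eta> (u \<cdot> f)) = (\<lambda>u \<in> Hom C V A. \<eta> u \<cdot> f) \<longleftrightarrow>
      (\<forall>u \<in> Hom C V A. \<eta> (u \<cdot> f) = \<eta> u \<cdot> f)"
      by (auto simp: fun_eq_iff restrict_def)
    ultimately show ?thesis by simp
  qed
  show ?thesis
  proof
    assume ?L
    then have ext: "\<alpha> \<in> extensional X" and nt: "nat_trans ?K Ab_cat (yoneda_obj C X A) \<alpha> (yoneda_obj C X B)"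
      using Arr by simp_all
    \<comment> \<open>The homomorphism stored in the component at \<open>Dom C u\<close>, evaluated
      at \<open>u\<close>.\<close>
    define \<eta> where "\<eta> u = fst (snd (\<alpha> (Dom C u))) u" for u
    have comp: "\<alpha> U = (hom_group C U A, (\<lambda>u \<in> Hom C U A. \<eta> u), hom_group C U B) \<and>
        (\<lambda>u \<in> Hom C U A. \<eta> u) \<in> hom (hom_group C U A) (hom_group C U B)" if U: "U \<in> X" for U
    proof -
      have "\<alpha> U \<in> Hom Ab_cat (hom_group C U A) (hom_group C U B)"
        using nt U F unfolding nat_trans_def K by simp
      then obtain e where e: "\<alpha> U = (hom_group C U A, e, hom_group C U B)"
        "e \<in> hom (hom_group C U A) (hom_group C U B)" "e \<in> extensional (Hom C U A)"
        by (auto simp: Ab_cat_Hom_iff hom_group_def)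
      have "e = (\<lambda>u \<in> Hom C U A. \<eta> u)"
        using e(1) by (intro extensionalityI[OF e(3) restrict_extensional]) (simp add: \<eta>_def Hom_iff)
      then show ?thesis using e by simp
    qed
    have \<eta>: "\<eta> u \<in> Hom C U B" if "U \<in> X" "u \<in> Hom C U A" for U u
      using comp[OF that(1)] that by (auto simp: hom_def hom_group_def Pi_iff)
    have add: "additive_family C X A \<eta>"
      unfolding additive_family_def
    proof (intro ballI)
      fix U u v assume "U \<in> X" "u \<in> Hom C U A" "v \<in> Hom C U A"
      then show "\<eta> (u \<boxplus> v) = \<eta> u \<boxplus> \<eta> v"
        using comp[of U] plus_in_Hom[of u U A v] by (auto simp: hom_def hom_group_def split: if_splits)
    qed
    have "nat_family C X A B \<eta>"
      unfolding nat_family_def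
    proof (intro conjI ballI)
      fix U V f u assume U: "U \<in> X" "V \<in> X" and f: "f \<in> Hom C U V" and u: "u \<in> Hom C V A"
      have "\<alpha> U \<cdot>\<^bsub>Ab_cat\<^esub> FArr (yoneda_obj C X A) f = FArr (yoneda_obj C X B) f \<cdot>\<^bsub>Ab_cat\<^esub> \<alpha> V"
        using nt f U unfolding nat_trans_def K by (auto simp: Hom_iff)
      then show "\<eta> (u \<cdot> f) = \<eta> u \<cdot> f"
        using comp[OF U(1)] comp[OF U(2)] FA[OF f U] nat[OF f \<eta>[OF U(2)]] u
        by (simp add: Ab_cat_def hom_group_def)
    qed (rule \<eta>)
    moreover have "\<alpha> = family_comp A B \<eta>"
      unfolding family_comp_def using comp by (intro extensionalityI[OF ext restrict_extensional]) simp
    ultimately show ?R using add by blast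
  next
    assume ?R
    then obtain \<eta> where \<eta>: "nat_family C X A B \<eta>" "additive_family C X A \<eta>" and \<alpha>: "\<alpha> = family_comp A B \<eta>" by blast
    have "nat_trans ?K Ab_cat (yoneda_obj C X A) \<alpha> (yoneda_obj C X B)"
      unfolding nat_trans_def K
    proof (intro conjI ballI)
      fix U assume U: "U \<in> X"
      have "(\<lambda>u \<in> Hom C U A. \<eta> u) \<in> hom (hom_group C U A) (hom_group C U B)"
        using nat_familyD(1)[OF \<eta>(1) U] \<eta>(2) U plus_in_Hom
        by (auto simp: hom_def hom_group_def additive_family_def)
      then show "\<alpha> U \<in> Hom Ab_cat (FObj (yoneda_obj C X A) U) (FObj (yoneda_obj C X B) U)"
        using F[OF U] hom_group[OF X_Obj[OF U]] A B U
        by (simp add: Hom_def[of Ab_cat] \<alpha> family_comp_def) (simp add: Ab_cat_def hom_group_def)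
    next
      fix f assume "f \<in> {f \<in> Arr C. Dom C f \<in> X \<and> Cod C f \<in> X}"
      then have f: "f \<in> Hom C (Dom C f) (Cod C f)" and U: "Dom C f \<in> X" and V: "Cod C f \<in> X" by (auto simp: Hom_def)
      have "\<forall>u \<in> Hom C (Cod C f) A. \<eta> (u \<cdot> f) = \<eta> u \<cdot> f" using nat_familyD(2)[OF \<eta>(1) V _ U f] by blast
      then show "\<alpha> (Dom C f) \<cdot>\<^bsub>Ab_cat\<^esub> FArr (yoneda_obj C X A) f = FArr (yoneda_obj C X B) f \<cdot>\<^bsub>Ab_cat\<^esub> \<alpha> (Cod C f)"
        unfolding FA[OF f U V] using nat[OF f nat_familyD(1)[OF \<eta>(1) V]] U V
        by (simp add: \<alpha> family_comp_def) (simp add: Ab_cat_def hom_group_def)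
    qed
    moreover have "\<alpha> \<in> extensional X" by (simp add: \<alpha> family_comp_def)
    ultimately show ?L using Arr by simp
  qed
qed

section \<open>The functor \<open>H\<close> with values in coherent functors\<close>

lemma additive_family_comp:
  "f \<in> Hom C A B \<Longrightarrow> additive_family C X A (\<lambda>u. f \<cdot> u)"
  by (simp add: additive_family_def Comp_add_right)

lemma yoneda_arr_presheaf:
  assumes f: "f \<in> Hom C A B"
  shows "(yoneda_obj C X A, family_comp A B (\<lambda>u. f \<cdot> u), yoneda_obj C X B) \<in> Arr (presheaf_cat C X)"
  using presheaf_arr_yoneda_iff[OF HomD(4,5)[OF f]] nat_family_comp[OF f] additive_family_comp[OF f] by blast

text \<open>The approximation \<open>a\<close> covers \<open>H(A)\<close>, and \<open>x\<close> from
  \<open>image_factorization\<close> covers the kernel of \<open>H(a)\<close>; together they present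
  \<open>H(A)\<close> by representables.\<close>

lemma coherent_yoneda_obj:
  assumes A: "A \<in> Obj C" shows "coherent C X (yoneda_obj C X A)"
proof -
  obtain P a where a: "P \<in> X" "a \<in> Hom C P A" "hom_surj_on C X a" using approxE[OF A] .
  obtain N x where x: "N \<in> X" "x \<in> Hom C N P" "a \<cdot> x = ZeroArr C N A"
    "\<And>U s. U \<in> X \<Longrightarrow> s \<in> Hom C U P \<Longrightarrow> a \<cdot> s = ZeroArr C U A \<Longrightarrow> \<exists>s' \<in> Hom C U N. x \<cdot> s' = s"
    using image_factorization[OF a(2,1)] by metis
  have "\<forall>U \<in> X. case (family_comp N P (\<lambda>u. x \<cdot> u) U, family_comp P A (\<lambda>u. a \<cdot> u) U) of
      ((G1, f, G0), (G0', p, K)) \<Rightarrow> p ` carrier G0 = carrier K \<and> kernel G0 K p = f ` carrier G1"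
  proof
    fix U assume U: "U \<in> X"
    have "(\<lambda>u. a \<cdot> u) ` Hom C U P = Hom C U A"
      using hom_surj_onE[OF a(3,2) U] Comp_closed[OF _ a(2)] by (auto simp: image_iff)
    moreover have "{s \<in> Hom C U P. a \<cdot> s = ZeroArr C U A} = (\<lambda>u. x \<cdot> u) ` Hom C U N"
      using x(4)[OF U] Comp_closed[OF _ x(2)] Comp_assoc[OF _ x(2) a(2)] x(3) zero_comp[OF _ A]
      by (auto simp: image_iff)
    moreover have "{s \<in> Hom C U P. (\<lambda>u \<in> Hom C U P. a \<cdot> u) s = ZeroArr C U A} = {s \<in> Hom C U P. a \<cdot> s = ZeroArr C U A}"
      by auto
    ultimately show "case (family_comp N P (\<lambda>u. x \<cdot> u) U, family_comp P A (\<lambda>u. a \<cdot> u) U) of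
      ((G1, f, G0), (G0', p, K)) \<Rightarrow> p ` carrier G0 = carrier K \<and> kernel G0 K p = f ` carrier G1"
      using U by (simp add: family_comp_def hom_group_def kernel_def)
  qed
  then show ?thesis
    unfolding coherent_def
    using yoneda_obj_presheaf[OF A] yoneda_arr_presheaf[OF x(2)] yoneda_arr_presheaf[OF a(2)] x(1) a(1)
    by blast
qed

lemma mod_cat_Hom_iff:
  "H \<in> Hom (mod_cat C X) (yoneda_obj C X A) (yoneda_obj C X B) \<longleftrightarrow>
     (\<exists>\<alpha>. H = (yoneda_obj C X A, \<alpha>, yoneda_obj C X B) \<and> H \<in> Arr (presheaf_cat C X))"
  if "A \<in> Obj C" "B \<in> Obj C"
  using coherent_yoneda_obj that
  by (cases H) (auto simp: Hom_def mod_cat_def full_subcat_def presheaf_cat_def functor_cat_def Let_def)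

lemma mod_cat_Hom_yoneda:
  assumes "A \<in> Obj C" "B \<in> Obj C"
  shows "H \<in> Hom (mod_cat C X) (yoneda_obj C X A) (yoneda_obj C X B) \<longleftrightarrow>
     (\<exists>\<eta>. nat_family C X A B \<eta> \<and> additive_family C X A \<eta> \<and> H = family_arr A B \<eta>)"
  unfolding mod_cat_Hom_iff[OF assms] using presheaf_arr_yoneda_iff[OF assms] by (auto simp: family_arr_def)

lemma yoneda_restr_functor: "is_functor C (mod_cat C X) (yoneda_restr C X)"
  unfolding is_functor_def
proof (intro conjI ballI impI)
  fix A assume A: "A \<in> Obj C"
  show "FObj (yoneda_restr C X) A \<in> Obj (mod_cat C X)"
    using coherent_yoneda_obj[OF A] yoneda_obj_presheaf[OF A] by (simp add: yoneda_restr_def mod_cat_def full_subcat_def)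
  have "yoneda_arr C X (Ide C A) = family_arr A A (\<lambda>u. u)"
    unfolding yoneda_arr_eq[OF Ide_closed[OF A]] family_arr_eq_iff by (simp add: Ide_left)
  then show "FArr (yoneda_restr C X) (Ide C A) = Ide (mod_cat C X) (FObj (yoneda_restr C X) A)"
    by (simp add: yoneda_restr_def mod_cat_def full_subcat_def presheaf_cat_def functor_cat_def Let_def
      family_arr_def family_comp_def)
      (auto simp: op_cat_def full_subcat_def yoneda_obj_def Ab_cat_def hom_group_def fun_eq_iff X_Obj)
next
  fix f assume f: "f \<in> Arr C"
  have "family_arr (Dom C f) (Cod C f) (\<lambda>u. f \<cdot> u) \<in> Hom (mod_cat C X) (yoneda_obj C X (Dom C f)) (yoneda_obj C X (Cod C f))"
    using mod_cat_Hom_yoneda[OF Dom_closed[OF f] Cod_closed[OF f]] nat_family_comp[OF Arr_Hom[OF f]]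
      additive_family_comp[OF Arr_Hom[OF f]] by blast
  then show "FArr (yoneda_restr C X) f \<in> Hom (mod_cat C X) (FObj (yoneda_restr C X) (Dom C f)) (FObj (yoneda_restr C X) (Cod C f))"
    using yoneda_arr_eq[OF Arr_Hom[OF f]] by (simp add: yoneda_restr_def)
next
  fix f g assume "f \<in> Arr C" "g \<in> Arr C" "Cod C f = Dom C g"
  then obtain A B D where f: "f \<in> Hom C A B" and g: "g \<in> Hom C B D" by (auto simp: Hom_def)
  have "compose (Hom C U A) (\<lambda>u \<in> Hom C U B. g \<cdot> u) (\<lambda>u \<in> Hom C U A. f \<cdot> u) = (\<lambda>u \<in> Hom C U A. (g \<cdot> f) \<cdot> u)" for U
    unfolding compose_def by (rule restrict_ext) (simp add: Comp_closed[OF _ f] Comp_assoc[OF _ f g])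
  then show "FArr (yoneda_restr C X) (g \<cdot> f) = FArr (yoneda_restr C X) g \<cdot>\<^bsub>mod_cat C X\<^esub> FArr (yoneda_restr C X) f"
    unfolding yoneda_restr_def ftr.simps yoneda_arr_eq[OF f] yoneda_arr_eq[OF g] yoneda_arr_eq[OF Comp_closed[OF f g]]
    by (simp add: mod_cat_def full_subcat_def presheaf_cat_def functor_cat_def Let_def family_arr_def)
      (auto simp: family_comp_def op_cat_def Ab_cat_def hom_group_def fun_eq_iff X_Obj)
qed

text \<open>The two directions use different strengths: fullness is applied to additive families,
  while the decomposition represents all natural families, in particular those coming from presheaf
  arrows.\<close>

lemma full_iff_decomposable:
  "full_functor C (mod_cat C X) (yoneda_restr C X) \<longleftrightarrow> decomposable"
proof
  assume full: "full_functor C (mod_cat C X) (yoneda_restr C X)"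
  show decomposable
  proof (rule additive_representable_imp_decomposable)
    fix A B \<eta> assume A: "A \<in> Obj C" and B: "B \<in> Obj C" and \<eta>: "nat_family C X A B \<eta>" "additive_family C X A \<eta>"
    have "family_arr A B \<eta> \<in> Hom (mod_cat C X) (yoneda_obj C X A) (yoneda_obj C X B)"
      using mod_cat_Hom_yoneda[OF A B] \<eta> by blast
    then obtain f where f: "f \<in> Hom C A B" "yoneda_arr C X f = family_arr A B \<eta>"
      using full A B unfolding full_functor_def yoneda_restr_def by simp blast
    then show "\<exists>f \<in> Hom C A B. represents C X A f \<eta>"
      using yoneda_arr_eq[OF f(1)] by (auto simp: family_arr_eq_iff represents_def)
  qed
next
  assume dec: decomposable
  show "full_functor C (mod_cat C X) (yoneda_restr C X)"
    unfolding full_functor_def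
  proof (intro conjI ballI yoneda_restr_functor)
    fix A B H assume A: "A \<in> Obj C" and B: "B \<in> Obj C"
      and "H \<in> Hom (mod_cat C X) (FObj (yoneda_restr C X) A) (FObj (yoneda_restr C X) B)"
    then obtain \<eta> where \<eta>: "nat_family C X A B \<eta>" "H = family_arr A B \<eta>"
      using mod_cat_Hom_yoneda[OF A B] by (auto simp: yoneda_restr_def)
    then obtain f where f: "f \<in> Hom C A B" "represents C X A f \<eta>"
      using decomposable_imp_representable[OF dec A] unfolding representable_def by blast
    then have "yoneda_arr C X f = H"
      unfolding yoneda_arr_eq[OF f(1)] \<eta>(2) family_arr_eq_iff by (simp add: represents_def)
    with f(1) show "\<exists>f \<in> Hom C A B. FArr (yoneda_restr C X) f = H" by (auto simp: yoneda_restr_def)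
  qed
qed

end

section \<open>Opposite categories\<close>

lemma op_addcat_simps [simp]:
  "Obj (op_addcat C) = Obj C" "Arr (op_addcat C) = Arr C" "Dom (op_addcat C) = Cod C" "Cod (op_addcat C) = Dom C"
  "Ide (op_addcat C) = Ide C" "g \<cdot>\<^bsub>op_addcat C\<^esub> f = f \<cdot>\<^bsub>C\<^esub> g"
  "ZeroArr (op_addcat C) A B = ZeroArr C B A" "PlusArr (op_addcat C) = PlusArr C"
  by (simp_all add: op_addcat_def op_cat_def cat.extend_def)

lemma Hom_op_addcat [simp]: "Hom (op_addcat C) A B = Hom C B A"
  by (auto simp: Hom_def)

lemma hom_group_op_addcat [simp]: "hom_group (op_addcat C) A B = hom_group C B A"
  by (simp add: hom_group_def)

text \<open>\<open>op_addcat\<close> drops further record fields, whence the type constraint;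
  quotient categories satisfy it.\<close>

lemma op_addcat_op_addcat: "op_addcat (op_addcat (C :: ('o, 'm) addcat)) = C"
  by (simp add: op_addcat_def op_cat_def cat.extend_def)

lemma is_biproduct_op_addcat [simp]: "is_biproduct (op_addcat C) A B P \<longleftrightarrow> is_biproduct C A B P"
  unfolding is_biproduct_def by simp blast

lemma direct_summand_op_addcat [simp]: "direct_summand (op_addcat C) = direct_summand C"
  by (simp add: direct_summand_def fun_eq_iff)

lemma is_zero_object_op_addcat [simp]: "is_zero_object (op_addcat C) Z \<longleftrightarrow> is_zero_object C Z"
  unfolding is_zero_object_def by auto

lemma preadditive_op_addcat:
  assumes "preadditive_category C" shows "preadditive_category (op_addcat C)"
proof -
  interpret preadditive_category C by fact
  show ?thesis
    by (intro preadditive_category.intro category.intro preadditive_category_axioms.intro)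
      (simp_all add: Dom_closed Cod_closed Ide_closed Comp_closed Ide_left Ide_right Comp_assoc
        hom_group Comp_add_left Comp_add_right)
qed

lemma additive_op_addcat:
  assumes "additive_category C" shows "additive_category (op_addcat C)"
proof -
  interpret additive_category C by fact
  show ?thesis
    by (intro additive_category.intro additive_category_axioms.intro preadditive_op_addcat preadditive_category_axioms)
      (simp_all add: zero_object biproducts)
qed

lemma is_kernel_op_addcat [simp]: "is_kernel (op_addcat C) k f \<longleftrightarrow> is_cokernel C k f"
  by (simp add: is_kernel_def is_cokernel_def)

lemma is_cokernel_op_addcat [simp]: "is_cokernel (op_addcat C) c f \<longleftrightarrow> is_kernel C c f"
  by (simp add: is_kernel_def is_cokernel_def)

lemma is_mono_op_addcat [simp]: "is_mono (op_addcat C) f \<longleftrightarrow> is_epi C f"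
  by (simp add: is_mono_def is_epi_def)

lemma is_epi_op_addcat [simp]: "is_epi (op_addcat C) f \<longleftrightarrow> is_mono C f"
  by (simp add: is_mono_def is_epi_def)

lemma abelian_op_addcat:
  assumes "abelian_category C" shows "abelian_category (op_addcat C)"
proof -
  interpret abelian_category C by fact
  show ?thesis
    by (intro abelian_category.intro abelian_category_axioms.intro additive_op_addcat additive_category_axioms)
      (simp_all add: kernels cokernels mono_is_kernel epi_is_cokernel)
qed

lemma abelian_op_addcat_iff: "abelian_category (op_addcat C) \<longleftrightarrow> abelian_category C" for C :: "('o, 'm) addcat"
  using abelian_op_addcat op_addcat_op_addcat by metis

lemma quot_class_op_addcat [simp]: "quot_class (op_addcat C) Z f = quot_class C Z f"
  unfolding quot_class_def factors_through_def neg_arr_def by auto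

text \<open>A residue class is the same set of arrows on both sides, so \<open>SOME\<close> picks
  the same representatives and the quotients are equal, not merely isomorphic.\<close>

lemma quot_cat_op_addcat: "quot_cat (op_addcat C) Z = op_addcat (quot_cat C Z)"
proof -
  have eq: "quot_class (op_addcat C) Z = quot_class C Z" by (simp add: fun_eq_iff)
  show ?thesis
    unfolding quot_cat_def Let_def op_addcat_simps eq by (simp add: op_addcat_def op_cat_def cat.extend_def)
qed

lemma is_iso_op_addcat [simp]: "is_iso (op_addcat C) f \<longleftrightarrow> is_iso C f"
  unfolding is_iso_def by auto

lemma isomorphic_op_addcat: "isomorphic (op_addcat C) A B \<longleftrightarrow> isomorphic C B A"
  by (simp add: isomorphic_def)

lemma split_idempotents_op_addcat [simp]: "split_idempotents (op_addcat C) \<longleftrightarrow> split_idempotents C"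
  unfolding split_idempotents_def by simp blast

lemma subcategory_op_addcat:
  assumes "category C" "subcategory C X" shows "subcategory (op_addcat C) X"
proof -
  interpret category C by fact
  have "isomorphic (op_addcat C) A B \<longleftrightarrow> isomorphic C A B" for A B
    using isomorphic_sym[of A B] isomorphic_sym[of B A] by (auto simp: isomorphic_op_addcat)
  then have "subcategory (op_addcat C) X \<longleftrightarrow> subcategory C X" unfolding subcategory_def by simp
  with assms(2) show ?thesis by simp
qed

lemma contravariantly_finite_op_addcat [simp]:
  "contravariantly_finite (op_addcat C) X \<longleftrightarrow> covariantly_finite C X"
  by (simp add: contravariantly_finite_def covariantly_finite_def)

lemma right_perp_op_addcat [simp]: "right_perp (op_addcat C) X = left_perp C X"
  by (simp add: right_perp_def left_perp_def)

lemma sum_subcat_op_addcat [simp]: "sum_subcat (op_addcat C) \<A> \<B> = sum_subcat C \<A> \<B>"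
  by (simp add: sum_subcat_def)

lemma is_weak_kernel_op_addcat [simp]: "is_weak_kernel (op_addcat C) k f \<longleftrightarrow> is_weak_cokernel C k f"
  by (simp add: is_weak_kernel_def is_weak_cokernel_def)

lemma is_weak_cokernel_op_addcat [simp]: "is_weak_cokernel (op_addcat C) c f \<longleftrightarrow> is_weak_kernel C c f"
  by (simp add: is_weak_kernel_def is_weak_cokernel_def)

section \<open>Triangles\<close>

context triangulated_category
begin

section \<open>The shift as a fully faithful additive functor\<close>

lemma shift_functor: "is_functor T T (Shift T)"
  using shift_full by (simp add: full_functor_def)

lemma ShO_closed: "A \<in> Obj T \<Longrightarrow> ShO T A \<in> Obj T"
  using shift_functor by (simp add: is_functor_def)

lemma ShA_Ide: "A \<in> Obj T \<Longrightarrow> ShA T (Ide T A) = Ide T (ShO T A)"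
  using shift_functor by (simp add: is_functor_def)

lemma ShA_in_Hom: "f \<in> Hom T A B \<Longrightarrow> ShA T f \<in> Hom T (ShO T A) (ShO T B)"
  using shift_functor unfolding is_functor_def Hom_iff[of f] by metis

lemma ShA_Comp: "f \<in> Hom T A B \<Longrightarrow> g \<in> Hom T B D \<Longrightarrow> ShA T (g \<cdot> f) = ShA T g \<cdot> ShA T f"
  using shift_functor unfolding is_functor_def by (simp add: Hom_iff)

lemma ShA_inject: "f \<in> Hom T A B \<Longrightarrow> g \<in> Hom T A B \<Longrightarrow> ShA T f = ShA T g \<Longrightarrow> f = g"
  using shift_faithful HomD(4,5) unfolding faithful_functor_def inj_on_def by metis

lemma ShA_surj:
  assumes "A \<in> Obj T" "B \<in> Obj T" "h \<in> Hom T (ShO T A) (ShO T B)"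
  obtains f where "f \<in> Hom T A B" "ShA T f = h"
  using shift_full assms unfolding full_functor_def by blast

lemma ShA_zero:
  assumes "A \<in> Obj T" "B \<in> Obj T" shows "ShA T (ZeroArr T A B) = ZeroArr T (ShO T A) (ShO T B)"
proof -
  note z = zero_in_Hom[OF assms] note s = ShA_in_Hom[OF z]
  show ?thesis
    using plus_left_cancel[OF s s zero_in_Hom[OF ShO_closed[OF assms(1)] ShO_closed[OF assms(2)]]]
      shift_additive[OF z z] plus_zero(1)[OF z] plus_zero(1)[OF s] by simp
qed

lemma ShA_neg:
  assumes f: "f \<in> Hom T A B" shows "ShA T (neg_arr T f) = neg_arr T (ShA T f)"
  by (rule neg_unique[OF ShA_in_Hom[OF f] ShA_in_Hom[OF neg_in_Hom[OF f]]])
    (simp add: shift_additive[OF f neg_in_Hom[OF f], symmetric] plus_neg[OF f] ShA_zero[OF HomD(4,5)[OF f]])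

lemma ShO_zero_object: "is_zero_object T Z \<Longrightarrow> is_zero_object T (ShO T Z)"
  unfolding zero_object_iff using ShO_closed ShA_Ide ShA_zero by metis

section \<open>Exactness properties of triangles\<close>

lemma triangle_Hom:
  assumes "is_triangle T A B C u v w"
  shows "u \<in> Hom T A B" "v \<in> Hom T B C" "w \<in> Hom T C (ShO T A)"
  using assms by (simp_all add: is_triangle_def is_candidate_triangle_def)

lemma triangle_rotate:
  assumes "is_triangle T A B C u v w"
  shows "is_triangle T B C (ShO T A) v w (neg_arr T (ShA T u))"
  using TR2[of A B C u v w] assms by (simp add: is_triangle_def)

text \<open>This is the identity triangle on \<open>E\<close> rotated backwards; it applies because
  the shift of a zero object is zero and the sign on a zero arrow disappears.\<close>

lemma triangle_zero_left:
  assumes Z: "is_zero_object T Z" and E: "E \<in> Obj T"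
  shows "is_triangle T Z E E (ZeroArr T Z E) (Ide T E) (ZeroArr T E (ShO T Z))"
proof -
  have ZO: "Z \<in> Obj T" using Z by (simp add: zero_object_iff)
  have "is_candidate_triangle T Z E E (ZeroArr T Z E) (Ide T E) (ZeroArr T E (ShO T Z))"
    unfolding is_candidate_triangle_def using zero_in_Hom Ide_closed ShO_closed ZO E by simp
  from TR2[OF this] show ?thesis
    using TR1_id[OF E ShO_zero_object[OF Z]] by (simp add: ShA_zero[OF ZO E] neg_zero[OF ShO_closed[OF ZO] ShO_closed[OF E]])
qed

text \<open>TR3 maps the identity triangle on \<open>A\<close> into the given one by the identity
  and \<open>u\<close>, so the composite factors through a zero object.\<close>

lemma triangle_comp_zero:
  assumes t: "is_triangle T A B C u v w" shows "v \<cdot> u = ZeroArr T A C"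
proof -
  note h = triangle_Hom[OF t]
  obtain Z where Z: "is_zero_object T Z" using zero_object by blast
  note A = HomD(4)[OF h(1)]
  have ZO: "Z \<in> Obj T" using Z by (simp add: zero_object_iff)
  obtain k where k: "k \<in> Hom T Z C" "k \<cdot> ZeroArr T A Z = v \<cdot> u"
    using TR3[OF TR1_id[OF A Z] t Ide_closed[OF A] h(1)] by blast
  then show ?thesis using comp_zero[OF k(1) A] by simp
qed

text \<open>An arrow \<open>g\<close> that kills \<open>u\<close> is a morphism on the first two
  vertices to the triangle on a zero object, \<open>E\<close> and \<open>E\<close>; the third arrow
  from TR3 is the factorization.\<close>

lemma triangle_weak_cokernel:
  assumes t: "is_triangle T A B C u v w" shows "is_weak_cokernel T v u"
  unfolding is_weak_cokernel_def
proof (intro conjI allI ballI impI)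
  note h = triangle_Hom[OF t] note A = HomD(4)[OF h(1)]
  show "u \<in> Arr T" "v \<in> Arr T" "Dom T v = Cod T u" "v \<cdot> u = ZeroArr T (Dom T u) (Cod T v)"
    using h triangle_comp_zero[OF t] by (simp_all add: Hom_iff)
  fix E g assume "g \<in> Hom T (Cod T u) E" "g \<cdot> u = ZeroArr T (Dom T u) E"
  then have g: "g \<in> Hom T B E" and gu: "g \<cdot> u = ZeroArr T A E" using h by (simp_all add: Hom_iff)
  obtain Z where Z: "is_zero_object T Z" using zero_object by blast
  have ZO: "Z \<in> Obj T" using Z by (simp add: zero_object_iff)
  note z = zero_in_Hom[OF ZO HomD(5)[OF g]]
  have "g \<cdot> u = ZeroArr T Z E \<cdot> ZeroArr T A Z" using gu comp_zero[OF z A] by simp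
  from TR3[OF t triangle_zero_left[OF Z HomD(5)[OF g]] zero_in_Hom[OF A ZO] g this]
  obtain k where "k \<in> Hom T C E" "k \<cdot> v = Ide T E \<cdot> g" by blast
  then show "\<exists>h' \<in> Hom T (Cod T v) E. h' \<cdot> v = g" using Ide_left[OF g] HomD(3)[OF h(2)] by auto
qed

text \<open>TR3 fills in the third arrow, not the first. So both triangles are rotated, the arrow
  found between the shifted vertices is pulled back by full faithfulness, and the two rotation signs
  cancel.\<close>

lemma triangle_weak_kernel:
  assumes t: "is_triangle T A B C u v w" shows "is_weak_kernel T u v"
  unfolding is_weak_kernel_def
proof (intro conjI allI ballI impI)
  note h = triangle_Hom[OF t] note A = HomD(4)[OF h(1)]
  show "v \<in> Arr T" "u \<in> Arr T" "Cod T u = Dom T v" "v \<cdot> u = ZeroArr T (Dom T u) (Cod T v)"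
    using h triangle_comp_zero[OF t] by (simp_all add: Hom_iff)
  fix E g assume "g \<in> Hom T E (Dom T v)" "v \<cdot> g = ZeroArr T E (Cod T v)"
  then have g: "g \<in> Hom T E B" and vg: "v \<cdot> g = ZeroArr T E C" using h by (simp_all add: Hom_iff)
  note E = HomD(4)[OF g]
  obtain Z where Z: "is_zero_object T Z" using zero_object by blast
  have ZO: "Z \<in> Obj T" using Z by (simp add: zero_object_iff)
  note z = zero_in_Hom[OF ZO HomD(5)[OF h(2)]]
  have t': "is_triangle T E Z (ShO T E) (ZeroArr T E Z) (ZeroArr T Z (ShO T E)) (neg_arr T (Ide T (ShO T E)))"
    using triangle_rotate[OF TR1_id[OF E Z]] ShA_Ide[OF E] by simp
  have "ZeroArr T Z C \<cdot> ZeroArr T E Z = v \<cdot> g" using vg comp_zero[OF z E] by simp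
  from TR3[OF t' triangle_rotate[OF t] g z this]
  obtain k where k: "k \<in> Hom T (ShO T E) (ShO T A)" "ShA T g \<cdot> neg_arr T (Ide T (ShO T E)) = neg_arr T (ShA T u) \<cdot> k" by blast
  obtain g' where g': "g' \<in> Hom T E A" "ShA T g' = k" using ShA_surj[OF E A k(1)] .
  have "neg_arr T (ShA T g) = neg_arr T (ShA T (u \<cdot> g'))"
    using k(2) comp_neg[OF Ide_closed[OF ShO_closed[OF E]] ShA_in_Hom[OF g]] Ide_right[OF ShA_in_Hom[OF g]]
      neg_comp[OF k(1) ShA_in_Hom[OF h(1)]] ShA_Comp[OF g'(1) h(1)] g'(2) by simp
  from arg_cong[OF this, of "neg_arr T"] have "ShA T g = ShA T (u \<cdot> g')"
    unfolding neg_neg[OF ShA_in_Hom[OF g]] neg_neg[OF ShA_in_Hom[OF Comp_closed[OF g'(1) h(1)]]] .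
  then have "u \<cdot> g' = g" using ShA_inject[OF g Comp_closed[OF g'(1) h(1)]] by simp
  then show "\<exists>h' \<in> Hom T E (Dom T u). u \<cdot> h' = g" using g'(1) HomD(2)[OF h(1)] by auto
qed

text \<open>Since the shift is only an equivalence, \<open>D\<close> is merely isomorphic to a
  shifted object. The triangle is first transported along the isomorphism by TR1, and then TR2 is
  read backwards.\<close>

lemma triangle_unrotate:
  assumes t: "is_triangle T B C D f x y" and A: "A \<in> Obj T" and iso: "isomorphic T (ShO T A) D"
  obtains u w where "is_triangle T A B C u f w"
proof -
  note h = triangle_Hom[OF t] note B = HomD(4)[OF h(1)] and C = HomD(5)[OF h(1)]
  obtain \<phi> \<psi> where \<phi>: "\<phi> \<in> Hom T (ShO T A) D" and \<psi>: "\<psi> \<in> Hom T D (ShO T A)" "is_iso T \<psi>"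
    and e: "\<phi> \<cdot> \<psi> = Ide T D" using isomorphic_obtain[OF iso] by metis
  note x' = Comp_closed[OF h(2) \<psi>(1)] and y' = Comp_closed[OF \<phi> h(3)]
  \<comment> \<open>The sign anticipates the one in TR2, so that the negative of the shifted
    \<open>u\<close> is exactly the third arrow of the transported triangle.\<close>
  obtain u where u: "u \<in> Hom T A B" "ShA T u = neg_arr T (y \<cdot> \<phi>)" using ShA_surj[OF A B neg_in_Hom[OF y']] .
  have "is_triangle T B C (ShO T A) f (\<psi> \<cdot> x) (y \<cdot> \<phi>)"
  proof (rule TR1_iso[OF t _ Ide_closed[OF B] Ide_closed[OF C] \<psi>(1) is_iso_Ide[OF B] is_iso_Ide[OF C] \<psi>(2)])
    show "is_candidate_triangle T B C (ShO T A) f (\<psi> \<cdot> x) (y \<cdot> \<phi>)"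
      unfolding is_candidate_triangle_def using h(1) x' y' by simp
    show "Ide T C \<cdot> f = f \<cdot> Ide T B" using Ide_left[OF h(1)] Ide_right[OF h(1)] by simp
    show "\<psi> \<cdot> x = (\<psi> \<cdot> x) \<cdot> Ide T C" using Ide_right[OF x'] by simp
    show "ShA T (Ide T B) \<cdot> y = (y \<cdot> \<phi>) \<cdot> \<psi>"
      using ShA_Ide[OF B] Ide_left[OF h(3)] Comp_assoc[OF \<psi>(1) \<phi> h(3)] e Ide_right[OF h(3)] by simp
  qed
  moreover have "neg_arr T (ShA T u) = y \<cdot> \<phi>" using u(2) neg_neg[OF y'] by simp
  moreover have "is_candidate_triangle T A B C u f (\<psi> \<cdot> x)"
    unfolding is_candidate_triangle_def using h(1) x' u(1) by simp
  ultimately have "is_triangle T A B C u f (\<psi> \<cdot> x)" using TR2 by simp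
  with that show thesis .
qed

lemma unshift_obtain:
  assumes "D \<in> Obj T" obtains A where "A \<in> Obj T" "isomorphic T (ShO T A) D"
  using shift_ess_surjective assms unfolding ess_surjective_def by blast

lemma cocone:
  assumes "f \<in> Hom T B C" obtains A u w where "is_triangle T A B C u f w"
proof -
  obtain D x y where t: "is_triangle T B C D f x y" using TR1_cone[OF assms] by blast
  obtain A where "A \<in> Obj T" "isomorphic T (ShO T A) D" using unshift_obtain[OF HomD(5)[OF triangle_Hom(2)[OF t]]] .
  with triangle_unrotate[OF t] that show thesis by metis
qed

section \<open>Rigid subcategories: the two instances of the presented setting\<close>

lemma rigid_zero:
  assumes "rigid T X" "X \<subseteq> Obj T" "U \<in> X" "V \<in> X" "f \<in> Hom T U (ShO T V)"
  shows "f = ZeroArr T U (ShO T V)"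
proof -
  have "ShO T V \<in> shift_subcat T X"
    unfolding shift_subcat_def using ShO_closed isomorphic_refl assms(2,4) by blast
  then show ?thesis using assms(1,3,5) unfolding rigid_def by blast
qed

text \<open>Rotation identifies the summands of cones of arrows in \<open>X\<close> with the objects
  of \<open>X \<star> X[1]\<close>. Rigidity is what makes the second arrow of such a triangle
  surjective under \<open>H\<close>.\<close>

lemma star_presented_category:
  assumes split: "split_idempotents T" and sub: "subcategory T X" and rigid: "rigid T X"
    and fin: "contravariantly_finite T X"
  shows "presented_category T X (star_subcat T X (shift_subcat T X))"
proof (intro presented_category.intro presented_category_axioms.intro additive_category_axioms split sub fin)
  have X: "X \<subseteq> Obj T" using sub by (simp add: subcategory_def)
  show "\<exists>k. is_weak_kernel T k f" if "f \<in> Arr T" for f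
    using cocone[OF Arr_Hom[OF that]] triangle_weak_kernel by metis
  show "\<exists>c. is_weak_cokernel T c p \<and> is_weak_kernel T p c \<and> hom_surj_on T X c \<and>
      (Cod T p \<in> X \<longrightarrow> Cod T c \<in> star_subcat T X (shift_subcat T X))"
    if p: "p \<in> Arr T" "Dom T p \<in> X" for p
  proof -
    obtain D c w where t: "is_triangle T (Dom T p) (Cod T p) D p c w" using TR1_cone[OF Arr_Hom[OF p(1)]] by blast
    note h = triangle_Hom[OF t] note c = HomD(2,3)[OF h(2)] and t' = triangle_rotate[OF t]
    have "hom_surj_on T X c"
      unfolding hom_surj_on_def c
    proof (intro ballI)
      fix U g assume U: "U \<in> X" and g: "g \<in> Hom T U D"
      \<comment> \<open>The obstruction to lifting \<open>g\<close> along \<open>c\<close> is an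
        arrow from \<open>X\<close> to \<open>X[1]\<close>.\<close>
      have "w \<cdot> g = ZeroArr T U (ShO T (Dom T p))" by (rule rigid_zero[OF rigid X U p(2) Comp_closed[OF g h(3)]])
      then show "\<exists>g' \<in> Hom T U (Cod T p). c \<cdot> g' = g"
        using weak_kernelE[OF triangle_weak_kernel[OF t'] h(3,2) g] by metis
    qed
    moreover have "D \<in> star_subcat T X (shift_subcat T X)" if "Cod T p \<in> X"
    proof -
      have "ShO T (Dom T p) \<in> shift_subcat T X"
        unfolding shift_subcat_def using ShO_closed isomorphic_refl X p(2) by blast
      with that t' direct_summand_refl[OF HomD(5)[OF h(2)]] show ?thesis unfolding star_subcat_def by blast
    qed
    ultimately show ?thesis using triangle_weak_cokernel[OF t] triangle_weak_kernel[OF t] c by blast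
  qed
  show "\<exists>x q. Dom T x \<in> X \<and> Cod T x \<in> X \<and> is_weak_cokernel T q x \<and> hom_surj_on T X q \<and> direct_summand T D (Cod T q)"
    if "D \<in> star_subcat T X (shift_subcat T X)" for D
  proof -
    from that obtain A U V u v w where D: "direct_summand T D A" and U: "U \<in> X" and V: "V \<in> shift_subcat T X"
      and t: "is_triangle T U A V u v w" unfolding star_subcat_def by blast
    note h = triangle_Hom[OF t]
    obtain N where N: "N \<in> X" "isomorphic T (ShO T N) V" using V isomorphic_sym unfolding shift_subcat_def by blast
    \<comment> \<open>Rotating \<open>V\<close> back to \<open>N\<close> exhibits \<open>A\<close>
      as the cone of an arrow between objects of \<open>X\<close>.\<close>
    obtain x w' where t': "is_triangle T N U A x u w'" using triangle_unrotate[OF t _ N(2)] N(1) X by blast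
    note x = triangle_Hom(1)[OF t']
    have "hom_surj_on T X u"
      unfolding hom_surj_on_def HomD(2,3)[OF h(1)]
    proof (intro ballI)
      fix W g assume W: "W \<in> X" and g: "g \<in> Hom T W A"
      have "v \<cdot> g = ZeroArr T W V" using rigid W V Comp_closed[OF g h(2)] unfolding rigid_def by blast
      then show "\<exists>g' \<in> Hom T W U. u \<cdot> g' = g"
        using weak_kernelE[OF triangle_weak_kernel[OF t] h(2,1) g] by metis
    qed
    then show ?thesis using D HomD(3)[OF h(1)] HomD(2,3)[OF x] N(1) U triangle_weak_cokernel[OF t'] by metis
  qed
qed

text \<open>The dual properties are verified inside \<open>T\<close>: a cone in the opposite
  category is a cocone \<open>K\<close> of an arrow into \<open>X\<close>, and an object of
  \<open>X[-1] \<star> X\<close> is a summand of such a cocone. The price is that extension problems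
  are solved after shifting and then pulled back.\<close>

lemma costar_presented_category:
  assumes split: "split_idempotents T" and sub: "subcategory T X" and rigid: "rigid T X"
    and fin: "covariantly_finite T X"
  shows "presented_category (op_addcat T) X (star_subcat T (unshift_subcat T X) X)"
proof (intro presented_category.intro presented_category_axioms.intro additive_op_addcat additive_category_axioms
    subcategory_op_addcat category_axioms sub; unfold op_addcat_simps split_idempotents_op_addcat
    contravariantly_finite_op_addcat is_weak_kernel_op_addcat is_weak_cokernel_op_addcat direct_summand_op_addcat)
  show "split_idempotents T" "covariantly_finite T X" by fact+
  have X: "X \<subseteq> Obj T" using sub by (simp add: subcategory_def)
  have iso: "B \<in> X" if "A \<in> X" "isomorphic T A B" "B \<in> Obj T" for A B
    using sub that unfolding subcategory_def by blast
  show "\<exists>k. is_weak_cokernel T k f" if "f \<in> Arr T" for f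
    using TR1_cone[OF Arr_Hom[OF that]] triangle_weak_cokernel by metis
  show "\<exists>c. is_weak_kernel T c p \<and> is_weak_cokernel T p c \<and> hom_surj_on (op_addcat T) X c \<and>
      (Dom T p \<in> X \<longrightarrow> Dom T c \<in> star_subcat T (unshift_subcat T X) X)"
    if p: "p \<in> Arr T" "Cod T p \<in> X" for p
  proof -
    obtain K c w where t: "is_triangle T K (Dom T p) (Cod T p) c p w" using cocone[OF Arr_Hom[OF p(1)]] .
    note h = triangle_Hom[OF t] note c = HomD(2,3)[OF h(1)] and t' = triangle_rotate[OF triangle_rotate[OF t]]
    note Sc = ShA_in_Hom[OF h(1)]
    have "hom_surj_on (op_addcat T) X c"
      unfolding hom_surj_on_def op_addcat_simps Hom_op_addcat c
    proof (intro ballI)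
      fix U g assume U: "U \<in> X" and g: "g \<in> Hom T K U"
      note Sg = ShA_in_Hom[OF g]
      \<comment> \<open>The obstruction to extending \<open>g\<close> along \<open>c\<close>, an
        arrow from \<open>X\<close> to \<open>X[1]\<close>.\<close>
      have "ShA T g \<cdot> w = ZeroArr T (Cod T p) (ShO T U)" by (rule rigid_zero[OF rigid X p(2) U Comp_closed[OF h(3) Sg]])
      then obtain k where k: "k \<in> Hom T (ShO T (Dom T p)) (ShO T U)" "k \<cdot> neg_arr T (ShA T c) = ShA T g"
        using weak_cokernelE[OF triangle_weak_cokernel[OF t'] h(3) neg_in_Hom[OF Sc] Sg] by blast
      obtain g' where g': "g' \<in> Hom T (Dom T p) U" "ShA T g' = k" using ShA_surj[OF HomD(5)[OF h(1)] HomD(5)[OF g] k(1)] .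
      note n = neg_in_Hom[OF g'(1)]
      \<comment> \<open>The double rotation puts a minus sign on the shifted \<open>c\<close>;
        negating \<open>g'\<close> absorbs it.\<close>
      have "ShA T ((neg_arr T g') \<cdot> c) = ShA T g"
        using ShA_Comp[OF h(1) n] ShA_neg[OF g'(1)] g'(2) neg_comp[OF Sc k(1)] comp_neg[OF Sc k(1)] k(2) by simp
      then show "\<exists>g' \<in> Hom T (Dom T p) U. g' \<cdot> c = g" using ShA_inject[OF Comp_closed[OF h(1) n] g] n by blast
    qed
    moreover have "K \<in> star_subcat T (unshift_subcat T X) X" if D: "Dom T p \<in> X"
    proof -
      obtain V where V: "V \<in> Obj T" "isomorphic T (ShO T V) (Cod T p)" using unshift_obtain[OF Cod_closed[OF p(1)]] .
      then have "V \<in> unshift_subcat T X"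
        unfolding unshift_subcat_def using iso[OF p(2) isomorphic_sym ShO_closed] by blast
      moreover obtain u w' where "is_triangle T V K (Dom T p) u c w'" using triangle_unrotate[OF t V] .
      ultimately show ?thesis using D direct_summand_refl[OF HomD(4)[OF h(1)]] unfolding star_subcat_def by blast
    qed
    ultimately show ?thesis using triangle_weak_cokernel[OF t] triangle_weak_kernel[OF t] c by blast
  qed
  show "\<exists>x q. Cod T x \<in> X \<and> Dom T x \<in> X \<and> is_weak_kernel T q x \<and> hom_surj_on (op_addcat T) X q \<and> direct_summand T D (Dom T q)"
    if "D \<in> star_subcat T (unshift_subcat T X) X" for D
  proof -
    from that obtain A U V u v w where D: "direct_summand T D A" and V: "V \<in> unshift_subcat T X" and U: "U \<in> X"
      and t: "is_triangle T V A U u v w" unfolding star_subcat_def by blast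
    note h = triangle_Hom[OF t]
    have SV: "ShO T V \<in> X" using V unfolding unshift_subcat_def by blast
    have "hom_surj_on (op_addcat T) X v"
      unfolding hom_surj_on_def op_addcat_simps Hom_op_addcat HomD(2,3)[OF h(2)]
    proof (intro ballI)
      fix W g assume W: "W \<in> X" and g: "g \<in> Hom T A W"
      note gu = Comp_closed[OF h(1) g]
      \<comment> \<open>\<open>V\<close> lies in \<open>X[-1]\<close>, so rigidity applies only
        after one shift; faithfulness brings the vanishing back.\<close>
      have "ShA T (g \<cdot> u) = ShA T (ZeroArr T V W)"
        using rigid_zero[OF rigid X SV W ShA_in_Hom[OF gu]] ShA_zero[OF HomD(4,5)[OF gu]] by simp
      then have "g \<cdot> u = ZeroArr T V W" using ShA_inject[OF gu zero_in_Hom[OF HomD(4,5)[OF gu]]] by simp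
      then show "\<exists>g' \<in> Hom T U W. g' \<cdot> v = g"
        using weak_cokernelE[OF triangle_weak_cokernel[OF t] h(1,2) g] by metis
    qed
    \<comment> \<open>The witnesses are \<open>w\<close>, from \<open>U\<close> to the shift of
      \<open>V\<close>, and \<open>v\<close>, which is a weak kernel of \<open>w\<close> by
      rotation.\<close>
    then show ?thesis using D HomD(2)[OF h(2)] HomD(2,3)[OF h(3)] SV U triangle_weak_kernel[OF triangle_rotate[OF t]] by metis
  qed
qed

end

theorem proposition4p16:
  fixes T :: "('o, 'm) tricat" and X :: "'o set"
  assumes "triangulated_category T"
    and "split_idempotents T"
    and "subcategory T X"
    and "rigid T X"
  shows
    "(contravariantly_finite T X \<longrightarrow>
        (full_functor T (mod_cat T X) (yoneda_restr T X)
           \<longleftrightarrow> Obj T = sum_subcat T (star_subcat T X (shift_subcat T X)) (right_perp T X)) \<and>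
        (Obj T = sum_subcat T (star_subcat T X (shift_subcat T X)) (right_perp T X)
           \<longleftrightarrow> abelian_category (quot_cat T (right_perp T X)))) \<and>
     (covariantly_finite T X \<longrightarrow>
        (full_functor (op_addcat T) (mod_cat (op_addcat T) X) (yoneda_restr (op_addcat T) X)
           \<longleftrightarrow> Obj T = sum_subcat T (star_subcat T (unshift_subcat T X) X) (left_perp T X)) \<and>
        (Obj T = sum_subcat T (star_subcat T (unshift_subcat T X) X) (left_perp T X)
           \<longleftrightarrow> abelian_category (quot_cat T (left_perp T X))))"
proof (intro conjI impI)
  interpret triangulated_category T by fact
  {
    assume fin: "contravariantly_finite T X"
    interpret P: presented_category T X "star_subcat T X (shift_subcat T X)"
      by (rule star_presented_category[OF assms(2-4) fin])
    show "full_functor T (mod_cat T X) (yoneda_restr T X)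
        \<longleftrightarrow> Obj T = sum_subcat T (star_subcat T X (shift_subcat T X)) (right_perp T X)"
      using P.full_iff_decomposable unfolding P.decomposable_def .
    show "Obj T = sum_subcat T (star_subcat T X (shift_subcat T X)) (right_perp T X)
        \<longleftrightarrow> abelian_category (quot_cat T (right_perp T X))"
      using P.decomposable_iff_abelian unfolding P.decomposable_def .
  }
  {
    assume fin: "covariantly_finite T X"
    interpret P: presented_category "op_addcat T" X "star_subcat T (unshift_subcat T X) X"
      by (rule costar_presented_category[OF assms(2-4) fin])
    show "full_functor (op_addcat T) (mod_cat (op_addcat T) X) (yoneda_restr (op_addcat T) X)
        \<longleftrightarrow> Obj T = sum_subcat T (star_subcat T (unshift_subcat T X) X) (left_perp T X)"
      using P.full_iff_decomposable
      unfolding P.decomposable_def op_addcat_simps sum_subcat_op_addcat right_perp_op_addcat .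
    show "Obj T = sum_subcat T (star_subcat T (unshift_subcat T X) X) (left_perp T X)
        \<longleftrightarrow> abelian_category (quot_cat T (left_perp T X))"
      \<comment> \<open>Being abelian is self-dual and the quotient commutes with passing to the
        opposite, so the statement returns to \<open>T\<close>.\<close>
      using P.decomposable_iff_abelian
      unfolding P.decomposable_def op_addcat_simps sum_subcat_op_addcat right_perp_op_addcat
        quot_cat_op_addcat abelian_op_addcat_iff .
  }
qed

end
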